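(* Let $([\cdot,\cdot],\rho,\alpha)$ be a Loday algebroid structure on a vector bundle $E$ over a manifold $M$, and let $\partial=\partial_B$ be the associated coboundary operator on $\mathcal{D}^\bullet(E)$, $B=([\cdot,\cdot],\rho)$. For $X\in\mathrm{Sec}(E)$ let $i_X$ be the contraction and $\mathcal{L}_X=\partial i_X+i_X\partial$ the Lie derivative. The graded derivations $\partial$, $i_X$, $\mathcal{L}_X$ of $\mathcal{D}^\bullet(E)$ satisfy, for all $X,Y\in\mathrm{Sec}(E)$: (a) $2\partial^2=[\partial,\partial]_{\mathrm{sc}}=0$; (b) $\mathcal{L}_X=[\partial,i_X]_{\mathrm{sc}}=\partial i_X+i_X\partial$; (c) $\partial\mathcal{L}_X-\mathcal{L}_X\partial=[\partial,\mathcal{L}_X]_{\mathrm{sc}}=0$; (d) $\mathcal{L}_Xi_Y-i_Y\mathcal{L}_X=[\mathcal{L}_X,i_Y]_{\mathrm{sc}}=i_{[X,Y]}$; (e) $\mathcal{L}_X\mathcal{L}_Y-\mathcal{L}_Y\mathcal{L}_X=[\mathcal{L}_X,\mathcal{L}_Y]_{\mathrm{sc}}=\mathcal{L}_{[X,Y]}$.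
   Context: All manifolds, bundles and sections are smooth; $\mathrm{Sec}(E)$ is the space of sections of $E$. A Loday algebroid structure on $E$ consists of an $\mathbb{R}$-bilinear bracket on $\mathrm{Sec}(E)$ with $[X,[Y,Z]]=[[X,Y],Z]+[Y,[X,Z]]$ and vector bundle morphisms $\rho:E\to TM$, $\alpha:E\to TM\otimes_M\mathrm{End}(E)$ over the identity of $M$ such that $[X,fY]=f[X,Y]+\rho(X)(f)Y$ and $[fX,Y]=f[X,Y]-\rho(Y)(f)X+\alpha(Y)(\mathrm{d}f\otimes X)$ for all $X,Y\in\mathrm{Sec}(E)$, $f\in C^\infty(M)$, where $(V\otimes\Phi)(\omega\otimes X)=\langle V,\omega\rangle\Phi(X)$. (Equivalently, the Loday bracket is bidifferential of total order $\le1$ and each $[X,\cdot]$ is a derivative endomorphism; then $\rho$ satisfies $\rho([X,Y])=[\rho(X),\rho(Y)]_{vf}$.) $\mathcal{D}^p(E)$ is the space of $\mathbb{R}$-$p$-linear multidifferential operators (differential operators of bounded order in each variable) $\mathrm{Sec}(E)^{\times p}\to C^\infty(M)$, $\mathcal{D}^0(E)=C^\infty(M)$, $\mathcal{D}^\bullet(E)=\bigoplus_{p\ge0}\mathcal{D}^p(E)$. It is a graded commutative associative algebra under the shuffle product $(\ell'\pitchfork\ell'')(X_1,\dots,X_{p+q})=\sum_{\sigma\in\mathrm{sh}(p,q)}\mathrm{sign}(\sigma)\,\ell'(X_{\sigma_1},\dots,X_{\sigma_p})\,\ell''(X_{\sigma_{p+1}},\dots,X_{\sigma_{p+q}})$,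 the sum being over $(p,q)$-shuffles. The operator $\partial_B:\mathcal{D}^p(E)\to\mathcal{D}^{p+1}(E)$ is $$(\partial_Bc)(X_1,\dots,X_{p+1})=\sum_{i=1}^{p+1}(-1)^{i+1}\rho(X_i)\big(c(X_1,\dots\hat{\imath}\dots,X_{p+1})\big)+\sum_{i<j}(-1)^i\,c(X_1,\dots\hat{\imath}\dots,[X_i,X_j],\dots,X_{p+1}),$$ where $\hat{\imath}$ means that $X_i$ is omitted and $[X_i,X_j]$ replaces $X_j$ in its place. The contraction is $i_X:\mathcal{D}^p(E)\to\mathcal{D}^{p-1}(E)$, $(i_X\ell)(X_1,\dots,X_{p-1})=\ell(X,X_1,\dots,X_{p-1})$, and $i_X=0$ on $\mathcal{D}^0(E)$. $[\cdot,\cdot]_{\mathrm{sc}}$ is the graded commutator (supercommutator) of graded operators on $\mathcal{D}^\bullet(E)$, $[P,Q]_{\mathrm{sc}}=PQ-(-1)^{\deg P\deg Q}QP$; $\partial$, $i_X$, $\mathcal{L}_X$ have degrees $1,-1,0$. *)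

theory Defs
  imports
    "HOL-Analysis.Analysis"
    "HOL-Library.Function_Algebras"
    "HOL-Combinatorics.Permutations"
begin

text \<open>Pointwise real vector space structure on functions; the additive structure is the one of
  \<^theory>\<open>HOL-Library.Function_Algebras\<close>.\<close>

instantiation "fun" :: (type, real_vector) real_vector
begin

definition scaleR_fun :: "real \<Rightarrow> ('a \<Rightarrow> 'b) \<Rightarrow> 'a \<Rightarrow> 'b"
  where "scaleR_fun r f = (\<lambda>x. r *\<^sub>R f x)"

instance
  by standard (simp_all add: scaleR_fun_def fun_eq_iff algebra_simps)

end

definition linear_between ::
    "'a::real_vector set \<Rightarrow> 'b::real_vector set \<Rightarrow> ('a \<Rightarrow> 'b) \<Rightarrow> bool" where
  "linear_between V W f \<longleftrightarrow>
     f ` V \<subseteq> W \<and>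
     (\<forall>u\<in>V. \<forall>v\<in>V. f (u + v) = f u + f v) \<and>
     (\<forall>r. \<forall>v\<in>V. f (r *\<^sub>R v) = r *\<^sub>R f v)"


section \<open>Smooth manifolds\<close>

text \<open>The classes \<^class>\<open>real_inner\<close> plus finite dimension are used for model spaces instead of
  \<^class>\<open>euclidean_space\<close>, because the latter excludes dimension (or rank) 0.\<close>

definition finite_dim :: "'b::real_vector itself \<Rightarrow> bool" where
  "finite_dim _ \<longleftrightarrow> (\<exists>B::'b set. finite B \<and> span B = UNIV)"

text \<open>Only used for open sets in finite-dimensional spaces, where this is the usual notion of
  a map of class \<open>C\<^sup>k\<close>.\<close>

primrec Ck_on ::
    "nat \<Rightarrow> 'a::real_normed_vector set \<Rightarrow> ('a \<Rightarrow> 'b::real_normed_vector) \<Rightarrow> bool" where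
  "Ck_on 0 S f \<longleftrightarrow> continuous_on S f"
| "Ck_on (Suc k) S f \<longleftrightarrow>
     (\<forall>x\<in>S. f differentiable (at x)) \<and>
     (\<forall>v. Ck_on k S (\<lambda>x. frechet_derivative f (at x) v))"

definition smooth_on ::
    "'a::real_normed_vector set \<Rightarrow> ('a \<Rightarrow> 'b::real_normed_vector) \<Rightarrow> bool" where
  "smooth_on S f \<longleftrightarrow> (\<forall>k. Ck_on k S f)"

record ('m, 'b) mfd =
  mtop :: "'m topology"
  atlas :: "('m set \<times> ('m \<Rightarrow> 'b)) set"

abbreviation points :: "('m, 'b) mfd \<Rightarrow> 'm set" where
  "points M \<equiv> topspace (mtop M)"

definition smooth_manifold :: "('m, 'b::real_inner) mfd \<Rightarrow> bool" where
  "smooth_manifold M \<longleftrightarrow>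
     finite_dim TYPE('b) \<and>
     Hausdorff_space (mtop M) \<and> second_countable (mtop M) \<and>
     \<Union> (fst ` atlas M) = points M \<and>
     (\<forall>(U, \<phi>) \<in> atlas M.
        openin (mtop M) U \<and> open (\<phi> ` U) \<and>
        homeomorphic_map (subtopology (mtop M) U) (top_of_set (\<phi> ` U)) \<phi>) \<and>
     (\<forall>(U, \<phi>) \<in> atlas M. \<forall>(U', \<phi>') \<in> atlas M.
        smooth_on (\<phi> ` (U \<inter> U')) (\<phi>' \<circ> inv_into U \<phi>))"

text \<open>Smoothness on an open subset \<open>W\<close> of \<open>M\<close>.\<close>

definition msmooth_on ::
    "('m, 'b::real_inner) mfd \<Rightarrow> 'm set \<Rightarrow> ('m \<Rightarrow> 'c::real_normed_vector) \<Rightarrow> bool" where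
  "msmooth_on M W f \<longleftrightarrow> (\<forall>(U, \<phi>) \<in> atlas M. smooth_on (\<phi> ` (U \<inter> W)) (f \<circ> inv_into U \<phi>))"

text \<open>Functions and sections on \<open>M\<close> are extended by 0 to the whole type, so that equality of
  such objects is equality on \<open>M\<close>.\<close>

definition Cinf :: "('m, 'b::real_inner) mfd \<Rightarrow> ('m \<Rightarrow> real) set" where
  "Cinf M = {f. msmooth_on M (points M) f \<and> (\<forall>x. x \<notin> points M \<longrightarrow> f x = 0)}"


section \<open>Vector bundles\<close>

text \<open>A vector bundle over \<open>M\<close> is given by its fibres, which are subspaces of a common real
  vector space type, and by a vector bundle atlas: a set of local trivialisations, each being a
  family of linear isomorphisms of the fibres over an open set onto the model fibre, with smooth
  transition maps. No relation of the fibres to the ambient type other than the linear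
  structure is required, so this is no restriction on the bundle.
  As the model fibre is finite-dimensional, smoothness of a family of linear maps is smoothness
  of its value on each vector.\<close>

record ('m, 'e, 'v) vbundle =
  fibre :: "'m \<Rightarrow> 'e set"
  trivs :: "('m set \<times> ('m \<Rightarrow> 'e \<Rightarrow> 'v)) set"

definition vector_bundle ::
    "('m, 'b::real_inner) mfd \<Rightarrow> ('m, 'e::real_vector, 'v::real_inner) vbundle \<Rightarrow> bool" where
  "vector_bundle M E \<longleftrightarrow>
     finite_dim TYPE('v) \<and>
     (\<forall>x\<in>points M. subspace (fibre E x)) \<and>
     \<Union> (fst ` trivs E) = points M \<and>
     (\<forall>(U, \<psi>) \<in> trivs E.
        openin (mtop M) U \<and>
        (\<forall>x\<in>U. linear_between (fibre E x) UNIV (\<psi> x) \<and> bij_betw (\<psi> x) (fibre E x) UNIV)) \<and>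
     (\<forall>(U, \<psi>) \<in> trivs E. \<forall>(U', \<psi>') \<in> trivs E. \<forall>v.
        msmooth_on M (U \<inter> U') (\<lambda>x. \<psi>' x (inv_into (fibre E x) (\<psi> x) v)))"

definition Sec ::
    "('m, 'b::real_inner) mfd \<Rightarrow> ('m, 'e::real_vector, 'v::real_normed_vector) vbundle
     \<Rightarrow> ('m \<Rightarrow> 'e) set" where
  "Sec M E = {X. (\<forall>x\<in>points M. X x \<in> fibre E x) \<and> (\<forall>x. x \<notin> points M \<longrightarrow> X x = 0) \<and>
                 (\<forall>(U, \<psi>) \<in> trivs E. msmooth_on M U (\<lambda>x. \<psi> x (X x)))}"

text \<open>Vector bundle morphisms over the identity of \<open>M\<close>.\<close>

definition vb_morphism ::
    "('m, 'b::real_inner) mfd \<Rightarrow> ('m, 'e::real_vector, 'v::real_normed_vector) vbundle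
     \<Rightarrow> ('m, 'f::real_vector, 'w::real_normed_vector) vbundle \<Rightarrow> ('m \<Rightarrow> 'e \<Rightarrow> 'f) \<Rightarrow> bool" where
  "vb_morphism M E F \<Phi> \<longleftrightarrow>
     (\<forall>x\<in>points M. linear_between (fibre E x) (fibre F x) (\<Phi> x)) \<and>
     (\<forall>(U, \<psi>) \<in> trivs E. \<forall>(U', \<theta>) \<in> trivs F. \<forall>v.
        msmooth_on M (U \<inter> U') (\<lambda>x. \<theta> x (\<Phi> x (inv_into (fibre E x) (\<psi> x) v))))"

definition fscale :: "('m \<Rightarrow> real) \<Rightarrow> ('m \<Rightarrow> 'e::real_vector) \<Rightarrow> 'm \<Rightarrow> 'e"  (infixr "\<odot>" 75) where
  "f \<odot> X = (\<lambda>x. f x *\<^sub>R X x)"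


section \<open>The tangent bundle and its tensor product with an endomorphism bundle\<close>

text \<open>Tangent vectors are realised as directional derivative operators on smooth functions.
  \<open>coord_vec M U \<phi> x w\<close> is \<open>\<Sum>\<^sub>i w\<^sub>i \<partial>/\<partial>\<phi>\<^sub>i\<close> at \<open>x\<close>.\<close>

type_synonym 'm tvec = "('m \<Rightarrow> real) \<Rightarrow> real"

definition coord_vec ::
    "('m, 'b::real_inner) mfd \<Rightarrow> 'm set \<Rightarrow> ('m \<Rightarrow> 'b) \<Rightarrow> 'm \<Rightarrow> 'b \<Rightarrow> 'm tvec" where
  "coord_vec M U \<phi> x w =
     (\<lambda>f. if f \<in> Cinf M then frechet_derivative (f \<circ> inv_into U \<phi>) (at (\<phi> x)) w else 0)"

definition tangent_space :: "('m, 'b::real_inner) mfd \<Rightarrow> 'm \<Rightarrow> 'm tvec set" where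
  "tangent_space M x = {coord_vec M U \<phi> x w | U \<phi> w. (U, \<phi>) \<in> atlas M \<and> x \<in> U}"

definition tangent_coord ::
    "('m, 'b::real_inner) mfd \<Rightarrow> 'm set \<Rightarrow> ('m \<Rightarrow> 'b) \<Rightarrow> 'm \<Rightarrow> 'm tvec \<Rightarrow> 'b" where
  "tangent_coord M U \<phi> x V = (THE w. V = coord_vec M U \<phi> x w)"

definition tangent_bundle :: "('m, 'b::real_inner) mfd \<Rightarrow> ('m, 'm tvec, 'b) vbundle" where
  "tangent_bundle M =
     \<lparr>fibre = tangent_space M, trivs = {(U, tangent_coord M U \<phi>) | U \<phi>. (U, \<phi>) \<in> atlas M}\<rparr>"

definition cotangent_space :: "('m, 'b::real_inner) mfd \<Rightarrow> 'm \<Rightarrow> ('m tvec \<Rightarrow> real) set" where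
  "cotangent_space M x =
     {\<omega>. linear_between (tangent_space M x) UNIV \<omega> \<and> (\<forall>V. V \<notin> tangent_space M x \<longrightarrow> \<omega> V = 0)}"

definition differential ::
    "('m, 'b::real_inner) mfd \<Rightarrow> ('m \<Rightarrow> real) \<Rightarrow> 'm \<Rightarrow> 'm tvec \<Rightarrow> real" where
  "differential M f x = (\<lambda>V. if V \<in> tangent_space M x then V f else 0)"

text \<open>\<open>T\<^sub>xM \<otimes> End(E\<^sub>x)\<close> is realised through its (faithful) action on \<open>T\<^sup>*\<^sub>xM \<otimes> E\<^sub>x\<close>: its elements are
  the finite sums of elementary tensors \<open>V \<otimes> \<Phi>\<close>, acting by \<open>(V \<otimes> \<Phi>)(\<omega> \<otimes> X) = \<langle>V, \<omega>\<rangle> \<Phi>(X)\<close>.\<close>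

definition tensor_space ::
    "('m, 'b::real_inner) mfd \<Rightarrow> ('m, 'e::real_vector, 'v) vbundle \<Rightarrow> 'm
     \<Rightarrow> (('m tvec \<Rightarrow> real) \<Rightarrow> 'e \<Rightarrow> 'e) set" where
  "tensor_space M E x =
     {\<lambda>\<omega> X. if \<omega> \<in> cotangent_space M x \<and> X \<in> fibre E x then (\<Sum>i<k. \<omega> (V i) *\<^sub>R \<Phi> i X) else 0
      | (k::nat) V \<Phi>. \<forall>i<k. V i \<in> tangent_space M x \<and>
                           linear_between (fibre E x) (fibre E x) (\<Phi> i)}"

text \<open>The model fibre \<open>B \<otimes> End(V)\<close> is \<open>Hom(B\<^sup>*, End(V))\<close>; a chart of \<open>M\<close> and a
  trivialisation of \<open>E\<close> induce a trivialisation of \<open>TM \<otimes> End(E)\<close>.\<close>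

definition tensor_coord ::
    "('m, 'b::real_inner) mfd \<Rightarrow> ('m, 'e::real_vector, 'v::real_inner) vbundle
     \<Rightarrow> 'm set \<Rightarrow> ('m \<Rightarrow> 'b) \<Rightarrow> ('m \<Rightarrow> 'e \<Rightarrow> 'v)
     \<Rightarrow> 'm \<Rightarrow> (('m tvec \<Rightarrow> real) \<Rightarrow> 'e \<Rightarrow> 'e) \<Rightarrow> (('b \<Rightarrow>\<^sub>L real) \<Rightarrow>\<^sub>L ('v \<Rightarrow>\<^sub>L 'v))" where
  "tensor_coord M E U \<phi> \<psi> x A =
     Blinfun (\<lambda>l. Blinfun (\<lambda>u.
       \<psi> x (A (\<lambda>V. if V \<in> tangent_space M x then blinfun_apply l (tangent_coord M U \<phi> x V) else 0)
              (inv_into (fibre E x) (\<psi> x) u))))"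

definition tensor_bundle ::
    "('m, 'b::real_inner) mfd \<Rightarrow> ('m, 'e::real_vector, 'v::real_inner) vbundle
     \<Rightarrow> ('m, ('m tvec \<Rightarrow> real) \<Rightarrow> 'e \<Rightarrow> 'e, ('b \<Rightarrow>\<^sub>L real) \<Rightarrow>\<^sub>L ('v \<Rightarrow>\<^sub>L 'v)) vbundle" where
  "tensor_bundle M E =
     \<lparr>fibre = tensor_space M E,
      trivs = {(U \<inter> U', tensor_coord M E U \<phi> \<psi>) | U \<phi> U' \<psi>. (U, \<phi>) \<in> atlas M \<and> (U', \<psi>) \<in> trivs E}\<rparr>"


section \<open>Loday algebroids\<close>

text \<open>\<open>\<rho>(X)(f)\<close>\<close>

definition anchor_act ::
    "('m, 'b::real_inner) mfd \<Rightarrow> ('m \<Rightarrow> 'e \<Rightarrow> 'm tvec) \<Rightarrow> ('m \<Rightarrow> 'e) \<Rightarrow> ('m \<Rightarrow> real)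
     \<Rightarrow> 'm \<Rightarrow> real" where
  "anchor_act M \<rho> X f = (\<lambda>x. if x \<in> points M then \<rho> x (X x) f else 0)"

text \<open>\<open>\<alpha>(Y)(df \<otimes> X)\<close>\<close>

definition alpha_act ::
    "('m, 'b::real_inner) mfd \<Rightarrow> ('m \<Rightarrow> 'e \<Rightarrow> ('m tvec \<Rightarrow> real) \<Rightarrow> 'e \<Rightarrow> 'e::real_vector)
     \<Rightarrow> ('m \<Rightarrow> 'e) \<Rightarrow> ('m \<Rightarrow> real) \<Rightarrow> ('m \<Rightarrow> 'e) \<Rightarrow> 'm \<Rightarrow> 'e" where
  "alpha_act M \<alpha> Y f X =
     (\<lambda>x. if x \<in> points M then \<alpha> x (Y x) (differential M f x) (X x) else 0)"

definition loday_algebroid ::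
    "('m, 'b::real_inner) mfd \<Rightarrow> ('m, 'e::real_vector, 'v::real_inner) vbundle
     \<Rightarrow> (('m \<Rightarrow> 'e) \<Rightarrow> ('m \<Rightarrow> 'e) \<Rightarrow> ('m \<Rightarrow> 'e))
     \<Rightarrow> ('m \<Rightarrow> 'e \<Rightarrow> 'm tvec)
     \<Rightarrow> ('m \<Rightarrow> 'e \<Rightarrow> ('m tvec \<Rightarrow> real) \<Rightarrow> 'e \<Rightarrow> 'e) \<Rightarrow> bool" where
  "loday_algebroid M E br \<rho> \<alpha> \<longleftrightarrow>
     smooth_manifold M \<and> vector_bundle M E \<and>
     (\<forall>X\<in>Sec M E. linear_between (Sec M E) (Sec M E) (\<lambda>Y. br X Y)) \<and>
     (\<forall>Y\<in>Sec M E. linear_between (Sec M E) (Sec M E) (\<lambda>X. br X Y)) \<and>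
     (\<forall>X\<in>Sec M E. \<forall>Y\<in>Sec M E. \<forall>Z\<in>Sec M E.
        br X (br Y Z) = br (br X Y) Z + br Y (br X Z)) \<and>
     vb_morphism M E (tangent_bundle M) \<rho> \<and>
     vb_morphism M E (tensor_bundle M E) \<alpha> \<and>
     (\<forall>X\<in>Sec M E. \<forall>Y\<in>Sec M E. \<forall>f\<in>Cinf M.
        br X (f \<odot> Y) = f \<odot> br X Y + anchor_act M \<rho> X f \<odot> Y) \<and>
     (\<forall>X\<in>Sec M E. \<forall>Y\<in>Sec M E. \<forall>f\<in>Cinf M.
        br (f \<odot> X) Y = f \<odot> br X Y - anchor_act M \<rho> Y f \<odot> X + alpha_act M \<alpha> Y f X)"


section \<open>Multidifferential operators\<close>

text \<open>\<open>diffop_le M E k D\<close>: all \<open>(k+1)\<close>-fold iterated commutators of \<open>D\<close> with multiplications by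
  smooth functions vanish. For \<open>\<real>\<close>-linear \<open>D\<close> from sections to functions this says that \<open>D\<close> is a
  differential operator of order at most \<open>k\<close>.\<close>

primrec diffop_le ::
    "('m, 'b::real_inner) mfd \<Rightarrow> ('m, 'e::real_vector, 'v::real_inner) vbundle \<Rightarrow> nat
     \<Rightarrow> (('m \<Rightarrow> 'e) \<Rightarrow> ('m \<Rightarrow> real)) \<Rightarrow> bool" where
  "diffop_le M E 0 D \<longleftrightarrow> (\<forall>f\<in>Cinf M. \<forall>X\<in>Sec M E. D (f \<odot> X) = f \<odot> D X)"
| "diffop_le M E (Suc k) D \<longleftrightarrow> (\<forall>f\<in>Cinf M. diffop_le M E k (\<lambda>X. D (f \<odot> X) - f \<odot> D X))"

text \<open>Cochains are functions on lists of sections, extended by 0 to all other arguments.\<close>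

type_synonym ('m, 'e) cochain = "('m \<Rightarrow> 'e) list \<Rightarrow> ('m \<Rightarrow> real)"

definition multidiff ::
    "('m, 'b::real_inner) mfd \<Rightarrow> ('m, 'e::real_vector, 'v::real_inner) vbundle \<Rightarrow> nat
     \<Rightarrow> ('m, 'e) cochain set" where
  "multidiff M E p =
     {c. (\<forall>Xs. \<not> (length Xs = p \<and> set Xs \<subseteq> Sec M E) \<longrightarrow> c Xs = 0) \<and>
         (\<forall>Xs. length Xs = p \<and> set Xs \<subseteq> Sec M E \<longrightarrow> c Xs \<in> Cinf M) \<and>
         (\<forall>i<p. \<forall>Xs. length Xs = p \<and> set Xs \<subseteq> Sec M E \<longrightarrow>
            linear_between (Sec M E) (Cinf M) (\<lambda>X. c (Xs[i := X]))) \<and>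
         (\<forall>i<p. \<exists>k. \<forall>Xs. length Xs = p \<and> set Xs \<subseteq> Sec M E \<longrightarrow>
            diffop_le M E k (\<lambda>X. c (Xs[i := X])))}"

text \<open>The component of degree \<open>p\<close> of a cochain is its restriction to lists of length \<open>p\<close>;
  the direct sum consists of the cochains with finitely many nonzero components.\<close>

definition component :: "nat \<Rightarrow> ('m, 'e) cochain \<Rightarrow> ('m, 'e) cochain" where
  "component p c = (\<lambda>Xs. if length Xs = p then c Xs else 0)"

definition multidiffs ::
    "('m, 'b::real_inner) mfd \<Rightarrow> ('m, 'e::real_vector, 'v::real_inner) vbundle
     \<Rightarrow> ('m, 'e) cochain set" where
  "multidiffs M E = {c. (\<forall>p. component p c \<in> multidiff M E p) \<and> finite {p. component p c \<noteq> 0}}"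

definition shuffle_perms :: "nat \<Rightarrow> nat \<Rightarrow> (nat \<Rightarrow> nat) set" where
  "shuffle_perms p q =
     {\<sigma>. \<sigma> permutes {..<p + q} \<and> strict_mono_on {..<p} \<sigma> \<and> strict_mono_on {p..<p + q} \<sigma>}"

text \<open>The bilinear extension to the direct sum: on a list of length \<open>n\<close>, all pairs of components
  of degrees \<open>p\<close> and \<open>n - p\<close> contribute.\<close>

definition shuffle_prod ::
    "('m, 'e) cochain \<Rightarrow> ('m, 'e) cochain \<Rightarrow> ('m, 'e) cochain"  (infixl "\<pitchfork>" 70) where
  "a \<pitchfork> b = (\<lambda>Xs. \<Sum>p\<le>length Xs. \<Sum>\<sigma>\<in>shuffle_perms p (length Xs - p).
     real_of_int (sign \<sigma>) *\<^sub>R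
       (a (map (\<lambda>i. Xs ! \<sigma> i) [0..<p]) * b (map (\<lambda>i. Xs ! \<sigma> i) [p..<length Xs])))"


section \<open>Cartan calculus\<close>

definition omit :: "nat \<Rightarrow> 'a list \<Rightarrow> 'a list" where
  "omit i xs = take i xs @ drop (Suc i) xs"

text \<open>Indices start from 0 here, which shifts the signs of the usual 1-based formula.\<close>

definition coboundary ::
    "('m, 'b::real_inner) mfd \<Rightarrow> ('m, 'e::real_vector, 'v::real_inner) vbundle
     \<Rightarrow> (('m \<Rightarrow> 'e) \<Rightarrow> ('m \<Rightarrow> 'e) \<Rightarrow> ('m \<Rightarrow> 'e)) \<Rightarrow> ('m \<Rightarrow> 'e \<Rightarrow> 'm tvec)
     \<Rightarrow> ('m, 'e) cochain \<Rightarrow> ('m, 'e) cochain" where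
  "coboundary M E br \<rho> c = (\<lambda>Xs.
     if set Xs \<subseteq> Sec M E then
       (\<Sum>i<length Xs. ((-1) ^ i :: real) *\<^sub>R anchor_act M \<rho> (Xs ! i) (c (omit i Xs))) +
       (\<Sum>j<length Xs. \<Sum>i<j. ((-1) ^ Suc i :: real) *\<^sub>R c (omit i (Xs[j := br (Xs ! i) (Xs ! j)])))
     else 0)"

definition contraction :: "('m \<Rightarrow> 'e) \<Rightarrow> ('m, 'e) cochain \<Rightarrow> ('m, 'e) cochain" where
  "contraction X c = (\<lambda>Xs. c (X # Xs))"

definition lie_derivative ::
    "('m, 'b::real_inner) mfd \<Rightarrow> ('m, 'e::real_vector, 'v::real_inner) vbundle
     \<Rightarrow> (('m \<Rightarrow> 'e) \<Rightarrow> ('m \<Rightarrow> 'e) \<Rightarrow> ('m \<Rightarrow> 'e)) \<Rightarrow> ('m \<Rightarrow> 'e \<Rightarrow> 'm tvec)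
     \<Rightarrow> ('m \<Rightarrow> 'e) \<Rightarrow> ('m, 'e) cochain \<Rightarrow> ('m, 'e) cochain" where
  "lie_derivative M E br \<rho> X c =
     coboundary M E br \<rho> (contraction X c) + contraction X (coboundary M E br \<rho> c)"

definition koszul_sign :: "int \<Rightarrow> real" where
  "koszul_sign k = (if even k then 1 else -1)"

text \<open>Graded commutator of an operator \<open>P\<close> of degree \<open>d\<close> and an operator \<open>Q\<close> of degree \<open>e\<close>.\<close>

definition supercomm ::
    "int \<Rightarrow> ('c \<Rightarrow> 'c) \<Rightarrow> int \<Rightarrow> ('c \<Rightarrow> 'c) \<Rightarrow> 'c \<Rightarrow> 'c::real_vector" where
  "supercomm d P e Q = (\<lambda>c. P (Q c) - koszul_sign (d * e) *\<^sub>R Q (P c))"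

definition graded_derivation ::
    "('m, 'b::real_inner) mfd \<Rightarrow> ('m, 'e::real_vector, 'v::real_inner) vbundle \<Rightarrow> int
     \<Rightarrow> (('m, 'e) cochain \<Rightarrow> ('m, 'e) cochain) \<Rightarrow> bool" where
  "graded_derivation M E d P \<longleftrightarrow>
     linear_between (multidiffs M E) (multidiffs M E) P \<and>
     (\<forall>p. \<forall>c\<in>multidiff M E p.
        if int p + d \<ge> 0 then P c \<in> multidiff M E (nat (int p + d)) else P c = 0) \<and>
     (\<forall>p. \<forall>a\<in>multidiff M E p. \<forall>b\<in>multidiffs M E.
        P (a \<pitchfork> b) = P a \<pitchfork> b + koszul_sign (d * int p) *\<^sub>R (a \<pitchfork> P b))"

end

theory Submission
  imports Defs
begin

text \<open>
  Contractions determine a cochain up to its value on the empty list, so all identities are proved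
  by induction on the number of arguments, using the recursions
  \<open>i\<^sub>X d = L\<^sub>X - d i\<^sub>X\<close>, \<open>i\<^sub>Y L\<^sub>X = L\<^sub>X i\<^sub>Y - i\<^bsub>[X,Y]\<^esub>\<close> and
  \<open>i\<^sub>X (a \<pitchfork> b) = i\<^sub>X a \<pitchfork> b + a' \<pitchfork> i\<^sub>X b\<close>, where \<open>a'\<close> is \<open>a\<close> with the sign of its degree. The last
  one comes from splitting shuffles according to the block into which the first argument goes.
  For example, \<open>i\<^sub>X d\<^sup>2 = L\<^sub>X d - d L\<^sub>X + d\<^sup>2 i\<^sub>X\<close> gives \<open>d\<^sup>2 = 0\<close> from \<open>[d, L\<^sub>X] = 0\<close>, which in turn
  follows from \<open>[L\<^sub>X, L\<^sub>Y] = L\<^bsub>[X,Y]\<^esub>\<close>, that is, from the Jacobi identity and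
  \<open>\<rho>([X,Y]) = [\<rho>(X), \<rho>(Y)]\<close>.

  The analytic input is that \<open>\<rho>(X)(f)\<close> is smooth. This needs bump functions: without enough global
  smooth functions a tangent vector would not determine its coordinates, and \<open>tangent_coord\<close>
  would be a junk value.
\<close>

section \<open>Calculus of smooth maps\<close>

text \<open>Cochains carry no symmetry and the bracket need not be skew, so the order of arguments
  matters throughout. Peeling off the first argument still works because [X_i, X_j] stands in the
  place of the later X_j: a leading X is either used up, which produces L_X, or a spectator, which
  produces - d i_X. The identities are proved on \<open>cochains\<close>, maps on lists of sections
  without regard to order or degree; \<open>additive_cochains\<close> adds what the Jacobi identity
  needs, namely that i_(U+V) splits. Compatibility of \<rho> with the brackets is not among the
  axioms and is derived in \<open>act_br\<close>. Differential operators enter when the operators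
  are shown to preserve \<open>multidiffs\<close>: d and L_X each raise a uniform bound on the
  orders by at most one. In the left slot of the bracket this rests on \<alpha>, which makes br (f
  X) Y - f br X Y linear over functions in X. Model spaces may have dimension 0 and come without a
  distinguished basis, so coordinates refer to a finite spanning set; the chain rule, local frames
  and compactness of balls all go through such finite sums.\<close>

lemma finite_dim_coords:
  assumes "finite_dim TYPE('b::real_inner)"
  obtains C :: "'b::real_inner set" and \<kappa> where "finite C" "\<And>c. bounded_linear (\<kappa> c)"
    "\<And>v. v = (\<Sum>c\<in>C. \<kappa> c v *\<^sub>R c)"
proof -
  obtain B :: "'b set" where B: "finite B" "span B = UNIV"
    using assms by (auto simp: finite_dim_def)
  obtain C :: "'b set" where C: "finite C" "span C = UNIV" "pairwise orthogonal C"
    using basis_orthogonal[OF B(1)] B(2) by auto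
  \<comment> \<open>Coefficients of orthogonal projection. \<open>C\<close> may contain 0, where
    division by zero gives the coefficient 0.\<close>
  define \<kappa> where "\<kappa> = (\<lambda>c v::'b. (v \<bullet> c) / (c \<bullet> c))"
  have lin: "bounded_linear (\<kappa> c)" for c
    unfolding \<kappa>_def divide_inverse by (intro bounded_linear_mult_const bounded_linear_inner_left)
  have sub: "subspace {v. v = (\<Sum>c\<in>C. \<kappa> c v *\<^sub>R c)}"
  proof (rule subspaceI; unfold mem_Collect_eq)
    show "0 = (\<Sum>c\<in>C. \<kappa> c 0 *\<^sub>R c)"
      by (simp add: \<kappa>_def)
  next
    fix x y assume "x = (\<Sum>c\<in>C. \<kappa> c x *\<^sub>R c)" "y = (\<Sum>c\<in>C. \<kappa> c y *\<^sub>R c)"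
    then show "x + y = (\<Sum>c\<in>C. \<kappa> c (x + y) *\<^sub>R c)"
      by (simp add: \<kappa>_def inner_add_left add_divide_distrib scaleR_add_left sum.distrib)
  next
    fix r x assume x: "x = (\<Sum>c\<in>C. \<kappa> c x *\<^sub>R c)"
    have "r *\<^sub>R (\<Sum>c\<in>C. \<kappa> c x *\<^sub>R c) = (\<Sum>c\<in>C. \<kappa> c (r *\<^sub>R x) *\<^sub>R c)"
      by (simp add: \<kappa>_def scaleR_sum_right)
    with x show "r *\<^sub>R x = (\<Sum>c\<in>C. \<kappa> c (r *\<^sub>R x) *\<^sub>R c)"
      by simp
  qed
  have gen: "C \<subseteq> {v. v = (\<Sum>c\<in>C. \<kappa> c v *\<^sub>R c)}"
  proof
    fix b assume b: "b \<in> C"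
    have "(\<Sum>c\<in>C. \<kappa> c b *\<^sub>R c) = (\<Sum>c\<in>C. if c = b then b else 0)"
    proof (rule sum.cong)
      fix c assume "c \<in> C"
      then show "\<kappa> c b *\<^sub>R c = (if c = b then b else 0)"
        using C(3) b by (auto simp: \<kappa>_def pairwise_def orthogonal_def)
    qed simp
    then show "b \<in> {v. v = (\<Sum>c\<in>C. \<kappa> c v *\<^sub>R c)}"
      using C(1) b by simp
  qed
  have "v = (\<Sum>c\<in>C. \<kappa> c v *\<^sub>R c)" for v
    using span_minimal[OF gen sub] C(2) by auto
  then show thesis
    using that C(1) lin by blast
qed

text \<open>\<open>frechet_derivative\<close> is a choice from the set of derivatives, and this set
  depends only on the germ, so the choices agree even at points where neither map is
  differentiable.\<close>

lemma frechet_derivative_cong_open: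
  assumes "open S" "x \<in> S" "\<And>y. y \<in> S \<Longrightarrow> f y = g y"
  shows "frechet_derivative f (at x) = frechet_derivative g (at x)"
proof -
  have "(f has_derivative D) (at x) \<longleftrightarrow> (g has_derivative D) (at x)" for D
    using assms has_derivative_transform_within_open[of f D x UNIV S g]
      has_derivative_transform_within_open[of g D x UNIV S f] by auto
  then show ?thesis
    by (simp add: frechet_derivative_def)
qed

lemma differentiable_cong_open:
  assumes "open S" "x \<in> S" "\<And>y. y \<in> S \<Longrightarrow> f y = g y"
  shows "f differentiable (at x) \<longleftrightarrow> g differentiable (at x)"
proof -
  have "(f has_derivative D) (at x) \<longleftrightarrow> (g has_derivative D) (at x)" for D
    using assms has_derivative_transform_within_open[of f D x UNIV S g]
      has_derivative_transform_within_open[of g D x UNIV S f] by auto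
  then show ?thesis
    by (simp add: differentiable_def)
qed

lemma Ck_on_cong:
  assumes "open S" "\<And>y. y \<in> S \<Longrightarrow> f y = g y"
  shows "Ck_on k S f \<longleftrightarrow> Ck_on k S g"
  using assms(2)
proof (induction k arbitrary: f g)
  case 0
  then show ?case by (simp cong: continuous_on_cong)
next
  case (Suc k)
  have "Ck_on k S (\<lambda>x. frechet_derivative f (at x) v) \<longleftrightarrow>
        Ck_on k S (\<lambda>x. frechet_derivative g (at x) v)" for v
    by (rule Suc.IH) (simp add: frechet_derivative_cong_open[OF assms(1) _ Suc.prems])
  moreover have "(\<forall>x\<in>S. f differentiable (at x)) \<longleftrightarrow> (\<forall>x\<in>S. g differentiable (at x))"
    using differentiable_cong_open[OF assms(1), of _ f g] Suc.prems by blast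
  ultimately show ?case by simp
qed

lemma Ck_on_subset: "Ck_on k S f \<Longrightarrow> T \<subseteq> S \<Longrightarrow> Ck_on k T f"
  by (induction k arbitrary: f) (auto intro: continuous_on_subset)

lemma Ck_on_Suc_lower: "Ck_on (Suc k) S f \<Longrightarrow> Ck_on k S f"
proof (induction k arbitrary: f)
  case 0
  then show ?case
    by (auto intro!: continuous_at_imp_continuous_on differentiable_imp_continuous_within)
next
  case (Suc k)
  then show ?case
    unfolding Ck_on.simps(2)[of "Suc k"] by auto
qed

lemma Ck_on_SucI:
  assumes "open S" "\<And>x. x \<in> S \<Longrightarrow> (f has_derivative f' x) (at x)"
    "\<And>v. Ck_on k S (\<lambda>x. f' x v)"
  shows "Ck_on (Suc k) S f"
proof -
  have "frechet_derivative f (at x) = f' x" if "x \<in> S" for x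
    using frechet_derivative_at[OF assms(2)[OF that]] by simp
  then have "Ck_on k S (\<lambda>x. frechet_derivative f (at x) v)" for v
    using assms(3)[of v] Ck_on_cong[OF assms(1), of "\<lambda>x. frechet_derivative f (at x) v" "\<lambda>x. f' x v"]
    by simp
  then show ?thesis
    using assms(2) by (auto simp: differentiable_def)
qed

lemma Ck_on_SucD:
  assumes "Ck_on (Suc k) S f"
  shows "\<And>x. x \<in> S \<Longrightarrow> (f has_derivative frechet_derivative f (at x)) (at x)"
    and "\<And>v. Ck_on k S (\<lambda>x. frechet_derivative f (at x) v)"
  using assms by (auto simp: frechet_derivative_works)

lemma Ck_on_locally:
  assumes "\<And>x. x \<in> S \<Longrightarrow> \<exists>T. open T \<and> x \<in> T \<and> Ck_on k T f"
  shows "Ck_on k S f"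
  using assms
proof (induction k arbitrary: f)
  case 0
  have "isCont f x" if "x \<in> S" for x
    using 0[OF that] by (auto simp: continuous_on_eq_continuous_at)
  then show ?case
    by (simp add: continuous_at_imp_continuous_on)
next
  case (Suc k)
  have "f differentiable (at x)" if "x \<in> S" for x
    using Suc.prems[OF that] by auto
  moreover have "Ck_on k S (\<lambda>x. frechet_derivative f (at x) v)" for v
    using Suc.prems by (intro Suc.IH) fastforce
  ultimately show ?case by simp
qed

lemma Ck_on_const: "open S \<Longrightarrow> Ck_on k S (\<lambda>x. c)"
proof (induction k arbitrary: c)
  case (Suc k)
  then show ?case
    by (intro Ck_on_SucI[where f' = "\<lambda>x v. 0"]) auto
qed simp

lemma Ck_on_add:
  "open S \<Longrightarrow> Ck_on k S f \<Longrightarrow> Ck_on k S g \<Longrightarrow> Ck_on k S (\<lambda>x. f x + g x)"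
proof (induction k arbitrary: f g)
  case (Suc k)
  show ?case
    by (rule Ck_on_SucI[OF Suc.prems(1) has_derivative_add[OF
          Ck_on_SucD(1)[OF Suc.prems(2)] Ck_on_SucD(1)[OF Suc.prems(3)]]
          Suc.IH[OF Suc.prems(1) Ck_on_SucD(2)[OF Suc.prems(2)] Ck_on_SucD(2)[OF Suc.prems(3)]]])
qed (auto intro: continuous_intros)

lemma Ck_on_sum:
  "open S \<Longrightarrow> (\<And>i. i \<in> I \<Longrightarrow> Ck_on k S (f i)) \<Longrightarrow> Ck_on k S (\<lambda>x. \<Sum>i\<in>I. f i x)"
proof (induction I rule: infinite_finite_induct)
  case (insert i I)
  then show ?case
    using Ck_on_add[of S k "f i" "\<lambda>x. \<Sum>i\<in>I. f i x"] by simp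
qed (auto intro: Ck_on_const)

lemma Ck_on_bilinear:
  assumes "bounded_bilinear b"
  shows "open S \<Longrightarrow> Ck_on k S f \<Longrightarrow> Ck_on k S g \<Longrightarrow> Ck_on k S (\<lambda>x. b (f x) (g x))"
proof (induction k arbitrary: f g)
  case 0
  then show ?case
    using bounded_bilinear.continuous_on[OF assms] by auto
next
  case (Suc k)
  \<comment> \<open>The product rule pairs the derivative of one factor with the other factor
    itself, which therefore has to be lowered to class C^k.\<close>
  note fk = Ck_on_Suc_lower[OF Suc.prems(2)] and gk = Ck_on_Suc_lower[OF Suc.prems(3)]
  show ?case
    by (rule Ck_on_SucI[OF Suc.prems(1) bounded_bilinear.FDERIV[OF assms
          Ck_on_SucD(1)[OF Suc.prems(2)] Ck_on_SucD(1)[OF Suc.prems(3)]]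
          Ck_on_add[OF Suc.prems(1) Suc.IH[OF Suc.prems(1) fk Ck_on_SucD(2)[OF Suc.prems(3)]]
          Suc.IH[OF Suc.prems(1) Ck_on_SucD(2)[OF Suc.prems(2)] gk]]])
qed

lemma Ck_on_linear:
  assumes "bounded_linear l"
  shows "open S \<Longrightarrow> Ck_on k S f \<Longrightarrow> Ck_on k S (\<lambda>x. l (f x))"
proof (induction k arbitrary: f)
  case 0
  then show ?case
    using bounded_linear.continuous_on[OF assms] by auto
next
  case (Suc k)
  show ?case
    by (rule Ck_on_SucI[OF Suc.prems(1) bounded_linear.has_derivative[OF assms
          Ck_on_SucD(1)[OF Suc.prems(2)]] Suc.IH[OF Suc.prems(1) Ck_on_SucD(2)[OF Suc.prems(2)]]])
qed

lemma Ck_on_ident: "open S \<Longrightarrow> Ck_on k S (\<lambda>x. x)"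
proof (cases k)
  case (Suc k')
  assume S: "open S"
  then show ?thesis
    unfolding Suc by (intro Ck_on_SucI[where f' = "\<lambda>x v. v"] Ck_on_const) auto
qed simp

text \<open>The definition of \<open>Ck_on\<close> only speaks about directional derivatives in fixed directions;
  finite dimension of the middle space is what makes the chain rule stay inside this class.\<close>

lemma Ck_on_compose:
  fixes f :: "'b::real_inner \<Rightarrow> 'c::real_normed_vector" and g :: "'a::real_normed_vector \<Rightarrow> 'b"
  assumes fd: "finite_dim TYPE('b)" and S: "open S" and T: "g ` S \<subseteq> T"
  shows "Ck_on k T f \<Longrightarrow> Ck_on k S g \<Longrightarrow> Ck_on k S (\<lambda>x. f (g x))"
proof (induction k arbitrary: f)
  case 0
  then show ?case
    using T by (auto intro: continuous_on_compose2)
next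
  case (Suc k)
  obtain C :: "'b set" and \<kappa> where C: "finite C" and bl: "\<And>c. bounded_linear (\<kappa> c)"
    and rep: "\<And>v. v = (\<Sum>c\<in>C. \<kappa> c v *\<^sub>R c)"
    using finite_dim_coords[OF fd] by blast
  let ?f' = "\<lambda>y. frechet_derivative f (at y)" and ?g' = "\<lambda>x. frechet_derivative g (at x)"
  have df: "(f has_derivative ?f' (g x)) (at (g x))" if "x \<in> S" for x
    using Ck_on_SucD(1)[OF Suc.prems(1), of "g x"] T that by blast
  \<comment> \<open>Expanding g'(x) v over \<open>C\<close> trades the moving direction for fixed
    directions c, so that the induction hypothesis applies to y -> f'(y) c.\<close>
  have der: "((\<lambda>x. f (g x)) has_derivative (\<lambda>v. \<Sum>c\<in>C. \<kappa> c (?g' x v) *\<^sub>R ?f' (g x) c)) (at x)"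
    if "x \<in> S" for x
  proof -
    interpret f': bounded_linear "?f' (g x)"
      using df[OF that] by (rule has_derivative_bounded_linear)
    have "?f' (g x) (?g' x v) = (\<Sum>c\<in>C. \<kappa> c (?g' x v) *\<^sub>R ?f' (g x) c)" for v
    proof -
      have "?f' (g x) (?g' x v) = ?f' (g x) (\<Sum>c\<in>C. \<kappa> c (?g' x v) *\<^sub>R c)"
        using rep[of "?g' x v"] by simp
      then show ?thesis
        by (simp add: f'.sum f'.scaleR)
    qed
    then show ?thesis
      using has_derivative_compose[OF Ck_on_SucD(1)[OF Suc.prems(2) that] df[OF that]] by simp
  qed
  have "Ck_on k S (\<lambda>x. \<Sum>c\<in>C. \<kappa> c (?g' x v) *\<^sub>R ?f' (g x) c)" for v
    by (intro Ck_on_sum S Ck_on_bilinear[OF bounded_bilinear_scaleR] Ck_on_linear[OF bl]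
        Ck_on_SucD(2)[OF Suc.prems(2)] Suc.IH[OF Ck_on_SucD(2)[OF Suc.prems(1)]]
        Ck_on_Suc_lower[OF Suc.prems(2)])
  then show ?case
    by (intro Ck_on_SucI[OF S der])
qed

section \<open>Ingredients of bump functions: a flat function and compact balls\<close>

definition flat_exp :: "nat \<Rightarrow> real \<Rightarrow> real" where
  "flat_exp n t = (if t > 0 then (1 / t) ^ n * exp (- (1 / t)) else 0)"

text \<open>A quadratic rate is what the difference quotient at 0 needs to tend to 0. The exponent
  \<open>?m\<close> = n + 2 cancels t^(-n) and leaves t^2; dropping the 1 in (1 + x/m)^m \<le> exp x
  with x = 1/t bounds exp (-1/t) by (t m)^m.\<close>

lemma flat_exp_bound: "\<exists>K. \<forall>t. \<bar>flat_exp n t\<bar> \<le> K * t\<^sup>2"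
proof -
  have "\<bar>flat_exp n t\<bar> \<le> real (n + 2) ^ (n + 2) * t\<^sup>2" for t
  proof (cases "t > 0")
    case True
    let ?m = "n + 2"
    define A where "A = t ^ ?m * real ?m ^ ?m"
    have "(1 / (t * real ?m)) ^ ?m \<le> (1 + (1 / t) / real ?m) ^ ?m"
      using True by (intro power_mono) (auto simp: field_simps)
    also have "\<dots> \<le> exp (1 / t)"
      using True by (intro exp_ge_one_plus_x_over_n_power_n) (auto intro: order_trans[of _ 0])
    finally have "1 / A \<le> exp (1 / t)"
      by (simp add: A_def power_divide power_mult_distrib mult_ac)
    moreover have "A > 0"
      using True by (simp add: A_def)
    ultimately have "exp (- (1 / t)) \<le> A"
      by (simp add: exp_minus field_simps)
    then have "(1 / t) ^ n * exp (- (1 / t)) \<le> (1 / t) ^ n * A"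
      using True by (intro mult_left_mono) auto
    also have "\<dots> = real ?m ^ ?m * t\<^sup>2"
      using True by (simp add: A_def power_add power_divide power2_eq_square)
    finally show ?thesis
      using True by (simp add: flat_exp_def)
  qed (simp add: flat_exp_def)
  then show ?thesis by blast
qed

text \<open>The factor t^(-n) is carried along because it makes the family closed under
  differentiation up to linear combinations; smoothness then follows by one induction over the order
  for all n at once. The formula also covers t \<le> 0, where every term is 0.\<close>

lemma flat_exp_deriv:
  "(flat_exp n has_derivative (\<lambda>v. v * (flat_exp (n + 2) t - n * flat_exp (n + 1) t))) (at t)"
proof -
  have pos: "(flat_exp n has_real_derivative (flat_exp (n + 2) t - n * flat_exp (n + 1) t)) (at t)"
    if t: "t > 0" for t
  proof -
    have "((\<lambda>t. (1 / t) ^ n * exp (- (1 / t))) has_real_derivative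
            (flat_exp (n + 2) t - n * flat_exp (n + 1) t)) (at t)"
    \<comment> \<open>The power rule produces the truncated exponent n - 1, hence the separate case
      n = 0.\<close>
    proof (cases n)
      case 0
      then show ?thesis
        using t by (auto intro!: derivative_eq_intros simp: flat_exp_def power2_eq_square)
    next
      case (Suc m)
      show ?thesis
        unfolding Suc using t
        by (auto intro!: derivative_eq_intros simp: flat_exp_def power2_eq_square field_simps)
          (cases m; simp)
    qed
    then show ?thesis
      by (rule has_field_derivative_transform_within_open[of _ _ _ "{0<..}"]) (use t in \<open>auto simp: flat_exp_def\<close>)
  qed
  have neg: "(flat_exp n has_real_derivative 0) (at t)" if t: "t < 0" for t
    by (rule has_field_derivative_transform_within_open[of "\<lambda>_. 0" _ _ "{..<0}"])
      (use t in \<open>auto simp: flat_exp_def\<close>)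
  have zero: "(flat_exp n has_real_derivative 0) (at 0)"
  proof -
    obtain K where K: "\<And>t. \<bar>flat_exp n t\<bar> \<le> K * t\<^sup>2"
      using flat_exp_bound by blast
    have "((\<lambda>h. flat_exp n h / h) \<longlongrightarrow> 0) (at 0)"
    proof (rule Lim_null_comparison)
      show "\<forall>\<^sub>F h in at 0. norm (flat_exp n h / h) \<le> K * \<bar>h\<bar>"
      proof (rule eventuallyI)
        fix h
        show "norm (flat_exp n h / h) \<le> K * \<bar>h\<bar>"
          using K[of h] by (cases "h = 0") (auto simp: field_simps power2_eq_square)
      qed
      show "((\<lambda>h. K * \<bar>h\<bar>) \<longlongrightarrow> 0) (at 0)"
        by (auto intro!: tendsto_eq_intros)
    qed
    then show ?thesis
      by (simp add: DERIV_def flat_exp_def)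
  qed
  have "(flat_exp n has_real_derivative (flat_exp (n + 2) t - n * flat_exp (n + 1) t)) (at t)"
    using pos[of t] neg[of t] zero by (cases t "0::real" rule: linorder_cases) (auto simp: flat_exp_def)
  then show ?thesis
    by (simp add: has_field_derivative_def mult.commute[of _ "_ - _"] mult_commute_abs)
qed

lemma Ck_on_flat_exp: "Ck_on k UNIV (flat_exp n)"
proof (induction k arbitrary: n)
  case 0
  show ?case
    using has_derivative_continuous[OF flat_exp_deriv]
    by (auto intro!: continuous_at_imp_continuous_on)
next
  case (Suc k)
  have "Ck_on k UNIV (\<lambda>t. v * (flat_exp (n + 2) t + (- real n) * flat_exp (n + 1) t))" for v
    by (intro Ck_on_bilinear[OF bounded_bilinear_mult] Ck_on_add Ck_on_const Suc.IH) auto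
  then show ?case
    by (intro Ck_on_SucI[OF _ flat_exp_deriv]) auto
qed

lemma finite_dim_real: "finite_dim TYPE(real)"
  unfolding finite_dim_def by (rule exI[of _ "{1}"]) (auto simp: span_singleton)

text \<open>The ball is a closed subset of a finite sum of compact segments, where the coefficient
  of c is bounded by its operator norm times norm z + r. Compactness makes the support of a bump
  closed in the Hausdorff manifold.\<close>

lemma finite_dim_compact_cball:
  fixes z :: "'b::real_inner"
  assumes "finite_dim TYPE('b)"
  shows "compact (cball z r)"
proof -
  obtain C :: "'b set" and \<kappa> where C: "finite C" and bl: "\<And>c. bounded_linear (\<kappa> c)"
    and rep: "\<And>v. v = (\<Sum>c\<in>C. \<kappa> c v *\<^sub>R c)"
    using finite_dim_coords[OF assms] by blast
  have "compact {\<Sum>c\<in>C. a c *\<^sub>R c | a. \<forall>c\<in>C. a c \<in> {- R c..R c}}" (is "compact (?box C)")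
    for R :: "'b \<Rightarrow> real"
    using C
  proof (induction C)
    case empty
    then show ?case by simp
  next
    case (insert c C)
    have "?box (insert c C) = {x + y | x y. x \<in> (\<lambda>s. s *\<^sub>R c) ` {- R c..R c} \<and> y \<in> ?box C}"
      (is "?l = ?r")
    proof
      show "?l \<subseteq> ?r"
      proof clarsimp
        fix a assume *: "- R c \<le> a c" "a c \<le> R c" "\<forall>c\<in>C. - R c \<le> a c \<and> a c \<le> R c"
        have "(\<Sum>c\<in>insert c C. a c *\<^sub>R c) = a c *\<^sub>R c + (\<Sum>c\<in>C. a c *\<^sub>R c)"
          using insert.hyps by simp
        moreover have "a c *\<^sub>R c \<in> (\<lambda>s. s *\<^sub>R c) ` {- R c..R c}"
          using * by (intro imageI) simp
        ultimately show "\<exists>x y. (\<Sum>c\<in>insert c C. a c *\<^sub>R c) = x + y \<and> x \<in> (\<lambda>s. s *\<^sub>R c) ` {- R c..R c} \<and>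
            (\<exists>a. y = (\<Sum>c\<in>C. a c *\<^sub>R c) \<and> (\<forall>c\<in>C. - R c \<le> a c \<and> a c \<le> R c))"
          using *(3) by blast
      qed
      show "?r \<subseteq> ?l"
      proof clarsimp
        fix s a assume *: "- R c \<le> s" "s \<le> R c" "\<forall>c\<in>C. - R c \<le> a c \<and> a c \<le> R c"
        have "s *\<^sub>R c + (\<Sum>d\<in>C. a d *\<^sub>R d) = (\<Sum>d\<in>insert c C. (a(c := s)) d *\<^sub>R d)"
          using insert.hyps by (auto intro!: sum.cong)
        moreover have "\<forall>d\<in>insert c C. - R d \<le> (a(c := s)) d \<and> (a(c := s)) d \<le> R d"
          using * by auto
        ultimately show "\<exists>a'. s *\<^sub>R c + (\<Sum>c\<in>C. a c *\<^sub>R c) = (\<Sum>c\<in>insert c C. a' c *\<^sub>R c) \<and>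
            - R c \<le> a' c \<and> a' c \<le> R c \<and> (\<forall>c\<in>C. - R c \<le> a' c \<and> a' c \<le> R c)"
          by (intro exI[of _ "a(c := s)"]) simp
      qed
    qed
    moreover have "compact ((\<lambda>s. s *\<^sub>R c) ` {- R c..R c})"
      by (intro compact_continuous_image continuous_intros compact_Icc)
    ultimately show ?case
      using compact_sums[OF _ insert.IH] by simp
  qed
  from this[of "\<lambda>c. onorm (\<kappa> c) * (norm z + r)"]
  have comp: "compact {\<Sum>c\<in>C. a c *\<^sub>R c | a.
      \<forall>c\<in>C. a c \<in> {- (onorm (\<kappa> c) * (norm z + r))..onorm (\<kappa> c) * (norm z + r)}}" .
  have sub: "cball z r \<subseteq> {\<Sum>c\<in>C. a c *\<^sub>R c | a.
      \<forall>c\<in>C. a c \<in> {- (onorm (\<kappa> c) * (norm z + r))..onorm (\<kappa> c) * (norm z + r)}}"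
  proof
    fix v assume "v \<in> cball z r"
    then have "norm v \<le> norm z + r"
      using norm_triangle_ineq2[of v z] by (simp add: dist_norm norm_minus_commute)
    then have "\<bar>\<kappa> c v\<bar> \<le> onorm (\<kappa> c) * (norm z + r)" for c
      using order_trans[OF onorm[OF bl, of c v] mult_left_mono[OF _ onorm_pos_le[OF bl, of c]]]
      by simp
    then have "\<forall>c\<in>C. \<kappa> c v \<in> {- (onorm (\<kappa> c) * (norm z + r))..onorm (\<kappa> c) * (norm z + r)}"
      by (simp add: abs_le_iff minus_le_iff)
    then show "v \<in> {\<Sum>c\<in>C. a c *\<^sub>R c | a.
      \<forall>c\<in>C. a c \<in> {- (onorm (\<kappa> c) * (norm z + r))..onorm (\<kappa> c) * (norm z + r)}}"
      unfolding mem_Collect_eq by (intro exI[of _ "\<lambda>c. \<kappa> c v"] conjI rep)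
  qed
  show ?thesis
    using compact_Int_closed[OF comp closed_cball, of z r] by (simp only: Int_absorb1[OF sub])
qed

section \<open>Charts and smooth functions on manifolds\<close>

lemma chart_facts:
  assumes "smooth_manifold M" "(U, \<phi>) \<in> atlas M"
  shows chart_openin: "openin (mtop M) U"
    and chart_subset: "U \<subseteq> points M"
    and chart_inj: "inj_on \<phi> U"
    and chart_image_open: "openin (mtop M) W \<Longrightarrow> open (\<phi> ` (U \<inter> W))"
    and chart_compactin: "K \<subseteq> U \<Longrightarrow> compact (\<phi> ` K) \<Longrightarrow> compactin (mtop M) K"
proof -
  have U: "openin (mtop M) U" and o: "open (\<phi> ` U)"
    and h: "homeomorphic_map (subtopology (mtop M) U) (top_of_set (\<phi> ` U)) \<phi>"
    using assms by (auto simp: smooth_manifold_def)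
  show "openin (mtop M) U" by fact
  then show sub: "U \<subseteq> points M" by (rule openin_subset)
  then have ts: "topspace (subtopology (mtop M) U) = U"
    by auto
  show "inj_on \<phi> U"
    using homeomorphic_imp_injective_map[OF h] ts by simp
  show "open (\<phi> ` (U \<inter> W))" if "openin (mtop M) W"
  proof -
    have "openin (subtopology (mtop M) U) (U \<inter> W)"
      using that by (simp add: openin_subtopology_Int2)
    then have "openin (top_of_set (\<phi> ` U)) (\<phi> ` (U \<inter> W))"
      using homeomorphic_imp_open_map[OF h] by (simp add: open_map_def)
    then show ?thesis
      using o by (rule openin_open_trans)
  qed
  show "compactin (mtop M) K" if K: "K \<subseteq> U" "compact (\<phi> ` K)"
  proof -
    have "compactin (top_of_set (\<phi> ` U)) (\<phi> ` K)"
      using K by (auto simp: compactin_subtopology)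
    moreover have "K \<subseteq> topspace (subtopology (mtop M) U)"
      using K(1) ts by simp
    ultimately have "compactin (subtopology (mtop M) U) K"
      using homeomorphic_map_compactness[OF h, of K] by simp
    then show ?thesis
      by (simp add: compactin_subtopology)
  qed
qed

lemma smooth_manifold_finite_dim:
  "smooth_manifold (M :: ('m, 'b::real_inner) mfd) \<Longrightarrow> finite_dim TYPE('b)"
  by (simp add: smooth_manifold_def)

lemma transition_smooth:
  assumes "smooth_manifold M" "(U, \<phi>) \<in> atlas M" "(U', \<phi>') \<in> atlas M"
  shows "smooth_on (\<phi> ` (U \<inter> U')) (\<phi>' \<circ> inv_into U \<phi>)"
  using assms by (auto simp: smooth_manifold_def)

lemma chart_exists:
  assumes "smooth_manifold M" "x \<in> points M"
  obtains U \<phi> where "(U, \<phi>) \<in> atlas M" "x \<in> U"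
proof -
  have "x \<in> \<Union> (fst ` atlas M)"
    using assms by (simp add: smooth_manifold_def)
  then show thesis
    using that by auto
qed

lemma msmooth_onD:
  "msmooth_on M W f \<Longrightarrow> (U, \<phi>) \<in> atlas M \<Longrightarrow> Ck_on k (\<phi> ` (U \<inter> W)) (f \<circ> inv_into U \<phi>)"
  by (auto simp: msmooth_on_def smooth_on_def)

lemma msmooth_onI:
  "(\<And>U \<phi> k. (U, \<phi>) \<in> atlas M \<Longrightarrow> Ck_on k (\<phi> ` (U \<inter> W)) (f \<circ> inv_into U \<phi>)) \<Longrightarrow> msmooth_on M W f"
  by (auto simp: msmooth_on_def smooth_on_def)

lemma msmooth_on_iff:
  "msmooth_on M W f \<longleftrightarrow>
     (\<forall>(U, \<phi>) \<in> atlas M. \<forall>k. Ck_on k (\<phi> ` (U \<inter> W)) (\<lambda>y. f (inv_into U \<phi> y)))"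
  by (simp add: msmooth_on_def smooth_on_def o_def)

lemma msmooth_on_cong:
  assumes "smooth_manifold M" "openin (mtop M) W" "\<And>x. x \<in> W \<Longrightarrow> f x = g x"
  shows "msmooth_on M W f \<longleftrightarrow> msmooth_on M W g"
proof -
  have "Ck_on k (\<phi> ` (U \<inter> W)) (f \<circ> inv_into U \<phi>) \<longleftrightarrow> Ck_on k (\<phi> ` (U \<inter> W)) (g \<circ> inv_into U \<phi>)"
    if c: "(U, \<phi>) \<in> atlas M" for U \<phi> k
    by (rule Ck_on_cong[OF chart_image_open[OF assms(1) c assms(2)]])
      (auto simp: assms(3) inv_into_f_f[OF chart_inj[OF assms(1) c]])
  then show ?thesis
    unfolding msmooth_on_def smooth_on_def by blast
qed

lemma msmooth_on_subset: "msmooth_on M W f \<Longrightarrow> V \<subseteq> W \<Longrightarrow> msmooth_on M V f"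
  by (rule msmooth_onI) (rule Ck_on_subset[OF msmooth_onD], auto)

lemma msmooth_on_locally:
  assumes "smooth_manifold M"
    and loc: "\<And>x. x \<in> W \<Longrightarrow> \<exists>V. openin (mtop M) V \<and> x \<in> V \<and> msmooth_on M V f"
  shows "msmooth_on M W f"
proof (rule msmooth_onI, rule Ck_on_locally)
  fix U \<phi> k y assume c: "(U, \<phi>) \<in> atlas M" and "y \<in> \<phi> ` (U \<inter> W)"
  then obtain x where x: "x \<in> U" "x \<in> W" "y = \<phi> x"
    by auto
  obtain V where V: "openin (mtop M) V" "x \<in> V" "msmooth_on M V f"
    using loc[OF x(2)] by auto
  show "\<exists>T. open T \<and> y \<in> T \<and> Ck_on k T (f \<circ> inv_into U \<phi>)"
    using chart_image_open[OF assms(1) c V(1)] msmooth_onD[OF V(3) c] x V(2)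
    by (intro exI[of _ "\<phi> ` (U \<inter> V)"]) auto
qed

context
  fixes M :: "('m, 'b::real_inner) mfd" and W :: "'m set"
  assumes M: "smooth_manifold M" and W: "openin (mtop M) W"
begin

lemma msmooth_on_const: "msmooth_on M W (\<lambda>x. c)"
  by (rule msmooth_onI) (simp add: o_def Ck_on_const[OF chart_image_open[OF M _ W]])

lemma msmooth_on_add:
  "msmooth_on M W f \<Longrightarrow> msmooth_on M W g \<Longrightarrow> msmooth_on M W (\<lambda>x. f x + g x)"
  unfolding msmooth_on_iff
  by (auto intro!: Ck_on_add[OF chart_image_open[OF M _ W]])

lemma msmooth_on_sum:
  "(\<And>i. i \<in> I \<Longrightarrow> msmooth_on M W (f i)) \<Longrightarrow> msmooth_on M W (\<lambda>x. \<Sum>i\<in>I. f i x)"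
  by (induction I rule: infinite_finite_induct) (auto intro: msmooth_on_const msmooth_on_add)

lemma msmooth_on_bilinear:
  assumes "bounded_bilinear b"
  shows "msmooth_on M W f \<Longrightarrow> msmooth_on M W g \<Longrightarrow> msmooth_on M W (\<lambda>x. b (f x) (g x))"
  unfolding msmooth_on_iff
  by (auto intro!: Ck_on_bilinear[OF assms chart_image_open[OF M _ W]])

lemma msmooth_on_linear:
  assumes "bounded_linear l"
  shows "msmooth_on M W f \<Longrightarrow> msmooth_on M W (\<lambda>x. l (f x))"
  unfolding msmooth_on_iff
  by (auto intro!: Ck_on_linear[OF assms chart_image_open[OF M _ W]])

end

lemma Cinf_zero: "smooth_manifold M \<Longrightarrow> 0 \<in> Cinf M"
  using msmooth_on_const[of M "points M" 0] by (simp add: Cinf_def zero_fun_def)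

lemma Cinf_add: "smooth_manifold M \<Longrightarrow> f \<in> Cinf M \<Longrightarrow> g \<in> Cinf M \<Longrightarrow> f + g \<in> Cinf M"
  using msmooth_on_add[of M "points M" f g] by (simp add: Cinf_def plus_fun_def)

lemma Cinf_mult: "smooth_manifold M \<Longrightarrow> f \<in> Cinf M \<Longrightarrow> g \<in> Cinf M \<Longrightarrow> f * g \<in> Cinf M"
  using msmooth_on_bilinear[of M "points M" "(*)" f g] bounded_bilinear_mult
  by (simp add: Cinf_def times_fun_def)

lemma Cinf_scaleR: "smooth_manifold M \<Longrightarrow> f \<in> Cinf M \<Longrightarrow> r *\<^sub>R f \<in> Cinf M"
  using msmooth_on_linear[OF _ openin_topspace bounded_linear_scaleR_right, of M f r]
  by (simp add: Cinf_def scaleR_fun_def)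

lemma Cinf_differentiable:
  assumes "smooth_manifold M" "f \<in> Cinf M" "(U, \<phi>) \<in> atlas M" "x \<in> U"
  shows "((f \<circ> inv_into U \<phi>) has_derivative frechet_derivative (f \<circ> inv_into U \<phi>) (at (\<phi> x))) (at (\<phi> x))"
proof -
  have "Ck_on (Suc 0) (\<phi> ` (U \<inter> points M)) (f \<circ> inv_into U \<phi>)"
    using assms by (intro msmooth_onD) (auto simp: Cinf_def)
  then show ?thesis
    by (rule Ck_on_SucD(1)) (use chart_subset[OF assms(1,3)] assms(4) in auto)
qed

text \<open>A bump supported in a chart domain and centred slightly off \<open>x\<close> against the direction \<open>w\<close>
  has non-zero derivative along \<open>w\<close> at \<open>x\<close>.\<close>

lemma exists_Cinf_derivative_nonzero:
  fixes M :: "('m, 'b::real_inner) mfd"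
  assumes M: "smooth_manifold M" and c: "(U, \<phi>) \<in> atlas M" and x: "x \<in> U" and w: "w \<noteq> 0"
  obtains f where "f \<in> Cinf M" "frechet_derivative (f \<circ> inv_into U \<phi>) (at (\<phi> x)) w \<noteq> 0"
proof -
  note fd = smooth_manifold_finite_dim[OF M]
  have oU: "open (\<phi> ` U)"
    using chart_image_open[OF M c chart_openin[OF M c]] by simp
  then obtain e where e: "e > 0" "cball (\<phi> x) e \<subseteq> \<phi> ` U"
    using x open_contains_cball by blast
  \<comment> \<open>The centre \<open>z\<close> lies at distance r/2 from the image of x: near
    enough for q > 0 there and for \<open>cball z r\<close> to stay within distance e (r/2 + r \<le>
    e), yet displaced along w, so that the derivative of q in direction w is - 2 s (w . w), which is
    nonzero.\<close>
  define r where "r = e / 2"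
  define s where "s = r / (2 * norm w)"
  define z where "z = \<phi> x - s *\<^sub>R w"
  have r: "r > 0" and s: "s > 0"
    using e w by (auto simp: r_def s_def)
  have sw: "norm (s *\<^sub>R w) = r / 2"
    using w r by (simp add: s_def)
  have cb: "cball z r \<subseteq> \<phi> ` U"
  proof
    fix y assume "y \<in> cball z r"
    moreover have "dist (\<phi> x) z = r / 2"
      using sw by (simp add: z_def dist_norm)
    ultimately have "dist (\<phi> x) y \<le> e"
      using dist_triangle[of "\<phi> x" y z] r by (simp add: r_def)
    then show "y \<in> \<phi> ` U"
      using e(2) by auto
  qed
  define q where "q = (\<lambda>y. r\<^sup>2 - (y - z) \<bullet> (y - z))"
  define h where "h = (\<lambda>y. flat_exp 0 (q y))"
  have h0: "h y = 0" if "y \<notin> cball z r" for y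
  proof -
    have "r\<^sup>2 < (norm (y - z))\<^sup>2"
      using that r by (intro power_strict_mono) (auto simp: dist_norm norm_minus_commute)
    then show ?thesis
      by (simp add: h_def q_def flat_exp_def power2_norm_eq_inner)
  qed
  have hC: "Ck_on k UNIV h" for k
  proof -
    have "Ck_on k UNIV (\<lambda>y. y + (- z))"
      by (intro Ck_on_add Ck_on_ident Ck_on_const) auto
    from Ck_on_bilinear[OF bounded_bilinear_inner open_UNIV this this]
    have "Ck_on k UNIV (\<lambda>y. r\<^sup>2 + (- 1) * ((y + (- z)) \<bullet> (y + (- z))))"
      by (intro Ck_on_add[OF _ Ck_on_const] Ck_on_bilinear[OF bounded_bilinear_mult _ Ck_on_const]) auto
    then have "Ck_on k UNIV q"
      by (simp add: q_def)
    then show ?thesis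
      unfolding h_def by (intro Ck_on_compose[OF finite_dim_real _ _ Ck_on_flat_exp]) auto
  qed
  \<comment> \<open>\<open>K\<close> is compact and hence closed, so \<open>U\<close> and the
    complement of \<open>K\<close> form an open cover of M; f is h in the chart on the first set and
    0 on the second.\<close>
  define K where "K = {y \<in> U. \<phi> y \<in> cball z r}"
  have "\<phi> ` K = cball z r"
    using cb by (auto simp: K_def)
  then have "compactin (mtop M) K"
    using finite_dim_compact_cball[OF fd, of z r] by (intro chart_compactin[OF M c]) (auto simp: K_def)
  then have K: "openin (mtop M) (points M - K)"
    using M compactin_imp_closedin[of "mtop M" K] by (auto simp: smooth_manifold_def)
  define f where "f = (\<lambda>y. if y \<in> U then h (\<phi> y) else 0)"
  have f0: "f y = 0" if "y \<notin> K" for y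
    using that h0 by (auto simp: f_def K_def)
  have loc1: "msmooth_on M U f"
  proof (rule msmooth_onI)
    fix U' \<phi>' k assume c': "(U', \<phi>') \<in> atlas M"
    note op = chart_image_open[OF M c' chart_openin[OF M c]]
    have "Ck_on k (\<phi>' ` (U' \<inter> U)) (\<lambda>y. h ((\<phi> \<circ> inv_into U' \<phi>') y))"
      using transition_smooth[OF M c' c]
      by (intro Ck_on_compose[OF fd op _ hC]) (auto simp: smooth_on_def o_def)
    moreover have "h ((\<phi> \<circ> inv_into U' \<phi>') y) = (f \<circ> inv_into U' \<phi>') y" if "y \<in> \<phi>' ` (U' \<inter> U)" for y
      using that chart_inj[OF M c'] by (auto simp: f_def)
    ultimately show "Ck_on k (\<phi>' ` (U' \<inter> U)) (f \<circ> inv_into U' \<phi>')"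
      using Ck_on_cong[OF op, of "\<lambda>y. h ((\<phi> \<circ> inv_into U' \<phi>') y)" "f \<circ> inv_into U' \<phi>'" k]
      by blast
  qed
  have loc2: "msmooth_on M (points M - K) f"
    using msmooth_on_cong[OF M K, of f "\<lambda>_. 0"] msmooth_on_const[OF M K] f0 by auto
  have "msmooth_on M (points M) f"
    using loc1 loc2 K chart_openin[OF M c]
    by (intro msmooth_on_locally[OF M]) (auto simp: K_def)
  then have "f \<in> Cinf M"
    using chart_subset[OF M c] by (auto simp: Cinf_def f_def)
  moreover have "frechet_derivative (f \<circ> inv_into U \<phi>) (at (\<phi> x)) w \<noteq> 0"
  proof -
    have "(f \<circ> inv_into U \<phi>) y = h y" if "y \<in> \<phi> ` U" for y
      using that chart_inj[OF M c] by (auto simp: f_def)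
    then have eq: "frechet_derivative (f \<circ> inv_into U \<phi>) (at (\<phi> x)) = frechet_derivative h (at (\<phi> x))"
      using x by (intro frechet_derivative_cong_open[OF oU]) auto
    have "(q has_derivative (\<lambda>v. - (2 * ((\<phi> x - z) \<bullet> v)))) (at (\<phi> x))"
      unfolding q_def by (auto intro!: derivative_eq_intros simp: inner_commute)
    from has_derivative_compose[OF this flat_exp_deriv[of 0]]
    have "(h has_derivative (\<lambda>v. - (2 * ((\<phi> x - z) \<bullet> v)) * flat_exp 2 (q (\<phi> x)))) (at (\<phi> x))"
      by (simp add: h_def numeral_2_eq_2)
    from fun_cong[OF frechet_derivative_at[OF this], of w]
    have "frechet_derivative h (at (\<phi> x)) w = - (2 * (s * (w \<bullet> w))) * flat_exp 2 (q (\<phi> x))"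
      by (simp add: z_def)
    moreover have "q (\<phi> x) > 0"
    proof -
      have q: "q (\<phi> x) = r\<^sup>2 - (r / 2)\<^sup>2"
        unfolding sw[symmetric] power2_norm_eq_inner by (simp add: q_def z_def)
      show ?thesis
        unfolding q using r by (simp add: power_divide)
    qed
    ultimately show ?thesis
      using s w by (simp add: eq flat_exp_def)
  qed
  ultimately show thesis
    using that by blast
qed

section \<open>Tangent vectors\<close>

text \<open>The chain rule for the transition map. Since \<open>tangent_space\<close> collects
  vectors from all charts at x, this is what allows any of them to be written in one chosen
  chart.\<close>

lemma coord_vec_change:
  assumes M: "smooth_manifold M" and c: "(U, \<phi>) \<in> atlas M" and c': "(U', \<phi>') \<in> atlas M"
    and x: "x \<in> U" "x \<in> U'"
  shows "coord_vec M U' \<phi>' x w =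
    coord_vec M U \<phi> x (frechet_derivative (\<phi> \<circ> inv_into U' \<phi>') (at (\<phi>' x)) w)"
proof -
  let ?\<tau> = "\<phi> \<circ> inv_into U' \<phi>'"
  have "frechet_derivative (f \<circ> inv_into U' \<phi>') (at (\<phi>' x)) w =
      frechet_derivative (f \<circ> inv_into U \<phi>) (at (\<phi> x)) (frechet_derivative ?\<tau> (at (\<phi>' x)) w)"
    if f: "f \<in> Cinf M" for f
  proof -
    have "Ck_on (Suc 0) (\<phi>' ` (U' \<inter> U)) ?\<tau>"
      using transition_smooth[OF M c' c] by (auto simp: smooth_on_def)
    then have \<tau>: "(?\<tau> has_derivative frechet_derivative ?\<tau> (at (\<phi>' x))) (at (\<phi>' x))"
      by (rule Ck_on_SucD(1)) (use x in auto)
    have "?\<tau> (\<phi>' x) = \<phi> x"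
      using x chart_inj[OF M c'] by simp
    then have fD: "((f \<circ> inv_into U \<phi>) has_derivative frechet_derivative (f \<circ> inv_into U \<phi>) (at (\<phi> x)))
        (at (?\<tau> (\<phi>' x)))"
      using Cinf_differentiable[OF M f c x(1)] by simp
    have "((f \<circ> inv_into U' \<phi>') has_derivative (\<lambda>v. frechet_derivative (f \<circ> inv_into U \<phi>) (at (\<phi> x))
        (frechet_derivative ?\<tau> (at (\<phi>' x)) v))) (at (\<phi>' x))"
    proof (rule has_derivative_transform_within_open[OF has_derivative_compose[OF \<tau> fD]])
      show "open (\<phi>' ` (U' \<inter> U))"
        by (rule chart_image_open[OF M c' chart_openin[OF M c]])
      show "\<phi>' x \<in> \<phi>' ` (U' \<inter> U)"
        using x by auto
      show "(f \<circ> inv_into U \<phi>) (?\<tau> y) = (f \<circ> inv_into U' \<phi>') y" if "y \<in> \<phi>' ` (U' \<inter> U)" for y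
        using that chart_inj[OF M c] chart_inj[OF M c'] by auto
    qed
    from frechet_derivative_at[OF this] show ?thesis
      by metis
  qed
  then show ?thesis
    by (auto simp: coord_vec_def)
qed

lemma coord_vec_inject:
  assumes M: "smooth_manifold M" and c: "(U, \<phi>) \<in> atlas M" and x: "x \<in> U"
    and eq: "coord_vec M U \<phi> x w = coord_vec M U \<phi> x w'"
  shows "w = w'"
proof (rule ccontr)
  assume "w \<noteq> w'"
  then have "w - w' \<noteq> 0"
    by simp
  from exists_Cinf_derivative_nonzero[OF M c x this] obtain f where f: "f \<in> Cinf M"
    and D: "frechet_derivative (f \<circ> inv_into U \<phi>) (at (\<phi> x)) (w - w') \<noteq> 0" .
  interpret bounded_linear "frechet_derivative (f \<circ> inv_into U \<phi>) (at (\<phi> x))"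
    using Cinf_differentiable[OF M f c x] by (rule has_derivative_bounded_linear)
  show False
    using fun_cong[OF eq, of f] f D by (simp add: coord_vec_def diff)
qed

text \<open>The definite description in \<open>tangent_coord\<close> is meaningful: existence is the
  change of charts, uniqueness is \<open>coord_vec_inject\<close>.\<close>

lemma coord_vec_tangent_coord:
  assumes M: "smooth_manifold M" and c: "(U, \<phi>) \<in> atlas M" and x: "x \<in> U"
    and V: "V \<in> tangent_space M x"
  shows "coord_vec M U \<phi> x (tangent_coord M U \<phi> x V) = V"
proof -
  obtain w where w: "V = coord_vec M U \<phi> x w"
    using V coord_vec_change[OF M c _ x] by (auto simp: tangent_space_def)
  then have "tangent_coord M U \<phi> x V = w"
    unfolding tangent_coord_def using coord_vec_inject[OF M c x] by (intro the_equality) auto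
  with w show ?thesis
    by simp
qed

lemma tangent_space_derivation:
  assumes M: "smooth_manifold M" and V: "V \<in> tangent_space M x"
    and f: "f \<in> Cinf M"
  shows "g \<in> Cinf M \<Longrightarrow> V (f + g) = V f + V g"
    and "V (r *\<^sub>R f) = r * V f"
    and "g \<in> Cinf M \<Longrightarrow> V (f * g) = f x * V g + V f * g x"
proof -
  obtain U \<phi> w where c: "(U, \<phi>) \<in> atlas M" and x: "x \<in> U" and w: "V = coord_vec M U \<phi> x w"
    using V by (auto simp: tangent_space_def)
  note fD = Cinf_differentiable[OF M f c x]
  have inv: "inv_into U \<phi> (\<phi> x) = x"
    using chart_inj[OF M c] x by simp
  show "V (f + g) = V f + V g" if g: "g \<in> Cinf M"
    using fun_cong[OF frechet_derivative_at[OF has_derivative_add[OF fD Cinf_differentiable[OF M g c x]]], of w]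
      f g Cinf_add[OF M f g]
    by (simp add: w coord_vec_def o_def plus_fun_def)
  show "V (r *\<^sub>R f) = r * V f"
    using fun_cong[OF frechet_derivative_at[OF has_derivative_scaleR_right[OF fD, of r]], of w] f Cinf_scaleR[OF M f, of r]
    by (simp add: w coord_vec_def o_def scaleR_fun_def)
  show "V (f * g) = f x * V g + V f * g x" if g: "g \<in> Cinf M"
    using fun_cong[OF frechet_derivative_at[OF has_derivative_mult[OF fD Cinf_differentiable[OF M g c x]]], of w]
      f g Cinf_mult[OF M f g] inv
    by (simp add: w coord_vec_def o_def times_fun_def)
qed

lemma scaleR_fun_apply [simp]: "(r *\<^sub>R f) x = r *\<^sub>R f x"
  by (simp add: scaleR_fun_def)

lemma sum_fun_apply: "(\<Sum>i\<in>I. f i) x = (\<Sum>i\<in>I. f i x)"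
  by (induction I rule: infinite_finite_induct) auto

text \<open>Instantiated with the empty family this also serves to obtain f 0 = 0, which
  \<open>linear_between\<close> states only through homogeneity.\<close>

lemma linear_between_sum:
  assumes "linear_between V W f" "subspace V" "finite I" "\<And>i. i \<in> I \<Longrightarrow> v i \<in> V"
  shows "f (\<Sum>i\<in>I. a i *\<^sub>R v i) = (\<Sum>i\<in>I. a i *\<^sub>R f (v i))"
  using assms(3,4)
proof (induction I)
  case empty
  have "f (0 *\<^sub>R 0) = 0 *\<^sub>R f 0"
    using assms(1) subspace_0[OF assms(2)] by (simp only: linear_between_def)
  then show ?case by simp
next
  case (insert i I)
  have "a i *\<^sub>R v i \<in> V" "(\<Sum>i\<in>I. a i *\<^sub>R v i) \<in> V"
    using insert.prems by (auto intro!: subspace_scale[OF assms(2)] subspace_sum[OF assms(2)])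
  then show ?case
    using insert assms(1) by (simp add: linear_between_def)
qed

section \<open>Modules of sections\<close>

context
  fixes M :: "('m, 'b::real_inner) mfd" and E :: "('m, 'e::real_vector, 'v::real_inner) vbundle"
  assumes M: "smooth_manifold M" and E: "vector_bundle M E"
begin

lemma triv_facts:
  assumes "(U, \<psi>) \<in> trivs E"
  shows triv_openin: "openin (mtop M) U"
    and triv_linear: "x \<in> U \<Longrightarrow> linear_between (fibre E x) UNIV (\<psi> x)"
    and triv_bij: "x \<in> U \<Longrightarrow> bij_betw (\<psi> x) (fibre E x) UNIV"
  using E assms by (auto simp: vector_bundle_def)

lemma triv_points: "(U, \<psi>) \<in> trivs E \<Longrightarrow> x \<in> U \<Longrightarrow> x \<in> points M"
  using openin_subset[OF triv_openin] by blast

lemma fibre_subspace: "x \<in> points M \<Longrightarrow> subspace (fibre E x)"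
  using E by (simp add: vector_bundle_def)

lemma Sec_fibre: "X \<in> Sec M E \<Longrightarrow> x \<in> points M \<Longrightarrow> X x \<in> fibre E x"
  by (simp add: Sec_def)

lemma Sec_outside: "X \<in> Sec M E \<Longrightarrow> x \<notin> points M \<Longrightarrow> X x = 0"
  by (simp add: Sec_def)

lemma Sec_zero: "0 \<in> Sec M E"
proof -
  have "msmooth_on M U (\<lambda>x. \<psi> x 0)" if t: "(U, \<psi>) \<in> trivs E" for U \<psi>
  proof -
    have "\<psi> x 0 = 0" if "x \<in> U" for x
      using linear_between_sum[OF triv_linear[OF t that] fibre_subspace[OF triv_points[OF t that]],
          of "{}"] by simp
    then show ?thesis
      using msmooth_on_cong[OF M triv_openin[OF t], of "\<lambda>x. \<psi> x 0" "\<lambda>_. 0"]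
        msmooth_on_const[OF M triv_openin[OF t]] by auto
  qed
  then show ?thesis
    using fibre_subspace subspace_0 by (auto simp: Sec_def)
qed

lemma Sec_add: "X \<in> Sec M E \<Longrightarrow> Y \<in> Sec M E \<Longrightarrow> X + Y \<in> Sec M E"
proof -
  assume X: "X \<in> Sec M E" and Y: "Y \<in> Sec M E"
  have "msmooth_on M U (\<lambda>x. \<psi> x (X x + Y x))" if t: "(U, \<psi>) \<in> trivs E" for U \<psi>
  proof -
    have "\<psi> x (X x + Y x) = \<psi> x (X x) + \<psi> x (Y x)" if "x \<in> U" for x
      using triv_linear[OF t that] Sec_fibre[OF X] Sec_fibre[OF Y] triv_points[OF t that]
      by (auto simp: linear_between_def)
    moreover have "msmooth_on M U (\<lambda>x. \<psi> x (X x) + \<psi> x (Y x))"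
      using X Y t by (intro msmooth_on_add[OF M triv_openin[OF t]]) (auto simp: Sec_def)
    ultimately show ?thesis
      by (simp cong: msmooth_on_cong[OF M triv_openin[OF t]])
  qed
  then show ?thesis
    using X Y subspace_add[OF fibre_subspace] by (auto simp: Sec_def)
qed

lemma Sec_fscale: "f \<in> Cinf M \<Longrightarrow> X \<in> Sec M E \<Longrightarrow> f \<odot> X \<in> Sec M E"
proof -
  assume f: "f \<in> Cinf M" and X: "X \<in> Sec M E"
  have "msmooth_on M U (\<lambda>x. \<psi> x (f x *\<^sub>R X x))" if t: "(U, \<psi>) \<in> trivs E" for U \<psi>
  proof -
    have "\<psi> x (f x *\<^sub>R X x) = f x *\<^sub>R \<psi> x (X x)" if "x \<in> U" for x
      using triv_linear[OF t that] Sec_fibre[OF X] triv_points[OF t that]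
      by (auto simp: linear_between_def)
    moreover have "msmooth_on M U f"
      using f openin_subset[OF triv_openin[OF t]] by (auto simp: Cinf_def intro: msmooth_on_subset)
    then have "msmooth_on M U (\<lambda>x. f x *\<^sub>R \<psi> x (X x))"
      using X t by (intro msmooth_on_bilinear[OF M triv_openin[OF t] bounded_bilinear_scaleR])
        (auto simp: Sec_def)
    ultimately show ?thesis
      by (simp cong: msmooth_on_cong[OF M triv_openin[OF t]])
  qed
  then show ?thesis
    using X subspace_scale[OF fibre_subspace] by (auto simp: Sec_def fscale_def)
qed

lemma Sec_scaleR: "X \<in> Sec M E \<Longrightarrow> r *\<^sub>R X \<in> Sec M E"
proof -
  assume X: "X \<in> Sec M E"
  \<comment> \<open>The constant r is cut off outside M because members of \<open>Cinf M\<close>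
    vanish there; scaling becomes a case of \<open>Sec_fscale\<close>.\<close>
  define f where "f = (\<lambda>x. if x \<in> points M then r else 0)"
  have "f \<in> Cinf M"
    using msmooth_on_cong[OF M openin_topspace, of f "\<lambda>_. r"] msmooth_on_const[OF M openin_topspace]
    by (auto simp: Cinf_def f_def)
  then have "f \<odot> X \<in> Sec M E"
    using X by (rule Sec_fscale)
  moreover have "f \<odot> X = r *\<^sub>R X"
    using Sec_outside[OF X] by (auto simp: f_def fscale_def scaleR_fun_def)
  ultimately show ?thesis by simp
qed

text \<open>The vectors \<open>inv_into (fibre E x) (\<psi> x) c\<close> form a local frame,
  possibly redundant. These are the vectors on which \<open>vb_morphism\<close> makes a smoothness
  statement, so general sections are reduced to them.\<close>

lemma triv_expand:
  assumes t: "(U, \<psi>) \<in> trivs E" and x: "x \<in> U" and v: "v \<in> fibre E x"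
    and C: "finite C" and rep: "\<And>u::'v. u = (\<Sum>c\<in>C. \<kappa> c u *\<^sub>R c)"
  shows "v = (\<Sum>c\<in>C. \<kappa> c (\<psi> x v) *\<^sub>R inv_into (fibre E x) (\<psi> x) c)"
proof -
  let ?i = "inv_into (fibre E x) (\<psi> x)"
  note b = triv_bij[OF t x] and sub = fibre_subspace[OF triv_points[OF t x]]
  have i: "?i c \<in> fibre E x" "\<psi> x (?i c) = c" for c
    using b by (auto simp: bij_betw_def f_inv_into_f intro!: inv_into_into)
  have "\<psi> x (\<Sum>c\<in>C. \<kappa> c (\<psi> x v) *\<^sub>R ?i c) = (\<Sum>c\<in>C. \<kappa> c (\<psi> x v) *\<^sub>R c)"
    using linear_between_sum[OF triv_linear[OF t x] sub C, of ?i] i by simp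
  also have "\<dots> = \<psi> x v"
    by (rule rep[symmetric])
  finally have "\<psi> x (\<Sum>c\<in>C. \<kappa> c (\<psi> x v) *\<^sub>R ?i c) = \<psi> x v" .
  moreover have "(\<Sum>c\<in>C. \<kappa> c (\<psi> x v) *\<^sub>R ?i c) \<in> fibre E x"
    using i by (intro subspace_sum[OF sub] subspace_scale[OF sub]) auto
  ultimately show ?thesis
    using v b by (metis bij_betw_imp_inj_on inj_onD)
qed

section \<open>The action of the anchor on functions\<close>

context
  fixes \<rho> :: "'m \<Rightarrow> 'e \<Rightarrow> 'm tvec"
  assumes \<rho>: "vb_morphism M E (tangent_bundle M) \<rho>"
begin

lemma anchor_linear: "x \<in> points M \<Longrightarrow> linear_between (fibre E x) (tangent_space M x) (\<rho> x)"
  using \<rho> by (simp add: vb_morphism_def tangent_bundle_def)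

lemma anchor_tangent: "X \<in> Sec M E \<Longrightarrow> x \<in> points M \<Longrightarrow> \<rho> x (X x) \<in> tangent_space M x"
  using anchor_linear[of x] Sec_fibre[of X x] by (auto simp: linear_between_def)

text \<open>Locally the function is a finite sum of products of three kinds of smooth functions:
  frame coefficients of X, chart coordinates of \<rho> on frame vectors, and directional derivatives
  of f along fixed vectors of the model space.\<close>

lemma anchor_act_Cinf:
  assumes X: "X \<in> Sec M E" and f: "f \<in> Cinf M"
  shows "anchor_act M \<rho> X f \<in> Cinf M"
proof -
  have "\<exists>V. openin (mtop M) V \<and> x \<in> V \<and> msmooth_on M V (anchor_act M \<rho> X f)"
    if x: "x \<in> points M" for x
  proof -
    obtain U \<phi> where c: "(U, \<phi>) \<in> atlas M" and xU: "x \<in> U"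
      using chart_exists[OF M x] .
    have "x \<in> \<Union> (fst ` trivs E)"
      using E x by (simp add: vector_bundle_def)
    then obtain U' \<psi> where t: "(U', \<psi>) \<in> trivs E" and xU': "x \<in> U'"
      by auto
    let ?V = "U' \<inter> U"
    have V: "openin (mtop M) ?V"
      using triv_openin[OF t] chart_openin[OF M c] by blast
    have "finite_dim TYPE('v)"
      using E by (simp add: vector_bundle_def)
    then obtain C :: "'v set" and \<kappa> where C: "finite C" and bl: "\<And>c. bounded_linear (\<kappa> c)"
      and rep: "\<And>v. v = (\<Sum>c\<in>C. \<kappa> c v *\<^sub>R c)"
      using finite_dim_coords by blast
    obtain B :: "'b set" and \<beta> where B: "finite B" and bl': "\<And>c. bounded_linear (\<beta> c)"
      and rep': "\<And>v. v = (\<Sum>b\<in>B. \<beta> b v *\<^sub>R b)"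
      using finite_dim_coords[OF smooth_manifold_finite_dim[OF M]] by blast
    \<comment> \<open>\<open>w c\<close> holds the coordinates in the chart \<phi> of \<rho> on the
      frame vector number c, and \<open>D y b\<close> is the derivative of f at y along b in the
      same chart.\<close>
    define w where "w = (\<lambda>c y. tangent_coord M U \<phi> y (\<rho> y (inv_into (fibre E y) (\<psi> y) c)))"
    define D where "D = (\<lambda>y. frechet_derivative (f \<circ> inv_into U \<phi>) (at (\<phi> y)))"
    have eq: "anchor_act M \<rho> X f y = (\<Sum>c\<in>C. \<kappa> c (\<psi> y (X y)) * (\<Sum>b\<in>B. \<beta> b (w c y) * D y b))"
      if y: "y \<in> ?V" for y
    proof -
      let ?i = "inv_into (fibre E y) (\<psi> y)"
      have yM: "y \<in> points M"
        using triv_points[OF t] y by auto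
      have i: "?i c \<in> fibre E y" for c
        using triv_bij[OF t] y by (auto simp: bij_betw_def intro!: inv_into_into)
      have "\<rho> y (X y) = \<rho> y (\<Sum>c\<in>C. \<kappa> c (\<psi> y (X y)) *\<^sub>R ?i c)"
        using y by (intro arg_cong[of _ _ "\<rho> y"] triv_expand[OF t _ Sec_fibre[OF X yM] C rep]) auto
      also have "\<dots> = (\<Sum>c\<in>C. \<kappa> c (\<psi> y (X y)) *\<^sub>R \<rho> y (?i c))"
        using i by (intro linear_between_sum[OF anchor_linear[OF yM] fibre_subspace[OF yM] C])
      finally have "\<rho> y (X y) f = (\<Sum>c\<in>C. \<kappa> c (\<psi> y (X y)) * \<rho> y (?i c) f)"
        by (simp add: sum_fun_apply scaleR_fun_def)
      moreover have "\<rho> y (?i c) f = (\<Sum>b\<in>B. \<beta> b (w c y) * D y b)" for c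
      proof -
        interpret bounded_linear "D y"
          unfolding D_def using Cinf_differentiable[OF M f c] y
          by (auto intro: has_derivative_bounded_linear)
        have "\<rho> y (?i c) \<in> tangent_space M y"
          using anchor_linear[OF yM] i by (auto simp: linear_between_def)
        then have "\<rho> y (?i c) = coord_vec M U \<phi> y (w c y)"
          unfolding w_def using coord_vec_tangent_coord[OF M c] y by simp
        then have "\<rho> y (?i c) f = D y (w c y)"
          using f by (simp add: coord_vec_def D_def)
        also have "\<dots> = D y (\<Sum>b\<in>B. \<beta> b (w c y) *\<^sub>R b)"
          by (rule arg_cong[OF rep'])
        finally show ?thesis
          by (simp add: sum scaleR)
      qed
      ultimately show ?thesis
        using yM by (simp add: anchor_act_def)
    qed
    have sX: "msmooth_on M ?V (\<lambda>y. \<psi> y (X y))"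
      using X t by (auto simp: Sec_def intro: msmooth_on_subset)
    have "(U, tangent_coord M U \<phi>) \<in> trivs (tangent_bundle M)"
      using c by (auto simp: tangent_bundle_def)
    then have sw: "msmooth_on M ?V (w c)" for c
      using \<rho> t unfolding vb_morphism_def w_def by fastforce
    \<comment> \<open>Smoothness is tested in an arbitrary chart \<phi>1, whereas \<open>D\<close>
      is computed in \<phi>; the transition map between them is composed with the
      derivative.\<close>
    have sD: "msmooth_on M ?V (\<lambda>y. D y b)" for b
    proof (rule msmooth_onI)
      fix U1 \<phi>1 k assume c1: "(U1, \<phi>1) \<in> atlas M"
      have "Ck_on (Suc k) (\<phi> ` (U \<inter> points M)) (f \<circ> inv_into U \<phi>)"
        using f c by (intro msmooth_onD) (auto simp: Cinf_def)
      then have 1: "Ck_on k (\<phi> ` U) (\<lambda>z. frechet_derivative (f \<circ> inv_into U \<phi>) (at z) b)"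
        using Ck_on_SucD(2) chart_subset[OF M c] by (metis inf.absorb1)
      have "Ck_on k (\<phi>1 ` (U1 \<inter> U)) (\<phi> \<circ> inv_into U1 \<phi>1)"
        using transition_smooth[OF M c1 c] by (auto simp: smooth_on_def)
      then have 2: "Ck_on k (\<phi>1 ` (U1 \<inter> ?V)) (\<phi> \<circ> inv_into U1 \<phi>1)"
        by (rule Ck_on_subset) auto
      have "(\<phi> \<circ> inv_into U1 \<phi>1) ` \<phi>1 ` (U1 \<inter> ?V) \<subseteq> \<phi> ` U"
        using chart_inj[OF M c1] by auto
      from Ck_on_compose[OF smooth_manifold_finite_dim[OF M] chart_image_open[OF M c1 V] this 1 2]
      show "Ck_on k (\<phi>1 ` (U1 \<inter> ?V)) ((\<lambda>y. D y b) \<circ> inv_into U1 \<phi>1)"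
        by (simp add: D_def o_def)
    qed
    have "msmooth_on M ?V (\<lambda>y. \<Sum>c\<in>C. \<kappa> c (\<psi> y (X y)) * (\<Sum>b\<in>B. \<beta> b (w c y) * D y b))"
      by (intro msmooth_on_sum[OF M V] msmooth_on_bilinear[OF M V bounded_bilinear_mult]
          msmooth_on_linear[OF M V bl] msmooth_on_linear[OF M V bl'] sX sw sD)
    then have "msmooth_on M ?V (anchor_act M \<rho> X f)"
      using msmooth_on_cong[OF M V, OF eq] by simp
    then show ?thesis
      using V xU xU' by blast
  qed
  then have "msmooth_on M (points M) (anchor_act M \<rho> X f)"
    by (rule msmooth_on_locally[OF M])
  then show ?thesis
    by (simp add: Cinf_def anchor_act_def)
qed

lemma anchor_act_add:
  "X \<in> Sec M E \<Longrightarrow> f \<in> Cinf M \<Longrightarrow> g \<in> Cinf M \<Longrightarrow>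
    anchor_act M \<rho> X (f + g) = anchor_act M \<rho> X f + anchor_act M \<rho> X g"
  by (auto simp: anchor_act_def fun_eq_iff tangent_space_derivation(1)[OF M anchor_tangent])

lemma anchor_act_scaleR:
  "X \<in> Sec M E \<Longrightarrow> f \<in> Cinf M \<Longrightarrow> anchor_act M \<rho> X (r *\<^sub>R f) = r *\<^sub>R anchor_act M \<rho> X f"
  by (auto simp: anchor_act_def fun_eq_iff tangent_space_derivation(2)[OF M anchor_tangent])

lemma anchor_act_mult:
  "X \<in> Sec M E \<Longrightarrow> f \<in> Cinf M \<Longrightarrow> g \<in> Cinf M \<Longrightarrow>
    anchor_act M \<rho> X (f * g) = f * anchor_act M \<rho> X g + anchor_act M \<rho> X f * g"
  by (auto simp: anchor_act_def fun_eq_iff tangent_space_derivation(3)[OF M anchor_tangent])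

lemma anchor_act_add_sec:
  "X \<in> Sec M E \<Longrightarrow> Y \<in> Sec M E \<Longrightarrow>
    anchor_act M \<rho> (X + Y) f = anchor_act M \<rho> X f + anchor_act M \<rho> Y f"
  using anchor_linear Sec_fibre by (auto simp: anchor_act_def fun_eq_iff linear_between_def)

lemma anchor_act_scaleR_sec:
  "X \<in> Sec M E \<Longrightarrow> anchor_act M \<rho> (r *\<^sub>R X) f = r *\<^sub>R anchor_act M \<rho> X f"
  using anchor_linear Sec_fibre by (auto simp: anchor_act_def fun_eq_iff linear_between_def scaleR_fun_def)

lemma anchor_act_fscale_sec:
  "X \<in> Sec M E \<Longrightarrow> anchor_act M \<rho> (g \<odot> X) f = g * anchor_act M \<rho> X f"
  using anchor_linear Sec_fibre
  by (auto simp: anchor_act_def fun_eq_iff linear_between_def scaleR_fun_def fscale_def)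

end

end

section \<open>The shuffle product and contractions\<close>

text \<open>Describes the shuffles of \<open>X # Xs\<close> in which the new argument X comes first
  in the left block.\<close>

definition perm_lift :: "(nat \<Rightarrow> nat) \<Rightarrow> nat \<Rightarrow> nat" where
  "perm_lift \<tau> i = (case i of 0 \<Rightarrow> 0 | Suc j \<Rightarrow> Suc (\<tau> j))"

lemma perm_lift_simps [simp]: "perm_lift \<tau> 0 = 0" "perm_lift \<tau> (Suc j) = Suc (\<tau> j)"
  by (simp_all add: perm_lift_def)

lemma perm_lift_inject: "perm_lift \<tau> = perm_lift \<tau>' \<Longrightarrow> \<tau> = \<tau>'"
proof
  fix i assume "perm_lift \<tau> = perm_lift \<tau>'"
  from fun_cong[OF this, of "Suc i"] show "\<tau> i = \<tau>' i" by simp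
qed

lemma perm_lift_permutes:
  assumes "\<tau> permutes {..<n}"
  shows "perm_lift \<tau> permutes {..<Suc n}"
  unfolding permutes_def
proof (intro conjI allI impI)
  fix i assume "i \<notin> {..<Suc n}"
  then show "perm_lift \<tau> i = i"
    using permutes_not_in[OF assms] by (cases i) auto
next
  fix j show "\<exists>!i. perm_lift \<tau> i = j"
  proof (cases j)
    case 0
    have "perm_lift \<tau> i = 0 \<longleftrightarrow> i = 0" for i
      by (cases i) auto
    then show ?thesis
      unfolding 0 by simp
  next
    case (Suc j')
    obtain i' where i': "\<And>k. \<tau> k = j' \<longleftrightarrow> k = i'"
      using assms unfolding permutes_def by metis
    have "perm_lift \<tau> i = Suc j' \<longleftrightarrow> i = Suc i'" for i
      using i' by (cases i) auto
    then show ?thesis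
      unfolding Suc by simp
  qed
qed

lemma perm_lift_surj:
  assumes \<pi>: "\<pi> permutes {..<Suc n}" and 0: "\<pi> 0 = 0"
  obtains \<tau> where "\<tau> permutes {..<n}" "\<pi> = perm_lift \<tau>"
proof
  \<comment> \<open>The truncated subtraction is harmless: by injectivity and \<pi> 0 = 0, no later
    index has the value 0.\<close>
  let ?\<tau> = "\<lambda>i. \<pi> (Suc i) - 1"
  have pos: "\<pi> (Suc i) \<noteq> 0" for i
    using 0 permutes_inj[OF \<pi>] by (metis injD nat.distinct(1))
  show "\<pi> = perm_lift ?\<tau>"
  proof
    fix i show "\<pi> i = perm_lift ?\<tau> i"
      using 0 pos by (cases i) auto
  qed
  show "?\<tau> permutes {..<n}"
    unfolding permutes_def
  proof (intro conjI allI impI)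
    fix i assume "i \<notin> {..<n}"
    then show "?\<tau> i = i"
      using permutes_not_in[OF \<pi>, of "Suc i"] by auto
  next
    fix j
    obtain i where i: "\<And>k. \<pi> k = Suc j \<longleftrightarrow> k = i"
      using \<pi> unfolding permutes_def by metis
    have "i \<noteq> 0"
      using 0 i[of 0] by auto
    then obtain i' where i': "i = Suc i'"
      by (cases i) auto
    show "\<exists>!i. ?\<tau> i = j"
    proof (rule ex1I[of _ i'])
      show "?\<tau> i' = j"
        using i[of i] i' by simp
      fix k assume "?\<tau> k = j"
      then have "\<pi> (Suc k) = Suc j"
        using pos[of k] by simp
      then show "k = i'"
        using i i' by blast
    qed
  qed
qed

text \<open>Lifting commutes with composition and turns the transposition of a and b into that of a
  + 1 and b + 1, so the number of transpositions is preserved.\<close>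

lemma sign_perm_lift:
  assumes "\<tau> permutes {..<n}"
  shows "sign (perm_lift \<tau>) = sign \<tau>"
  using assms finite_lessThan
proof (induction rule: permutes_induct)
  case id
  have "perm_lift id = id"
    by (auto simp: perm_lift_def fun_eq_iff split: nat.split)
  then show ?case by (simp only:)
next
  case (swap a b \<tau>)
  have eq: "perm_lift (Transposition.transpose a b \<circ> \<tau>) =
      Transposition.transpose (Suc a) (Suc b) \<circ> perm_lift \<tau>"
  proof
    fix i show "perm_lift (Transposition.transpose a b \<circ> \<tau>) i =
        (Transposition.transpose (Suc a) (Suc b) \<circ> perm_lift \<tau>) i"
      by (cases i) (auto simp: Transposition.transpose_def)
  qed
  have perm: "permutation (perm_lift \<tau>)" "permutation \<tau>"
    using swap permutation_permutes finite_lessThan perm_lift_permutes by blast+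
  have "sign (perm_lift (Transposition.transpose a b \<circ> \<tau>)) =
      sign (Transposition.transpose (Suc a) (Suc b)) * sign (perm_lift \<tau>)"
    by (simp only: eq sign_compose[OF permutation_swap_id perm(1)])
  also have "\<dots> = sign (Transposition.transpose a b) * sign \<tau>"
    using swap by (simp add: sign_swap_id)
  also have "\<dots> = sign (Transposition.transpose a b \<circ> \<tau>)"
    by (simp only: sign_compose[OF permutation_swap_id perm(2)])
  finally show ?case .
qed

text \<open>The cycle sending p to 0 and every i < p to i + 1, built from p adjacent transpositions
  so that its sign (-1)^p can be read off. It moves the head of the right block past the p arguments
  of the left block.\<close>

primrec front_cycle :: "nat \<Rightarrow> nat \<Rightarrow> nat" where
  "front_cycle 0 = id"
| "front_cycle (Suc p) = front_cycle p \<circ> Transposition.transpose p (Suc p)"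

lemma front_cycle_apply:
  "front_cycle p i = (if i < p then Suc i else if i = p then 0 else i)"
  by (induction p arbitrary: i) (auto simp: Transposition.transpose_def)

lemma front_cycle_permutes: "front_cycle p permutes {..p}"
proof (induction p)
  case (Suc p)
  have "front_cycle p permutes {..Suc p}"
    using Suc by (rule permutes_subset) auto
  then show ?case
    unfolding front_cycle.simps by (intro permutes_compose permutes_swap_id) auto
qed (simp only: front_cycle.simps permutes_id)

lemma sign_front_cycle: "sign (front_cycle p) = (- 1) ^ p"
proof (induction p)
  case (Suc p)
  have perm: "permutation (front_cycle p)"
    using front_cycle_permutes permutation_permutes by blast
  show ?case
    unfolding front_cycle.simps sign_compose[OF perm permutation_swap_id] Suc
    by (simp add: sign_swap_id)
qed simp

text \<open>Deleting the first argument from the left block of a shuffle leaves a shuffle with a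
  left block shorter by one.\<close>

lemma shuffle_first_left:
  "bij_betw perm_lift (shuffle_perms p q) {\<sigma> \<in> shuffle_perms (Suc p) q. \<sigma> 0 = 0}"
proof (rule bij_betwI')
  fix \<tau> \<tau>' show "perm_lift \<tau> = perm_lift \<tau>' \<longleftrightarrow> \<tau> = \<tau>'"
    using perm_lift_inject by blast
next
  fix \<tau> assume \<tau>: "\<tau> \<in> shuffle_perms p q"
  have "strict_mono_on {..<Suc p} (perm_lift \<tau>)"
  proof (rule strict_mono_onI)
    fix i j assume "i \<in> {..<Suc p}" "j \<in> {..<Suc p}" "i < j"
    then show "perm_lift \<tau> i < perm_lift \<tau> j"
      using \<tau> by (cases i; cases j) (auto simp: shuffle_perms_def strict_mono_on_def)
  qed
  moreover have "strict_mono_on {Suc p..<Suc p + q} (perm_lift \<tau>)"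
  proof (rule strict_mono_onI)
    fix i j assume "i \<in> {Suc p..<Suc p + q}" "j \<in> {Suc p..<Suc p + q}" "i < j"
    then show "perm_lift \<tau> i < perm_lift \<tau> j"
      using \<tau> by (cases i; cases j) (auto simp: shuffle_perms_def strict_mono_on_def)
  qed
  ultimately show "perm_lift \<tau> \<in> {\<sigma> \<in> shuffle_perms (Suc p) q. \<sigma> 0 = 0}"
    using \<tau> perm_lift_permutes[of \<tau> "p + q"] by (simp add: shuffle_perms_def)
next
  fix \<sigma> assume \<sigma>: "\<sigma> \<in> {\<sigma> \<in> shuffle_perms (Suc p) q. \<sigma> 0 = 0}"
  then obtain \<tau> where \<tau>: "\<tau> permutes {..<p + q}" "\<sigma> = perm_lift \<tau>"
    using perm_lift_surj[of \<sigma> "p + q"] by (auto simp: shuffle_perms_def)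
  have "strict_mono_on {..<p} \<tau>"
  proof (rule strict_mono_onI)
    fix i j assume "i \<in> {..<p}" "j \<in> {..<p}" "i < j"
    then have "\<sigma> (Suc i) < \<sigma> (Suc j)"
      using \<sigma> unfolding shuffle_perms_def strict_mono_on_def by auto
    then show "\<tau> i < \<tau> j"
      by (simp add: \<tau>)
  qed
  moreover have "strict_mono_on {p..<p + q} \<tau>"
  proof (rule strict_mono_onI)
    fix i j assume "i \<in> {p..<p + q}" "j \<in> {p..<p + q}" "i < j"
    then have "\<sigma> (Suc i) < \<sigma> (Suc j)"
      using \<sigma> unfolding shuffle_perms_def strict_mono_on_def by auto
    then show "\<tau> i < \<tau> j"
      by (simp add: \<tau>)
  qed
  ultimately show "\<exists>\<tau>\<in>shuffle_perms p q. \<sigma> = perm_lift \<tau>"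
    using \<tau> by (auto simp: shuffle_perms_def)
qed

text \<open>If the first argument heads the right block, undoing \<open>front_cycle p\<close> brings
  it to index 0. What remains is the lift of a shuffle with a right block shorter by one.\<close>

lemma shuffle_first_right:
  "bij_betw (\<lambda>\<tau>. perm_lift \<tau> \<circ> front_cycle p) (shuffle_perms p q)
     {\<sigma> \<in> shuffle_perms p (Suc q). \<sigma> p = 0}"
proof (rule bij_betwI')
  have inv: "front_cycle p \<circ> inv (front_cycle p) = id"
    using permutes_inv_o(1)[OF front_cycle_permutes] .
  fix \<tau> \<tau>' show "perm_lift \<tau> \<circ> front_cycle p = perm_lift \<tau>' \<circ> front_cycle p \<longleftrightarrow> \<tau> = \<tau>'"
    using perm_lift_inject inv by (metis comp_assoc comp_id)
next
  have fc: "front_cycle p permutes {..<Suc (p + q)}"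
    using front_cycle_permutes by (rule permutes_subset) auto
  fix \<tau> assume \<tau>: "\<tau> \<in> shuffle_perms p q"
  have "strict_mono_on {..<p} (perm_lift \<tau> \<circ> front_cycle p)"
    using \<tau> by (auto simp: shuffle_perms_def strict_mono_on_def front_cycle_apply)
  moreover have "strict_mono_on {p..<p + Suc q} (perm_lift \<tau> \<circ> front_cycle p)"
  proof (rule strict_mono_onI)
    fix i j assume "i \<in> {p..<p + Suc q}" "j \<in> {p..<p + Suc q}" "i < j"
    then show "(perm_lift \<tau> \<circ> front_cycle p) i < (perm_lift \<tau> \<circ> front_cycle p) j"
      using \<tau> by (cases i; cases j) (auto simp: shuffle_perms_def strict_mono_on_def front_cycle_apply)
  qed
  moreover have "perm_lift \<tau> \<circ> front_cycle p permutes {..<Suc (p + q)}"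
    using \<tau> fc by (intro permutes_compose perm_lift_permutes) (auto simp: shuffle_perms_def)
  ultimately show "perm_lift \<tau> \<circ> front_cycle p \<in> {\<sigma> \<in> shuffle_perms p (Suc q). \<sigma> p = 0}"
    by (simp add: shuffle_perms_def front_cycle_apply)
next
  have fc: "front_cycle p permutes {..<Suc (p + q)}"
    using front_cycle_permutes by (rule permutes_subset) auto
  fix \<sigma> assume \<sigma>: "\<sigma> \<in> {\<sigma> \<in> shuffle_perms p (Suc q). \<sigma> p = 0}"
  have "\<sigma> \<circ> inv (front_cycle p) permutes {..<Suc (p + q)}"
    using \<sigma> fc by (intro permutes_compose permutes_inv) (auto simp: shuffle_perms_def)
  moreover have "inv (front_cycle p) 0 = p"
    using permutes_inv_eq[OF fc, of 0 p] by (simp add: front_cycle_apply)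
  then have "(\<sigma> \<circ> inv (front_cycle p)) 0 = 0"
    using \<sigma> by simp
  ultimately obtain \<tau> where \<tau>: "\<tau> permutes {..<p + q}" "\<sigma> \<circ> inv (front_cycle p) = perm_lift \<tau>"
    using perm_lift_surj by blast
  have \<sigma>eq: "\<sigma> = perm_lift \<tau> \<circ> front_cycle p"
    using permutes_inv_o(2)[OF fc] by (metis \<tau>(2) comp_assoc comp_id)
  have "strict_mono_on {..<p} \<tau>"
  proof (rule strict_mono_onI)
    fix i j assume ij: "i \<in> {..<p}" "j \<in> {..<p}" "i < j"
    then have "\<sigma> i < \<sigma> j"
      using \<sigma> unfolding shuffle_perms_def strict_mono_on_def by auto
    then show "\<tau> i < \<tau> j"
      using ij by (simp add: \<sigma>eq front_cycle_apply)
  qed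
  moreover have "strict_mono_on {p..<p + q} \<tau>"
  proof (rule strict_mono_onI)
    fix i j assume ij: "i \<in> {p..<p + q}" "j \<in> {p..<p + q}" "i < j"
    then have "\<sigma> (Suc i) < \<sigma> (Suc j)"
      using \<sigma> unfolding shuffle_perms_def strict_mono_on_def by auto
    then show "\<tau> i < \<tau> j"
      using ij by (simp add: \<sigma>eq front_cycle_apply)
  qed
  ultimately show "\<exists>\<tau>\<in>shuffle_perms p q. \<sigma> = perm_lift \<tau> \<circ> front_cycle p"
    using \<tau> \<sigma>eq by (auto simp: shuffle_perms_def)
qed

lemma finite_shuffle_perms [simp]: "finite (shuffle_perms p q)"
  unfolding shuffle_perms_def using finite_permutations[of "{..<p + q}"]
  by (rule rev_finite_subset) auto

text \<open>Monotonicity inside the blocks forces the preimage of 0 to be the first index of a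
  block. The inequality of truth values is an exclusive or; for p = 0 both equations read \<sigma> 0
  = 0, and the guard p > 0 decides for the right block.\<close>

lemma shuffle_perms_first:
  assumes \<sigma>: "\<sigma> \<in> shuffle_perms p q" and pq: "p + q = Suc n"
  shows "(p > 0 \<and> \<sigma> 0 = 0) \<noteq> (q > 0 \<and> \<sigma> p = 0)"
proof -
  have perm: "\<sigma> permutes {..<p + q}"
    using \<sigma> by (simp add: shuffle_perms_def)
  obtain i where i: "\<sigma> i = 0"
    using permutes_surj[OF perm] by (metis surj_def)
  have lt: "i < p + q"
    using i pq permutes_not_in[OF perm, of i] by (cases "i < p + q") auto
  have left: "i = 0" if "i < p"
    using \<sigma> i that unfolding shuffle_perms_def strict_mono_on_def
    by (metis (mono_tags, lifting) gr_zeroI lessThan_iff less_zeroE mem_Collect_eq order.strict_trans)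
  have right: "i = p" if "p \<le> i"
  proof (rule ccontr)
    assume "i \<noteq> p"
    then have "\<sigma> p < \<sigma> i"
      using \<sigma> that lt unfolding shuffle_perms_def strict_mono_on_def by auto
    then show False
      using i by simp
  qed
  have zero: "\<sigma> j = 0 \<longleftrightarrow> j = i" for j
    using i permutes_inj[OF perm] by (metis injD)
  show ?thesis
  proof (cases "i < p")
    case True
    then show ?thesis
      using left zero[of 0] zero[of p] by auto
  next
    case False
    then show ?thesis
      using right lt zero[of 0] zero[of p] by auto
  qed
qed

text \<open>The Koszul sign of an odd operator passing a, in a form that also makes sense for
  inhomogeneous cochains: the degree of a component is the number of its arguments.\<close>

definition grade_involution :: "('m, 'e) cochain \<Rightarrow> ('m, 'e) cochain" where
  "grade_involution a = (\<lambda>Xs. (- 1) ^ length Xs *\<^sub>R a Xs)"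

definition shuffle_term ::
    "('m, 'e) cochain \<Rightarrow> ('m, 'e) cochain \<Rightarrow> ('m \<Rightarrow> 'e) list \<Rightarrow> nat \<Rightarrow> (nat \<Rightarrow> nat) \<Rightarrow> 'm \<Rightarrow> real" where
  "shuffle_term a b Xs p \<sigma> = real_of_int (sign \<sigma>) *\<^sub>R
     (a (map (\<lambda>i. Xs ! \<sigma> i) [0..<p]) * b (map (\<lambda>i. Xs ! \<sigma> i) [p..<length Xs]))"

lemma shuffle_term_left:
  assumes "\<tau> \<in> shuffle_perms p q" "p + q = length Xs"
  shows "shuffle_term a b (X # Xs) (Suc p) (perm_lift \<tau>) = shuffle_term (contraction X a) b Xs p \<tau>"
proof -
  have 1: "map (\<lambda>i. (X # Xs) ! perm_lift \<tau> i) [0..<Suc p] = X # map (\<lambda>i. Xs ! \<tau> i) [0..<p]"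
    by (simp add: upt_conv_Cons map_Suc_upt[symmetric] del: upt_Suc)
  have 2: "map (\<lambda>i. (X # Xs) ! perm_lift \<tau> i) [Suc p..<length (X # Xs)] =
      map (\<lambda>i. Xs ! \<tau> i) [p..<length Xs]"
    by (simp add: map_Suc_upt[symmetric] del: upt_Suc)
  have "sign (perm_lift \<tau>) = sign \<tau>"
    using assms by (intro sign_perm_lift[of _ "p + q"]) (simp add: shuffle_perms_def)
  then show ?thesis
    by (simp only: shuffle_term_def 1 2 contraction_def)
qed

lemma shuffle_term_right:
  assumes "\<tau> \<in> shuffle_perms p q" "p + q = length Xs"
  shows "shuffle_term a b (X # Xs) p (perm_lift \<tau> \<circ> front_cycle p) =
    shuffle_term (grade_involution a) (contraction X b) Xs p \<tau>"
proof -
  have 1: "map (\<lambda>i. (X # Xs) ! (perm_lift \<tau> \<circ> front_cycle p) i) [0..<p] = map (\<lambda>i. Xs ! \<tau> i) [0..<p]"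
    by (auto simp: front_cycle_apply)
  have "[p..<length (X # Xs)] = p # map Suc [p..<length Xs]"
    using assms(2) by (simp add: upt_conv_Cons map_Suc_upt del: upt_Suc)
  then have 2: "map (\<lambda>i. (X # Xs) ! (perm_lift \<tau> \<circ> front_cycle p) i) [p..<length (X # Xs)] =
      X # map (\<lambda>i. Xs ! \<tau> i) [p..<length Xs]"
    by (auto simp: front_cycle_apply)
  have \<tau>: "\<tau> permutes {..<p + q}"
    using assms(1) by (simp add: shuffle_perms_def)
  \<comment> \<open>The sign (-1)^p of the cycle is exactly what \<open>grade_involution a\<close>
    contributes on p arguments.\<close>
  then have 3: "sign (perm_lift \<tau> \<circ> front_cycle p) = sign \<tau> * (- 1) ^ p"
    using perm_lift_permutes[OF \<tau>] front_cycle_permutes[of p]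
    by (subst sign_compose) (auto simp: permutation_permutes sign_perm_lift[OF \<tau>] sign_front_cycle)
  show ?thesis
    unfolding shuffle_term_def 1 2 3 contraction_def grade_involution_def by (simp add: fun_eq_iff)
qed

lemma shuffle_prod_eq_term:
  "(a \<pitchfork> b) Xs = (\<Sum>p\<le>length Xs. \<Sum>\<sigma>\<in>shuffle_perms p (length Xs - p). shuffle_term a b Xs p \<sigma>)"
  by (simp add: shuffle_prod_def shuffle_term_def)

lemma shuffle_prod_Nil: "(a \<pitchfork> b) [] = a [] * b []"
proof -
  have "shuffle_perms 0 0 = {id}"
    by (auto simp: shuffle_perms_def strict_mono_on_def)
  then show ?thesis
    by (simp add: shuffle_prod_def)
qed

lemma contraction_shuffle_prod:
  "contraction X (a \<pitchfork> b) = contraction X a \<pitchfork> b + grade_involution a \<pitchfork> contraction X b"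
proof
  fix Xs :: "('a \<Rightarrow> 'b) list"
  let ?n = "length Xs" and ?T = "shuffle_term a b (X # Xs)"
  let ?L = "\<lambda>p. {\<sigma> \<in> shuffle_perms p (Suc ?n - p). p > 0 \<and> \<sigma> 0 = 0}"
  let ?R = "\<lambda>p. {\<sigma> \<in> shuffle_perms p (Suc ?n - p). Suc ?n - p > 0 \<and> \<sigma> p = 0}"
  have split: "(\<Sum>\<sigma>\<in>shuffle_perms p (Suc ?n - p). ?T p \<sigma>) = sum (?T p) (?L p) + sum (?T p) (?R p)"
    if "p \<le> Suc ?n" for p
  proof -
    have first: "(p > 0 \<and> \<sigma> 0 = 0) \<noteq> (Suc ?n - p > 0 \<and> \<sigma> p = 0)"
      if "\<sigma> \<in> shuffle_perms p (Suc ?n - p)" for \<sigma>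
      using shuffle_perms_first[OF that, of ?n] \<open>p \<le> Suc ?n\<close> by simp
    then have "shuffle_perms p (Suc ?n - p) = ?L p \<union> ?R p" "?L p \<inter> ?R p = {}"
      by blast+
    then show ?thesis
      by (metis (no_types, lifting) finite_Un finite_shuffle_perms sum.union_disjoint)
  qed
  have L: "(\<Sum>p\<le>Suc ?n. sum (?T p) (?L p)) = (contraction X a \<pitchfork> b) Xs"
  proof -
    \<comment> \<open>With p = 0 the left block is empty and contributes nothing, so the sum can be
      shifted down by one.\<close>
    have "(\<Sum>p\<le>Suc ?n. sum (?T p) (?L p)) = (\<Sum>p\<le>?n. sum (?T (Suc p)) (?L (Suc p)))"
      by (subst sum.atMost_Suc_shift) simp
    also have "\<dots> = (\<Sum>p\<le>?n. \<Sum>\<tau>\<in>shuffle_perms p (?n - p). shuffle_term (contraction X a) b Xs p \<tau>)"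
    proof (rule sum.cong[OF refl])
      fix p assume p: "p \<in> {..?n}"
      have "sum (?T (Suc p)) (?L (Suc p)) = (\<Sum>\<tau>\<in>shuffle_perms p (?n - p). ?T (Suc p) (perm_lift \<tau>))"
        using sum.reindex_bij_betw[OF shuffle_first_left, of "?T (Suc p)" p "?n - p"] by simp
      also have "\<dots> = (\<Sum>\<tau>\<in>shuffle_perms p (?n - p). shuffle_term (contraction X a) b Xs p \<tau>)"
        using p by (intro sum.cong refl shuffle_term_left[where q = "?n - p"]) auto
      finally show "sum (?T (Suc p)) (?L (Suc p)) =
          (\<Sum>\<tau>\<in>shuffle_perms p (?n - p). shuffle_term (contraction X a) b Xs p \<tau>)" .
    qed
    finally show ?thesis
      by (simp add: shuffle_prod_eq_term)
  qed
  have R: "(\<Sum>p\<le>Suc ?n. sum (?T p) (?R p)) = (grade_involution a \<pitchfork> contraction X b) Xs"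
  proof -
    \<comment> \<open>With p = n + 1 the right block is empty, so the last summand is 0.\<close>
    have "(\<Sum>p\<le>Suc ?n. sum (?T p) (?R p)) = (\<Sum>p\<le>?n. sum (?T p) (?R p))"
      by simp
    also have "\<dots> = (\<Sum>p\<le>?n. \<Sum>\<tau>\<in>shuffle_perms p (?n - p).
        shuffle_term (grade_involution a) (contraction X b) Xs p \<tau>)"
    proof (rule sum.cong[OF refl])
      fix p assume p: "p \<in> {..?n}"
      then have q: "Suc ?n - p = Suc (?n - p)"
        by auto
      have "sum (?T p) (?R p) = (\<Sum>\<tau>\<in>shuffle_perms p (?n - p). ?T p (perm_lift \<tau> \<circ> front_cycle p))"
        using sum.reindex_bij_betw[OF shuffle_first_right, of "?T p" p "?n - p"] by (simp add: q)
      also have "\<dots> = (\<Sum>\<tau>\<in>shuffle_perms p (?n - p).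
          shuffle_term (grade_involution a) (contraction X b) Xs p \<tau>)"
        using p by (intro sum.cong refl shuffle_term_right[where q = "?n - p"]) auto
      finally show "sum (?T p) (?R p) = (\<Sum>\<tau>\<in>shuffle_perms p (?n - p).
          shuffle_term (grade_involution a) (contraction X b) Xs p \<tau>)" .
    qed
    finally show ?thesis
      by (simp add: shuffle_prod_eq_term)
  qed
  have "contraction X (a \<pitchfork> b) Xs = (\<Sum>p\<le>Suc ?n. \<Sum>\<sigma>\<in>shuffle_perms p (Suc ?n - p). ?T p \<sigma>)"
    by (simp only: contraction_def shuffle_prod_eq_term length_Cons)
  also have "\<dots> = (\<Sum>p\<le>Suc ?n. sum (?T p) (?L p) + sum (?T p) (?R p))"
    by (rule sum.cong[OF refl]) (simp only: split atMost_iff)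
  also have "\<dots> = (contraction X a \<pitchfork> b + grade_involution a \<pitchfork> contraction X b) Xs"
    by (simp only: sum.distrib L R plus_fun_apply)
  finally show "contraction X (a \<pitchfork> b) Xs =
      (contraction X a \<pitchfork> b + grade_involution a \<pitchfork> contraction X b) Xs" .
qed

lemma fscale_apply: "(f \<odot> X) x = f x *\<^sub>R X x"
  by (simp add: fscale_def)

lemma grade_involution_involutive [simp]: "grade_involution (grade_involution a) = a"
  by (simp add: grade_involution_def fun_eq_iff flip: power_add)

lemma contraction_grade_involution:
  "contraction X (grade_involution a) = - grade_involution (contraction X a)"
  by (simp add: contraction_def grade_involution_def fun_eq_iff)

lemma contraction_add: "contraction X (a + b) = contraction X a + contraction X b"
  by (simp add: contraction_def fun_eq_iff)

lemma contraction_diff: "contraction X (a - b) = contraction X a - contraction X b"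
  by (simp add: contraction_def fun_eq_iff)

lemma contraction_scaleR: "contraction X (r *\<^sub>R a) = r *\<^sub>R contraction X a"
  by (simp add: contraction_def fun_eq_iff)

lemma contraction_zero: "contraction X 0 = 0"
  by (simp add: contraction_def fun_eq_iff)

lemma contraction_apply: "contraction X c Xs = c (X # Xs)"
  by (simp add: contraction_def)

lemma shuffle_prod_apply:
  "(a \<pitchfork> b) Xs x = (\<Sum>p\<le>length Xs. \<Sum>\<sigma>\<in>shuffle_perms p (length Xs - p).
     real_of_int (sign \<sigma>) * (a (map (\<lambda>i. Xs ! \<sigma> i) [0..<p]) x * b (map (\<lambda>i. Xs ! \<sigma> i) [p..<length Xs]) x))"
  by (simp add: shuffle_prod_def sum_fun_apply)

lemma shuffle_prod_diff_left: "(a - a') \<pitchfork> b = a \<pitchfork> b - a' \<pitchfork> b"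
  by (rule ext, rule ext) (simp add: shuffle_prod_apply algebra_simps sum_subtractf)

lemma shuffle_prod_diff_right: "a \<pitchfork> (b - b') = a \<pitchfork> b - a \<pitchfork> b'"
  by (rule ext, rule ext) (simp add: shuffle_prod_apply algebra_simps sum_subtractf)

lemma shuffle_prod_uminus_left: "(- a) \<pitchfork> b = - (a \<pitchfork> b)"
  by (rule ext, rule ext) (simp add: shuffle_prod_apply sum_negf)

lemma shuffle_prod_scaleR_left: "(r *\<^sub>R a) \<pitchfork> b = r *\<^sub>R (a \<pitchfork> b)"
  by (rule ext, rule ext) (simp add: shuffle_prod_apply sum_distrib_left mult_ac)

lemma shuffle_prod_zero_left: "0 \<pitchfork> b = 0"
  by (rule ext, rule ext) (simp add: shuffle_prod_apply)

lemma shuffle_prod_zero_right: "a \<pitchfork> 0 = 0"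
  by (rule ext, rule ext) (simp add: shuffle_prod_apply)

section \<open>Loday algebroids\<close>

locale loday =
  fixes M :: "('m, 'b::real_inner) mfd"
    and E :: "('m, 'e::real_vector, 'v::real_inner) vbundle"
    and br :: "('m \<Rightarrow> 'e) \<Rightarrow> ('m \<Rightarrow> 'e) \<Rightarrow> ('m \<Rightarrow> 'e)"
    and \<rho> :: "'m \<Rightarrow> 'e \<Rightarrow> 'm tvec"
    and \<alpha> :: "'m \<Rightarrow> 'e \<Rightarrow> ('m tvec \<Rightarrow> real) \<Rightarrow> 'e \<Rightarrow> 'e"
  assumes algebroid: "loday_algebroid M E br \<rho> \<alpha>"
begin

abbreviation "S \<equiv> Sec M E"
abbreviation "C \<equiv> Cinf M"
abbreviation "act \<equiv> anchor_act M \<rho>"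
abbreviation "d \<equiv> coboundary M E br \<rho>"
abbreviation "L \<equiv> lie_derivative M E br \<rho>"

lemma M: "smooth_manifold M" and E: "vector_bundle M E" and \<rho>: "vb_morphism M E (tangent_bundle M) \<rho>"
  and \<alpha>: "vb_morphism M E (tensor_bundle M E) \<alpha>"
  using algebroid by (simp_all add: loday_algebroid_def)

lemmas S_zero = Sec_zero[OF M E] and S_add = Sec_add[OF M E] and S_scaleR = Sec_scaleR[OF M E]
  and S_fscale = Sec_fscale[OF M E]
lemmas C_zero = Cinf_zero[OF M] and C_add = Cinf_add[OF M] and C_mult = Cinf_mult[OF M]
  and C_scaleR = Cinf_scaleR[OF M]
lemmas act_C = anchor_act_Cinf[OF M E \<rho>] and act_add = anchor_act_add[OF M E \<rho>]
  and act_scaleR = anchor_act_scaleR[OF M E \<rho>] and act_mult = anchor_act_mult[OF M E \<rho>]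
  and act_add_sec = anchor_act_add_sec[OF M E \<rho>] and act_scaleR_sec = anchor_act_scaleR_sec[OF M E \<rho>]
  and act_fscale_sec = anchor_act_fscale_sec[OF M E \<rho>]

lemma C_diff: "f \<in> C \<Longrightarrow> g \<in> C \<Longrightarrow> f - g \<in> C"
  using C_add[of f "(-1) *\<^sub>R g"] C_scaleR[of g "-1"] by simp

lemma C_sum: "(\<And>i. i \<in> I \<Longrightarrow> f i \<in> C) \<Longrightarrow> (\<Sum>i\<in>I. f i) \<in> C"
  by (induction I rule: infinite_finite_induct) (simp_all add: C_zero C_add)

lemma S_diff: "X \<in> S \<Longrightarrow> Y \<in> S \<Longrightarrow> X - Y \<in> S"
  using S_add[of X "(-1) *\<^sub>R Y"] S_scaleR[of Y "-1"] by simp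

lemma act_zero: "X \<in> S \<Longrightarrow> act X 0 = 0"
  using act_scaleR[of X 0 0] C_zero by simp

lemma act_diff: "X \<in> S \<Longrightarrow> f \<in> C \<Longrightarrow> g \<in> C \<Longrightarrow> act X (f - g) = act X f - act X g"
  using act_add[of X f "(-1) *\<^sub>R g"] act_scaleR[of X g "-1"] C_scaleR[of g "-1"] by simp

lemma br_S: "X \<in> S \<Longrightarrow> Y \<in> S \<Longrightarrow> br X Y \<in> S"
  using algebroid unfolding loday_algebroid_def linear_between_def by blast

lemma br_add_right: "X \<in> S \<Longrightarrow> Y \<in> S \<Longrightarrow> Z \<in> S \<Longrightarrow> br X (Y + Z) = br X Y + br X Z"
  using algebroid unfolding loday_algebroid_def linear_between_def by blast

lemma br_add_left: "X \<in> S \<Longrightarrow> Y \<in> S \<Longrightarrow> Z \<in> S \<Longrightarrow> br (X + Y) Z = br X Z + br Y Z"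
  using algebroid unfolding loday_algebroid_def linear_between_def by blast

lemma br_scaleR_right: "X \<in> S \<Longrightarrow> Y \<in> S \<Longrightarrow> br X (r *\<^sub>R Y) = r *\<^sub>R br X Y"
  using algebroid unfolding loday_algebroid_def linear_between_def by blast

lemma br_scaleR_left: "X \<in> S \<Longrightarrow> Y \<in> S \<Longrightarrow> br (r *\<^sub>R X) Y = r *\<^sub>R br X Y"
  using algebroid unfolding loday_algebroid_def linear_between_def by blast

lemma jacobi: "X \<in> S \<Longrightarrow> Y \<in> S \<Longrightarrow> Z \<in> S \<Longrightarrow> br X (br Y Z) = br (br X Y) Z + br Y (br X Z)"
  using algebroid unfolding loday_algebroid_def by blast

lemma leibniz_right:
  "X \<in> S \<Longrightarrow> Y \<in> S \<Longrightarrow> f \<in> C \<Longrightarrow> br X (f \<odot> Y) = f \<odot> br X Y + act X f \<odot> Y"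
  using algebroid unfolding loday_algebroid_def by blast

lemma leibniz_left:
  "X \<in> S \<Longrightarrow> Y \<in> S \<Longrightarrow> f \<in> C \<Longrightarrow>
    br (f \<odot> X) Y = f \<odot> br X Y - act Y f \<odot> X + alpha_act M \<alpha> Y f X"
  using algebroid unfolding loday_algebroid_def by blast

text \<open>The Jacobi identity for \<open>X\<close>, \<open>Y\<close> and \<open>f \<odot> Z\<close> gives the identity wherever \<open>Z\<close> does not
  vanish. Taking \<open>Z\<close> among \<open>X\<close>, \<open>Y\<close>, \<open>br X Y\<close> suffices: where all three vanish, both sides are 0.\<close>

lemma act_br:
  assumes X: "X \<in> S" and Y: "Y \<in> S" and f: "f \<in> C"
  shows "act (br X Y) f = act X (act Y f) - act Y (act X f)"
proof
  fix x
  have key: "(act X (act Y f) x - act Y (act X f) x - act (br X Y) f x) *\<^sub>R Z x = 0" if Z: "Z \<in> S" for Z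
  proof -
    have two: "br U (br V (f \<odot> Z)) = f \<odot> br U (br V Z) + act U f \<odot> br V Z
        + (act V f \<odot> br U Z + act U (act V f) \<odot> Z)" if "U \<in> S" "V \<in> S" for U V
      using that Z f by (simp add: leibniz_right br_add_right br_S S_fscale act_C)
    \<comment> \<open>After expansion, the terms with undifferentiated f cancel by the Jacobi
      identity for Z and those with one derivative of f agree on both sides; only multiples of Z
      remain.\<close>
    have "br X (br Y (f \<odot> Z)) = br (br X Y) (f \<odot> Z) + br Y (br X (f \<odot> Z))"
      using X Y Z f by (intro jacobi S_fscale)
    from fun_cong[OF this[unfolded two[OF X Y] two[OF Y X] leibniz_right[OF br_S[OF X Y] Z f]], of x]
    have "f x *\<^sub>R br X (br Y Z) x + act X f x *\<^sub>R br Y Z x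
          + (act Y f x *\<^sub>R br X Z x + act X (act Y f) x *\<^sub>R Z x) =
        f x *\<^sub>R br (br X Y) Z x + act (br X Y) f x *\<^sub>R Z x
          + (f x *\<^sub>R br Y (br X Z) x + act Y f x *\<^sub>R br X Z x
          + (act X f x *\<^sub>R br Y Z x + act Y (act X f) x *\<^sub>R Z x))"
      by (simp add: fscale_apply)
    moreover have "br X (br Y Z) x = br (br X Y) Z x + br Y (br X Z) x"
      using jacobi[OF X Y Z] by simp
    ultimately show ?thesis
      by (simp add: algebra_simps)
  qed
  show "act (br X Y) f x = (act X (act Y f) - act Y (act X f)) x"
  proof (cases "X x = 0 \<and> Y x = 0 \<and> br X Y x = 0")
    case True
    have "\<rho> x 0 = 0" if x: "x \<in> points M"
      using linear_between_sum[OF anchor_linear[OF M E \<rho> x] fibre_subspace[OF M E x], of "{}"] by simp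
    then show ?thesis
      using True by (simp add: anchor_act_def)
  next
    case False
    then obtain Z where "Z \<in> S" "Z x \<noteq> 0"
      using X Y br_S by blast
    then show ?thesis
      using key[of Z] by simp
  qed
qed

section \<open>Cartan calculus on function-valued cochains\<close>

text \<open>The space on which the inductions run. It is closed under contraction with sections,
  \<open>lie\<close>, d and the shuffle product, and keeps all bookkeeping of orders and degrees out
  of the identities.\<close>

definition cochains :: "('m, 'e) cochain set" where
  "cochains = {c. \<forall>Xs. if set Xs \<subseteq> S then c Xs \<in> C else c Xs = 0}"

lemma cochains_C: "c \<in> cochains \<Longrightarrow> set Xs \<subseteq> S \<Longrightarrow> c Xs \<in> C"
  by (auto simp: cochains_def)

lemma cochains_0: "c \<in> cochains \<Longrightarrow> \<not> set Xs \<subseteq> S \<Longrightarrow> c Xs = 0"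
  by (auto simp: cochains_def)

lemma cochainsI:
  "(\<And>Xs. set Xs \<subseteq> S \<Longrightarrow> c Xs \<in> C) \<Longrightarrow> (\<And>Xs. \<not> set Xs \<subseteq> S \<Longrightarrow> c Xs = 0) \<Longrightarrow> c \<in> cochains"
  by (auto simp: cochains_def)

lemma cochains_C': "c \<in> cochains \<Longrightarrow> c Xs \<in> C"
  using C_zero by (cases "set Xs \<subseteq> S") (auto dest: cochains_C cochains_0)

lemma cochains_zero: "0 \<in> cochains"
  by (rule cochainsI) (simp_all add: C_zero)

lemma cochains_add:
  assumes "a \<in> cochains" "b \<in> cochains"
  shows "a + b \<in> cochains"
  by (rule cochainsI)
    (simp_all add: assms[THEN cochains_C] assms[THEN cochains_0] C_add)

lemma cochains_diff:
  assumes "a \<in> cochains" "b \<in> cochains"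
  shows "a - b \<in> cochains"
  by (rule cochainsI)
    (simp_all add: assms[THEN cochains_C] assms[THEN cochains_0] C_diff)

lemma cochains_scaleR:
  assumes "a \<in> cochains"
  shows "r *\<^sub>R a \<in> cochains"
  by (rule cochainsI) (simp_all add: assms[THEN cochains_C] assms[THEN cochains_0] C_scaleR)

lemma cochains_grade_involution:
  assumes "a \<in> cochains"
  shows "grade_involution a \<in> cochains"
  by (rule cochainsI)
    (simp_all add: grade_involution_def assms[THEN cochains_C] assms[THEN cochains_0] C_scaleR)

lemma cochains_contraction:
  assumes "X \<in> S" "c \<in> cochains"
  shows "contraction X c \<in> cochains"
  unfolding contraction_def using assms(1)
  by (intro cochainsI cochains_C[OF assms(2)] cochains_0[OF assms(2)]) auto

lemma contraction_outside:
  assumes "X \<notin> S" "c \<in> cochains"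
  shows "contraction X c = 0"
proof
  fix Xs show "contraction X c Xs = 0 Xs"
    using assms(1) cochains_0[OF assms(2), of "X # Xs"] by (simp add: contraction_apply fun_eq_iff)
qed

lemma set_omit_subset: "set Xs \<subseteq> S \<Longrightarrow> set (omit i Xs) \<subseteq> S"
  using set_take_subset[of i Xs] set_drop_subset[of "Suc i" Xs] by (auto simp: omit_def)

lemma set_update_subset: "set Xs \<subseteq> S \<Longrightarrow> Y \<in> S \<Longrightarrow> set (Xs[j := Y]) \<subseteq> S"
  using set_update_subset_insert[of Xs j Y] by auto

lemma nth_S: "set Xs \<subseteq> S \<Longrightarrow> j < length Xs \<Longrightarrow> Xs ! j \<in> S"
  using nth_mem by blast

lemma set_br_update_subset:
  "X \<in> S \<Longrightarrow> set Xs \<subseteq> S \<Longrightarrow> j < length Xs \<Longrightarrow> set (Xs[j := br X (Xs ! j)]) \<subseteq> S"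
  by (intro set_update_subset br_S nth_S)

lemma coboundary_outside: "\<not> set Xs \<subseteq> S \<Longrightarrow> d c Xs = 0"
  by (simp add: coboundary_def)

lemma coboundary_Nil: "d c [] = 0"
  by (simp add: coboundary_def)

text \<open>The closed formula for the Lie derivative, kept as a separate constant because the
  recursion for d is phrased with it; \<open>lie_derivative_eq\<close> identifies it with the
  homotopy formula that defines \<open>L\<close>.\<close>

definition lie :: "('m \<Rightarrow> 'e) \<Rightarrow> ('m, 'e) cochain \<Rightarrow> ('m, 'e) cochain" where
  "lie X c = (\<lambda>Xs. if set Xs \<subseteq> S then act X (c Xs) - (\<Sum>j<length Xs. c (Xs[j := br X (Xs ! j)])) else 0)"

lemma lie_outside: "\<not> set Xs \<subseteq> S \<Longrightarrow> lie X c Xs = 0"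
  by (simp add: lie_def)

lemma lie_Nil: "lie X c [] = act X (c [])"
  by (simp add: lie_def)

text \<open>The summands with i = 0 use up X and assemble to \<open>lie X c\<close>. In all others X
  stays in front, since brackets are stored at the later position j > 0, and the shift of i by one
  reverses every sign; together they give minus the coboundary of the contraction.\<close>

lemma coboundary_Cons:
  assumes "X \<in> S" "set Xs \<subseteq> S"
  shows "d c (X # Xs) = lie X c Xs - d (contraction X c) Xs"
proof -
  let ?n = "length Xs"
  have 1: "(\<Sum>i<Suc ?n. ((-1) ^ i :: real) *\<^sub>R act ((X # Xs) ! i) (c (omit i (X # Xs)))) =
      act X (c Xs) - (\<Sum>i<?n. ((-1) ^ i :: real) *\<^sub>R act (Xs ! i) (c (X # omit i Xs)))"
    by (subst sum.lessThan_Suc_shift) (simp add: omit_def sum_negf)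
  have inner: "(\<Sum>i<Suc j. ((-1) ^ Suc i :: real) *\<^sub>R
        c (omit i ((X # Xs)[Suc j := br ((X # Xs) ! i) ((X # Xs) ! Suc j)]))) =
      - c (Xs[j := br X (Xs ! j)]) -
      (\<Sum>i<j. ((-1) ^ Suc i :: real) *\<^sub>R c (X # omit i (Xs[j := br (Xs ! i) (Xs ! j)])))" for j
    by (subst sum.lessThan_Suc_shift) (simp add: omit_def sum_negf)
  have 2: "(\<Sum>j<Suc ?n. \<Sum>i<j. ((-1) ^ Suc i :: real) *\<^sub>R
        c (omit i ((X # Xs)[j := br ((X # Xs) ! i) ((X # Xs) ! j)]))) =
      - (\<Sum>j<?n. c (Xs[j := br X (Xs ! j)])) -
      (\<Sum>j<?n. \<Sum>i<j. ((-1) ^ Suc i :: real) *\<^sub>R c (X # omit i (Xs[j := br (Xs ! i) (Xs ! j)])))"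
    by (subst sum.lessThan_Suc_shift) (simp only: inner sum_subtractf sum_negf lessThan_0 sum.empty add_0_left)
  have "d c (X # Xs) =
      (\<Sum>i<Suc ?n. ((-1) ^ i :: real) *\<^sub>R act ((X # Xs) ! i) (c (omit i (X # Xs)))) +
      (\<Sum>j<Suc ?n. \<Sum>i<j. ((-1) ^ Suc i :: real) *\<^sub>R
        c (omit i ((X # Xs)[j := br ((X # Xs) ! i) ((X # Xs) ! j)])))"
    unfolding coboundary_def using assms by (simp only: length_Cons list.simps insert_subset if_True simp_thms)
  also have "\<dots> = lie X c Xs - d (contraction X c) Xs"
    unfolding 1 2 lie_def coboundary_def contraction_apply using assms(2) by (simp add: algebra_simps del: power_Suc)
  finally show ?thesis .
qed

lemma lie_derivative_eq: "X \<in> S \<Longrightarrow> L X c = lie X c"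
proof
  fix Xs assume X: "X \<in> S"
  show "L X c Xs = lie X c Xs"
    using X coboundary_Cons[OF X, of Xs c] coboundary_outside[of Xs] coboundary_outside[of "X # Xs"]
      lie_outside[of Xs X c]
    by (cases "set Xs \<subseteq> S") (simp_all add: lie_derivative_def contraction_apply fun_eq_iff)
qed

lemma cochains_lie:
  assumes "X \<in> S" "c \<in> cochains"
  shows "lie X c \<in> cochains"
proof (rule cochainsI)
  fix Xs assume "set Xs \<subseteq> S"
  then have "lie X c Xs = act X (c Xs) - (\<Sum>j<length Xs. c (Xs[j := br X (Xs ! j)]))"
    by (simp add: lie_def)
  also have "\<dots> \<in> C"
    by (intro C_diff C_sum act_C cochains_C' assms)
  finally show "lie X c Xs \<in> C" .
qed (rule lie_outside)

lemma cochains_coboundary: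
  assumes "c \<in> cochains"
  shows "d c \<in> cochains"
proof (rule cochainsI)
  fix Xs assume Xs: "set Xs \<subseteq> S"
  show "d c Xs \<in> C"
    unfolding coboundary_def if_P[OF Xs]
    by (intro C_add C_sum C_scaleR act_C cochains_C' assms nth_S Xs) simp
qed (rule coboundary_outside)

lemma contraction_coboundary:
  assumes "X \<in> S"
  shows "contraction X (d c) = lie X c - d (contraction X c)"
proof
  fix Xs show "contraction X (d c) Xs = (lie X c - d (contraction X c)) Xs"
    using coboundary_Cons[OF assms, of Xs c] coboundary_outside[of Xs] coboundary_outside[of "X # Xs"]
      lie_outside[of Xs X c]
    by (cases "set Xs \<subseteq> S") (simp_all add: contraction_apply fun_eq_iff)
qed

text \<open>The slot occupied by Y contributes the term with br X Y; the remaining slots form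
  \<open>lie X\<close> of the contraction.\<close>

lemma contraction_lie:
  assumes X: "X \<in> S" and Y: "Y \<in> S" and c: "c \<in> cochains"
  shows "contraction Y (lie X c) = lie X (contraction Y c) - contraction (br X Y) c"
proof
  fix Ys
  show "contraction Y (lie X c) Ys = (lie X (contraction Y c) - contraction (br X Y) c) Ys"
  proof (cases "set Ys \<subseteq> S")
    case True
    have "(\<Sum>j<length (Y # Ys). c ((Y # Ys)[j := br X ((Y # Ys) ! j)])) =
        c (br X Y # Ys) + (\<Sum>j<length Ys. c (Y # Ys[j := br X (Ys ! j)]))"
      unfolding length_Cons by (subst sum.lessThan_Suc_shift) simp
    then show ?thesis
      using True Y by (simp add: contraction_apply lie_def fun_eq_iff algebra_simps del: length_Cons)
  next
    case False
    then show ?thesis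
      using lie_outside[of "Y # Ys" X c] lie_outside[of Ys] cochains_0[OF c, of "br X Y # Ys"]
      by (simp add: contraction_apply fun_eq_iff)
  qed
qed

lemma lie_diff:
  assumes "X \<in> S" "a \<in> cochains" "b \<in> cochains"
  shows "lie X (a - b) = lie X a - lie X b"
proof
  fix Xs show "lie X (a - b) Xs = (lie X a - lie X b) Xs"
    using assms(1) by (simp add: lie_def act_diff assms(2,3)[THEN cochains_C'] sum_subtractf)
qed

lemma coboundary_add:
  assumes "a \<in> cochains" "b \<in> cochains"
  shows "d (a + b) = d a + d b"
proof
  fix Xs show "d (a + b) Xs = (d a + d b) Xs"
    by (simp add: coboundary_def act_add assms[THEN cochains_C'] nth_S sum.distrib scaleR_add_right add_ac del: power_Suc cong: sum.cong_simp)
qed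

lemma coboundary_scaleR:
  assumes "a \<in> cochains"
  shows "d (r *\<^sub>R a) = r *\<^sub>R d a"
proof
  fix Xs show "d (r *\<^sub>R a) Xs = (r *\<^sub>R d a) Xs"
    by (simp add: coboundary_def act_scaleR assms[THEN cochains_C'] nth_S scaleR_sum_right scaleR_add_right mult.commute cong: sum.cong_simp)
qed

lemma coboundary_diff:
  assumes "a \<in> cochains" "b \<in> cochains"
  shows "d (a - b) = d a - d b"
  using coboundary_add[OF assms(1) cochains_scaleR[OF assms(2), of "-1"]] coboundary_scaleR[OF assms(2), of "-1"]
  by simp

lemma coboundary_zero: "d 0 = 0"
  using coboundary_scaleR[OF cochains_zero, of 0] by simp


section \<open>Product rules for the Lie derivative and the coboundary\<close>

lemma cochains_eqI:
  assumes "a \<in> cochains" "b \<in> cochains" "\<And>Xs. set Xs \<subseteq> S \<Longrightarrow> a Xs = b Xs"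
  shows "a = b"
  using assms by (metis cochains_0 ext)

text \<open>Induction through the product rule for contractions. Both clauses of membership are
  carried together, because a head outside \<open>S\<close> has to be treated too: there both
  contractions vanish.\<close>

lemma cochains_shuffle_prod:
  assumes "a \<in> cochains" "b \<in> cochains"
  shows "a \<pitchfork> b \<in> cochains"
proof -
  have "if set Xs \<subseteq> S then (a \<pitchfork> b) Xs \<in> C else (a \<pitchfork> b) Xs = 0" for Xs
    using assms
  proof (induction Xs arbitrary: a b)
    case Nil
    then show ?case
      using C_mult[OF cochains_C'[OF Nil(1), of "[]"] cochains_C'[OF Nil(2), of "[]"]]
      by (simp add: shuffle_prod_Nil)
  next
    case (Cons X Xs)
    have eq: "(a \<pitchfork> b) (X # Xs) =
        (contraction X a \<pitchfork> b) Xs + (grade_involution a \<pitchfork> contraction X b) Xs"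
      using fun_cong[OF contraction_shuffle_prod[of X a b], of Xs]
      by (simp only: contraction_apply plus_fun_apply)
    show ?case
    proof (cases "X \<in> S")
      case True
      note 1 = Cons.IH[OF cochains_contraction[OF True Cons.prems(1)] Cons.prems(2)]
      note 2 = Cons.IH[OF cochains_grade_involution[OF Cons.prems(1)] cochains_contraction[OF True Cons.prems(2)]]
      show ?thesis
      proof (cases "set Xs \<subseteq> S")
        case Xs: True
        then show ?thesis
          unfolding eq using True C_add[OF 1[unfolded if_P[OF Xs]] 2[unfolded if_P[OF Xs]]]
          by (simp only: list.simps insert_subset simp_thms if_True)
      next
        case Xs: False
        then show ?thesis
          unfolding eq 1[unfolded if_not_P[OF Xs]] 2[unfolded if_not_P[OF Xs]] by simp
      qed
    next
      case False
      then show ?thesis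
        unfolding eq contraction_outside[OF False Cons.prems(1)] contraction_outside[OF False Cons.prems(2)]
          shuffle_prod_zero_left shuffle_prod_zero_right
        by simp
    qed
  qed
  then show ?thesis
    by (simp add: cochains_def)
qed

lemma lie_grade_involution:
  assumes "X \<in> S" "a \<in> cochains"
  shows "lie X (grade_involution a) = grade_involution (lie X a)"
proof
  fix Xs show "lie X (grade_involution a) Xs = grade_involution (lie X a) Xs"
    using act_scaleR[OF assms(1) cochains_C'[OF assms(2), of Xs]]
    by (simp add: lie_def grade_involution_def scaleR_diff_right scaleR_sum_right)
qed

text \<open>d changes the parity of the degree, hence the minus sign. In the induction it reappears
  from contraction, which changes parity as well.\<close>

lemma coboundary_grade_involution:
  assumes "a \<in> cochains"
  shows "d (grade_involution a) = - grade_involution (d a)"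
proof
  fix Xs show "d (grade_involution a) Xs = (- grade_involution (d a)) Xs"
    using assms
  proof (induction Xs arbitrary: a)
    case Nil
    then show ?case by (simp add: coboundary_Nil grade_involution_def)
  next
    case (Cons X Xs)
    show ?case
    proof (cases "X \<in> S")
      case True
      have i: "contraction X a \<in> cochains"
        by (rule cochains_contraction[OF True Cons.prems])
      have "d (grade_involution a) (X # Xs) = contraction X (d (grade_involution a)) Xs"
        by (simp only: contraction_apply)
      also have "\<dots> = (grade_involution (lie X a) - d ((-1) *\<^sub>R grade_involution (contraction X a))) Xs"
        by (simp add: contraction_coboundary[OF True] contraction_grade_involution
            lie_grade_involution[OF True Cons.prems])
      also have "\<dots> = (grade_involution (lie X a) + d (grade_involution (contraction X a))) Xs"
        unfolding coboundary_scaleR[OF cochains_grade_involution[OF i]] by simp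
      also have "\<dots> = grade_involution (lie X a) Xs - grade_involution (d (contraction X a)) Xs"
        using Cons.IH[OF i] by (simp add: fun_eq_iff)
      also have "\<dots> = grade_involution (contraction X (d a)) Xs"
        by (simp add: contraction_coboundary[OF True] grade_involution_def scaleR_diff_right)
      also have "\<dots> = (- grade_involution (d a)) (X # Xs)"
        by (simp add: contraction_def grade_involution_def)
      finally show ?thesis .
    next
      case False
      then show ?thesis
        using coboundary_outside[of "X # Xs"] by (simp add: grade_involution_def)
    qed
  qed
qed

lemma lie_add:
  assumes "X \<in> S" "a \<in> cochains" "b \<in> cochains"
  shows "lie X (a + b) = lie X a + lie X b"
proof
  fix Xs show "lie X (a + b) Xs = (lie X a + lie X b) Xs"
    using assms(1) by (simp add: lie_def act_add assms(2,3)[THEN cochains_C'] sum.distrib)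
qed

text \<open>Contraction with Y turns the claim into the same claim for the pairs i_Y a, b and a',
  i_Y b, on a shorter list, where a' is \<open>grade_involution a\<close>. The terms with br X Y on
  the two sides agree by the product rule for contractions. The induction starts from the derivation
  property of the anchor.\<close>

lemma lie_shuffle_prod:
  assumes X: "X \<in> S" and "a \<in> cochains" "b \<in> cochains"
  shows "lie X (a \<pitchfork> b) = lie X a \<pitchfork> b + a \<pitchfork> lie X b"
proof (rule cochains_eqI)
  show "lie X (a \<pitchfork> b) \<in> cochains" "lie X a \<pitchfork> b + a \<pitchfork> lie X b \<in> cochains"
    by (intro cochains_add cochains_lie cochains_shuffle_prod assms)+
  fix Ys assume "set Ys \<subseteq> S"
  then show "lie X (a \<pitchfork> b) Ys = (lie X a \<pitchfork> b + a \<pitchfork> lie X b) Ys"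
    using assms(2,3)
  proof (induction Ys arbitrary: a b)
    case Nil
    then show ?case
      using act_mult[OF X cochains_C'[OF Nil(2), of "[]"] cochains_C'[OF Nil(3), of "[]"]]
      by (simp add: lie_Nil shuffle_prod_Nil add.commute)
  next
    case (Cons Y Ys)
    have Y: "Y \<in> S" and Ys: "set Ys \<subseteq> S"
      using Cons.prems by auto
    note a = Cons.prems(2) and b = Cons.prems(3)
    let ?t = grade_involution and ?i = "contraction Y" and ?j = "contraction (br X Y)"
    have ia: "?i a \<in> cochains" and ib: "?i b \<in> cochains" and ta: "?t a \<in> cochains"
      using Y a b by (auto intro: cochains_contraction cochains_grade_involution)
    have "?i (lie X (a \<pitchfork> b)) = lie X (?i a \<pitchfork> b) + lie X (?t a \<pitchfork> ?i b) - (?j a \<pitchfork> b + ?t a \<pitchfork> ?j b)"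
      using X Y a b ia ib ta
      by (simp only: contraction_lie cochains_shuffle_prod contraction_shuffle_prod lie_add)
    moreover have "?i (lie X a \<pitchfork> b + a \<pitchfork> lie X b) =
        (lie X (?i a) \<pitchfork> b + ?i a \<pitchfork> lie X b) + (lie X (?t a) \<pitchfork> ?i b + ?t a \<pitchfork> lie X (?i b))
        - (?j a \<pitchfork> b + ?t a \<pitchfork> ?j b)"
      by (simp only: contraction_add contraction_shuffle_prod contraction_lie[OF X Y a]
          contraction_lie[OF X Y b] lie_grade_involution[OF X a] shuffle_prod_diff_left
          shuffle_prod_diff_right) simp
    moreover have "lie X (?i a \<pitchfork> b) Ys = (lie X (?i a) \<pitchfork> b + ?i a \<pitchfork> lie X b) Ys"
      by (rule Cons.IH[OF Ys ia b])
    moreover have "lie X (?t a \<pitchfork> ?i b) Ys = (lie X (?t a) \<pitchfork> ?i b + ?t a \<pitchfork> lie X (?i b)) Ys"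
      by (rule Cons.IH[OF Ys ta ib])
    ultimately have "?i (lie X (a \<pitchfork> b)) Ys = ?i (lie X a \<pitchfork> b + a \<pitchfork> lie X b) Ys"
      by (simp only: plus_fun_apply minus_apply)
    then show ?case
      by (simp only: contraction_apply)
  qed
qed

text \<open>After contraction with X the Lie terms match by \<open>lie_shuffle_prod\<close>, and
  what is left is the claim for i_X a, b and for a', i_X b, with a' the grade involution of a. The
  signs fit because both i_X and d anticommute with the grade involution.\<close>

lemma coboundary_shuffle_prod:
  assumes "a \<in> cochains" "b \<in> cochains"
  shows "d (a \<pitchfork> b) = d a \<pitchfork> b + grade_involution a \<pitchfork> d b"
proof (rule cochains_eqI)
  show "d (a \<pitchfork> b) \<in> cochains" "d a \<pitchfork> b + grade_involution a \<pitchfork> d b \<in> cochains"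
    by (intro cochains_add cochains_coboundary cochains_shuffle_prod cochains_grade_involution assms)+
  fix Xs assume "set Xs \<subseteq> S"
  then show "d (a \<pitchfork> b) Xs = (d a \<pitchfork> b + grade_involution a \<pitchfork> d b) Xs"
    using assms
  proof (induction Xs arbitrary: a b)
    case Nil
    then show ?case
      by (simp add: coboundary_Nil shuffle_prod_Nil)
  next
    case (Cons X Xs)
    have X: "X \<in> S" and Xs: "set Xs \<subseteq> S"
      using Cons.prems by auto
    note a = Cons.prems(2) and b = Cons.prems(3)
    let ?t = grade_involution and ?i = "contraction X"
    have ia: "?i a \<in> cochains" and ib: "?i b \<in> cochains" and ta: "?t a \<in> cochains"
      using X a b by (auto intro: cochains_contraction cochains_grade_involution)
    have "?i (d (a \<pitchfork> b)) = lie X a \<pitchfork> b + a \<pitchfork> lie X b - (d (?i a \<pitchfork> b) + d (?t a \<pitchfork> ?i b))"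
      by (simp only: contraction_coboundary[OF X] lie_shuffle_prod[OF X a b] contraction_shuffle_prod
          coboundary_add[OF cochains_shuffle_prod[OF ia b] cochains_shuffle_prod[OF ta ib]])
    moreover have "?i (d a \<pitchfork> b + ?t a \<pitchfork> d b) = lie X a \<pitchfork> b + a \<pitchfork> lie X b
        - ((d (?i a) \<pitchfork> b + ?t (?i a) \<pitchfork> d b) + (d (?t a) \<pitchfork> ?i b + ?t (?t a) \<pitchfork> d (?i b)))"
      unfolding contraction_add contraction_shuffle_prod contraction_coboundary[OF X]
        contraction_grade_involution coboundary_grade_involution[OF a] shuffle_prod_diff_left
        shuffle_prod_diff_right shuffle_prod_uminus_left grade_involution_involutive
      by simp
    moreover have "d (?i a \<pitchfork> b) Xs = (d (?i a) \<pitchfork> b + ?t (?i a) \<pitchfork> d b) Xs"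
      by (rule Cons.IH[OF Xs ia b])
    moreover have "d (?t a \<pitchfork> ?i b) Xs = (d (?t a) \<pitchfork> ?i b + ?t (?t a) \<pitchfork> d (?i b)) Xs"
      by (rule Cons.IH[OF Xs ta ib])
    ultimately have "?i (d (a \<pitchfork> b)) Xs = ?i (d a \<pitchfork> b + ?t a \<pitchfork> d b) Xs"
      by (simp only: plus_fun_apply minus_apply)
    then show ?case
      by (simp only: contraction_apply)
  qed
qed

section \<open>Commutators of Lie derivatives and the square of the coboundary\<close>

definition additive_cochains :: "('m, 'e) cochain set" where
  "additive_cochains = {c \<in> cochains. \<forall>Xs i. set Xs \<subseteq> S \<and> i < length Xs \<longrightarrow>
     (\<forall>U\<in>S. \<forall>V\<in>S. c (Xs[i := U + V]) = c (Xs[i := U]) + c (Xs[i := V]))}"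

lemma additive_cochains_cochains: "c \<in> additive_cochains \<Longrightarrow> c \<in> cochains"
  by (simp add: additive_cochains_def)

lemma additive_cochains_contraction:
  assumes X: "X \<in> S" and c: "c \<in> additive_cochains"
  shows "contraction X c \<in> additive_cochains"
proof -
  have "c (X # Xs[i := U + V]) = c (X # Xs[i := U]) + c (X # Xs[i := V])"
    if "set Xs \<subseteq> S" "i < length Xs" "U \<in> S" "V \<in> S" for Xs i U V
  proof -
    have "set (X # Xs) \<subseteq> S" "Suc i < length (X # Xs)"
      using that X by auto
    then have "c ((X # Xs)[Suc i := U + V]) = c ((X # Xs)[Suc i := U]) + c ((X # Xs)[Suc i := V])"
      using c that unfolding additive_cochains_def by blast
    then show ?thesis by simp
  qed
  then show ?thesis
    using cochains_contraction[OF X additive_cochains_cochains[OF c]]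
    by (simp only: additive_cochains_def contraction_apply mem_Collect_eq) blast
qed

text \<open>Splits the contraction with the sum on the right of the Jacobi identity.
  \<open>additive_cochains\<close> asks for additivity in all slots, since repeated contraction
  brings each of them to the front.\<close>

lemma contraction_add_sec:
  assumes c: "c \<in> additive_cochains" and U: "U \<in> S" and V: "V \<in> S"
  shows "contraction (U + V) c = contraction U c + contraction V c"
proof (rule cochains_eqI)
  show "contraction (U + V) c \<in> cochains" "contraction U c + contraction V c \<in> cochains"
    by (intro cochains_add cochains_contraction S_add U V additive_cochains_cochains[OF c])+
  fix Xs assume "set Xs \<subseteq> S"
  then have "set (U # Xs) \<subseteq> S" "0 < length (U # Xs)"
    using U by auto
  then have "c ((U # Xs)[0 := U + V]) = c ((U # Xs)[0 := U]) + c ((U # Xs)[0 := V])"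
    using c U V unfolding additive_cochains_def by blast
  then show "contraction (U + V) c Xs = (contraction U c + contraction V c) Xs"
    by (simp add: contraction_def)
qed

text \<open>On the empty list this is \<open>act_br\<close>. Contraction with Z yields mixed terms
  such as L_X i_[Y,Z] + L_Y i_[X,Z], symmetric in X and Y and hence cancelling, and double brackets
  that the Jacobi identity collapses to i_[[X,Y],Z].\<close>

lemma lie_commutator:
  assumes X: "X \<in> S" and Y: "Y \<in> S" and "c \<in> additive_cochains"
  shows "lie X (lie Y c) - lie Y (lie X c) = lie (br X Y) c"
proof (rule cochains_eqI)
  show "lie X (lie Y c) - lie Y (lie X c) \<in> cochains" "lie (br X Y) c \<in> cochains"
    by (intro cochains_diff cochains_lie br_S X Y additive_cochains_cochains[OF assms(3)])+
  fix Zs assume "set Zs \<subseteq> S"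
  then show "(lie X (lie Y c) - lie Y (lie X c)) Zs = lie (br X Y) c Zs"
    using assms(3)
  proof (induction Zs arbitrary: c)
    case Nil
    then show ?case
      using act_br[OF X Y cochains_C'[OF additive_cochains_cochains[OF Nil(2)], of "[]"]]
      by (simp add: lie_Nil)
  next
    case (Cons Z Zs)
    have Z: "Z \<in> S" and Zs: "set Zs \<subseteq> S"
      using Cons.prems by auto
    note c = additive_cochains_cochains[OF Cons.prems(2)]
    let ?i = contraction
    have two: "?i Z (lie U (lie V c)) =
        lie U (lie V (?i Z c)) - lie U (?i (br V Z) c) - (lie V (?i (br U Z) c) - ?i (br V (br U Z)) c)"
      if U: "U \<in> S" and V: "V \<in> S" for U V
      by (simp only: contraction_lie[OF U Z cochains_lie[OF V c]] contraction_lie[OF V Z c]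
          contraction_lie[OF V br_S[OF U Z] c]
          lie_diff[OF U cochains_lie[OF V cochains_contraction[OF Z c]] cochains_contraction[OF br_S[OF V Z] c]])
    have "?i (br X (br Y Z)) c = ?i (br (br X Y) Z) c + ?i (br Y (br X Z)) c"
      unfolding jacobi[OF X Y Z] using X Y Z by (intro contraction_add_sec[OF Cons.prems(2)] br_S)
    then have "?i Z (lie X (lie Y c) - lie Y (lie X c)) =
        lie X (lie Y (?i Z c)) - lie Y (lie X (?i Z c)) - ?i (br (br X Y) Z) c"
      unfolding contraction_diff two[OF X Y] two[OF Y X] by simp
    moreover have "?i Z (lie (br X Y) c) = lie (br X Y) (?i Z c) - ?i (br (br X Y) Z) c"
      by (rule contraction_lie[OF br_S[OF X Y] Z c])
    moreover note Cons.IH[OF Zs additive_cochains_contraction[OF Z Cons.prems(2)]]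
    ultimately have "?i Z (lie X (lie Y c) - lie Y (lie X c)) Zs = ?i Z (lie (br X Y) c) Zs"
      by (simp add: fun_eq_iff)
    then show ?case
      by (simp only: contraction_apply)
  qed
qed

text \<open>After contraction with Y both sides contain d i_[X,Y] c. The rest is the commutator of
  L_X and L_Y, matched by L_[X,Y] c, and the claim for i_Y c.\<close>

lemma coboundary_lie:
  assumes X: "X \<in> S" and "c \<in> additive_cochains"
  shows "d (lie X c) = lie X (d c)"
proof (rule cochains_eqI)
  show "d (lie X c) \<in> cochains" "lie X (d c) \<in> cochains"
    by (intro cochains_coboundary cochains_lie X additive_cochains_cochains[OF assms(2)])+
  fix Ys assume "set Ys \<subseteq> S"
  then show "d (lie X c) Ys = lie X (d c) Ys"
    using assms(2)
  proof (induction Ys arbitrary: c)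
    case Nil
    then show ?case
      by (simp add: coboundary_Nil lie_Nil act_zero[OF X])
  next
    case (Cons Y Ys)
    have Y: "Y \<in> S" and Ys: "set Ys \<subseteq> S"
      using Cons.prems by auto
    note c = additive_cochains_cochains[OF Cons.prems(2)]
    note ic = cochains_contraction[OF Y c]
    let ?i = contraction
    have "?i Y (d (lie X c)) = lie Y (lie X c) - d (lie X (?i Y c)) + d (?i (br X Y) c)"
      by (simp only: contraction_coboundary[OF Y] contraction_lie[OF X Y c]
          coboundary_diff[OF cochains_lie[OF X ic] cochains_contraction[OF br_S[OF X Y] c]]) simp
    moreover have "?i Y (lie X (d c)) = lie X (lie Y c) - lie X (d (?i Y c)) - lie (br X Y) c + d (?i (br X Y) c)"
      by (simp only: contraction_lie[OF X Y cochains_coboundary[OF c]] contraction_coboundary[OF Y]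
          contraction_coboundary[OF br_S[OF X Y]]
          lie_diff[OF X cochains_lie[OF Y c] cochains_coboundary[OF ic]]) simp
    moreover have "lie X (lie Y c) = lie Y (lie X c) + lie (br X Y) c"
      using lie_commutator[OF X Y Cons.prems(2)] by (simp only: diff_eq_eq add.commute)
    moreover note Cons.IH[OF Ys additive_cochains_contraction[OF Y Cons.prems(2)]]
    ultimately have "?i Y (d (lie X c)) Ys = ?i Y (lie X (d c)) Ys"
      by (simp add: plus_fun_apply)
    then show ?case
      by (simp only: contraction_apply)
  qed
qed

lemma coboundary_coboundary:
  assumes "c \<in> additive_cochains"
  shows "d (d c) = 0"
proof (rule cochains_eqI)
  show "d (d c) \<in> cochains"
    by (intro cochains_coboundary additive_cochains_cochains assms)
  fix Xs assume "set Xs \<subseteq> S"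
  then show "d (d c) Xs = 0 Xs"
    using assms
  proof (induction Xs arbitrary: c)
    case Nil
    then show ?case
      by (simp add: coboundary_Nil)
  next
    case (Cons X Xs)
    have X: "X \<in> S" and Xs: "set Xs \<subseteq> S"
      using Cons.prems by auto
    note c = additive_cochains_cochains[OF Cons.prems(2)]
    have "contraction X (d (d c)) = d (d (contraction X c))"
      by (simp only: contraction_coboundary[OF X] coboundary_lie[OF X Cons.prems(2)]
          coboundary_diff[OF cochains_lie[OF X c] cochains_coboundary[OF cochains_contraction[OF X c]]]) simp
    from fun_cong[OF this, of Xs] Cons.IH[OF Xs additive_cochains_contraction[OF X Cons.prems(2)]]
    show ?case
      by (simp only: contraction_apply zero_fun_apply)
  qed
qed (rule cochains_zero)


section \<open>Orders of differential operators\<close>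

lemma diffop_le_SucI:
  "(\<And>f. f \<in> C \<Longrightarrow> diffop_le M E k (\<lambda>X. D (f \<odot> X) - f \<odot> D X)) \<Longrightarrow> diffop_le M E (Suc k) D"
  unfolding diffop_le.simps by blast

lemma diffop_le_SucD:
  "diffop_le M E (Suc k) D \<Longrightarrow> f \<in> C \<Longrightarrow> diffop_le M E k (\<lambda>X. D (f \<odot> X) - f \<odot> D X)"
  unfolding diffop_le.simps by blast

lemma diffop_le_cong:
  "(\<And>X. X \<in> S \<Longrightarrow> D X = D' X) \<Longrightarrow> diffop_le M E k D \<Longrightarrow> diffop_le M E k D'"
proof (induction k arbitrary: D D')
  case 0
  then show ?case
    by (simp add: S_fscale)
next
  case (Suc k)
  have "diffop_le M E k (\<lambda>X. D' (f \<odot> X) - f \<odot> D' X)" if f: "f \<in> C" for f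
  proof (rule Suc.IH)
    show "D (f \<odot> X) - f \<odot> D X = D' (f \<odot> X) - f \<odot> D' X" if "X \<in> S" for X
      by (simp only: Suc.prems(1) S_fscale f that)
    show "diffop_le M E k (\<lambda>X. D (f \<odot> X) - f \<odot> D X)"
      by (rule diffop_le_SucD[OF Suc.prems(2) f])
  qed
  then show ?case by (rule diffop_le_SucI)
qed

lemma diffop_le_zero: "diffop_le M E k (\<lambda>X. 0)"
proof (induction k)
  case (Suc k)
  have "f \<odot> (0 :: 'm \<Rightarrow> real) = 0" for f
    by (simp add: fscale_def fun_eq_iff)
  then show ?case
    using Suc by (auto simp only: diffop_le.simps diff_self)
qed (simp add: fscale_def fun_eq_iff)

lemma diffop_le_lift: "diffop_le M E k D \<Longrightarrow> diffop_le M E (Suc k) D"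
proof (induction k arbitrary: D)
  case 0
  have "diffop_le M E 0 (\<lambda>X. D (f \<odot> X) - f \<odot> D X)" if f: "f \<in> C" for f
    by (rule diffop_le_cong[OF _ diffop_le_zero]) (use 0 f in simp)
  then show ?case by (rule diffop_le_SucI)
next
  case (Suc k)
  have "diffop_le M E (Suc k) (\<lambda>X. D (f \<odot> X) - f \<odot> D X)" if f: "f \<in> C" for f
    by (rule Suc.IH[OF diffop_le_SucD[OF Suc.prems f]])
  then show ?case by (rule diffop_le_SucI)
qed

lemma diffop_le_mono: "diffop_le M E k D \<Longrightarrow> k \<le> l \<Longrightarrow> diffop_le M E l D"
  by (induction l) (auto simp: le_Suc_eq intro: diffop_le_lift simp del: diffop_le.simps)

lemma diffop_le_add:
  "diffop_le M E k D \<Longrightarrow> diffop_le M E k D' \<Longrightarrow> diffop_le M E k (\<lambda>X. D X + D' X)"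
proof (induction k arbitrary: D D')
  case 0
  then show ?case
    by (simp add: fscale_def fun_eq_iff algebra_simps)
next
  case (Suc k)
  have "diffop_le M E k (\<lambda>X. D (f \<odot> X) + D' (f \<odot> X) - f \<odot> (D X + D' X))" if f: "f \<in> C" for f
  proof -
    have "(D (f \<odot> X) - f \<odot> D X) + (D' (f \<odot> X) - f \<odot> D' X) =
        D (f \<odot> X) + D' (f \<odot> X) - f \<odot> (D X + D' X)" for X
      by (simp add: fscale_def fun_eq_iff algebra_simps)
    from diffop_le_cong[OF this Suc.IH[OF Suc.prems[THEN diffop_le_SucD, OF f]]] show ?thesis .
  qed
  then show ?case by (rule diffop_le_SucI)
qed

lemma diffop_le_scaleR: "diffop_le M E k D \<Longrightarrow> diffop_le M E k (\<lambda>X. r *\<^sub>R D X)"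
proof (induction k arbitrary: D)
  case 0
  then show ?case
    by (simp add: fscale_def fun_eq_iff algebra_simps)
next
  case (Suc k)
  have "diffop_le M E k (\<lambda>X. r *\<^sub>R D (f \<odot> X) - f \<odot> (r *\<^sub>R D X))" if f: "f \<in> C" for f
  proof -
    have "r *\<^sub>R (D (f \<odot> X) - f \<odot> D X) = r *\<^sub>R D (f \<odot> X) - f \<odot> (r *\<^sub>R D X)" for X
      by (simp add: fscale_def fun_eq_iff algebra_simps)
    from diffop_le_cong[OF this Suc.IH[OF Suc.prems[THEN diffop_le_SucD, OF f]]] show ?thesis .
  qed
  then show ?case by (rule diffop_le_SucI)
qed

lemma diffop_le_fscale:
  assumes g: "g \<in> C"
  shows "diffop_le M E k D \<Longrightarrow> diffop_le M E k (\<lambda>X. g \<odot> D X)"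
proof (induction k arbitrary: D)
  case 0
  then show ?case
    by (simp add: fscale_def fun_eq_iff algebra_simps)
next
  case (Suc k)
  have "diffop_le M E k (\<lambda>X. g \<odot> D (f \<odot> X) - f \<odot> (g \<odot> D X))" if f: "f \<in> C" for f
  proof -
    have "g \<odot> (D (f \<odot> X) - f \<odot> D X) = g \<odot> D (f \<odot> X) - f \<odot> (g \<odot> D X)" for X
      by (simp add: fscale_def fun_eq_iff algebra_simps)
    from diffop_le_cong[OF this Suc.IH[OF Suc.prems[THEN diffop_le_SucD, OF f]]] show ?thesis .
  qed
  then show ?case by (rule diffop_le_SucI)
qed

text \<open>The derivation rule gives [act Y o D, f] = act Y o [D, f] + (act Y f) D, where [D, f]
  has one order less than D; hence the bound grows by exactly one.\<close>

lemma diffop_le_act: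
  assumes Y: "Y \<in> S"
  shows "(\<And>X. X \<in> S \<Longrightarrow> D X \<in> C) \<Longrightarrow> diffop_le M E k D \<Longrightarrow> diffop_le M E (Suc k) (\<lambda>X. act Y (D X))"
proof (induction k arbitrary: D)
  case 0
  have "diffop_le M E 0 (\<lambda>X. act Y (D (f \<odot> X)) - f \<odot> act Y (D X))" if f: "f \<in> C" for f
  proof (rule diffop_le_cong)
    show "act Y f \<odot> D X = act Y (D (f \<odot> X)) - f \<odot> act Y (D X)" if X: "X \<in> S" for X
    proof -
      have eq: "D (f \<odot> X) = f * D X"
        using 0(2) f X by (simp add: fscale_def times_fun_def)
      show ?thesis
        unfolding eq act_mult[OF Y f 0(1)[OF X]] by (simp add: fscale_apply fun_eq_iff)
    qed
    show "diffop_le M E 0 (\<lambda>X. act Y f \<odot> D X)"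
      by (intro diffop_le_fscale act_C Y f 0)
  qed
  then show ?case by (rule diffop_le_SucI)
next
  case (Suc k)
  have "diffop_le M E (Suc k) (\<lambda>X. act Y (D (f \<odot> X)) - f \<odot> act Y (D X))" if f: "f \<in> C" for f
  proof (rule diffop_le_cong)
    let ?D = "\<lambda>X. D (f \<odot> X) - f \<odot> D X"
    have fD: "f \<odot> D X = f * D X" for X
      by (simp add: fscale_def times_fun_def)
    have DC: "?D X \<in> C" if "X \<in> S" for X
      unfolding fD by (intro C_diff C_mult Suc.prems(1) S_fscale f that)
    show "act Y (?D X) + act Y f \<odot> D X = act Y (D (f \<odot> X)) - f \<odot> act Y (D X)" if X: "X \<in> S" for X
    proof -
      have eq: "act Y (?D X) = act Y (D (f \<odot> X)) - act Y (f * D X)"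
        unfolding fD by (intro act_diff C_mult Suc.prems(1) S_fscale f X Y)
      show ?thesis
        unfolding eq act_mult[OF Y f Suc.prems(1)[OF X]] by (simp add: fscale_apply fun_eq_iff)
    qed
    have "diffop_le M E k ?D"
      by (rule diffop_le_SucD[OF Suc.prems(2) f])
    then show "diffop_le M E (Suc k) (\<lambda>X. act Y (?D X) + act Y f \<odot> D X)"
      by (intro diffop_le_add diffop_le_fscale Suc.IH DC act_C Y f Suc.prems(2))
  qed
  then show ?case by (rule diffop_le_SucI)
qed

lemma diffop_le_comp_linear:
  assumes P: "\<And>X. X \<in> S \<Longrightarrow> P X \<in> S" "\<And>f X. f \<in> C \<Longrightarrow> X \<in> S \<Longrightarrow> P (f \<odot> X) = f \<odot> P X"
  shows "diffop_le M E k D \<Longrightarrow> diffop_le M E k (\<lambda>X. D (P X))"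
proof (induction k arbitrary: D)
  case 0
  then show ?case
    by (simp add: P)
next
  case (Suc k)
  have "diffop_le M E k (\<lambda>X. D (P (f \<odot> X)) - f \<odot> D (P X))" if f: "f \<in> C" for f
  proof (rule diffop_le_cong)
    show "D (f \<odot> P X) - f \<odot> D (P X) = D (P (f \<odot> X)) - f \<odot> D (P X)" if "X \<in> S" for X
      by (simp only: P f that)
    show "diffop_le M E k (\<lambda>X. D (f \<odot> P X) - f \<odot> D (P X))"
      by (rule Suc.IH[OF diffop_le_SucD[OF Suc.prems f]])
  qed
  then show ?case by (rule diffop_le_SucI)
qed

text \<open>With A f = [P, f], one has [D o P, f] = [D, f] o P + D o A f. The first summand is
  covered by the induction hypothesis and the second keeps order k, as A f is linear over functions.
  Additivity of D sits in the goal because the induction passes to [D, f].\<close>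

lemma diffop_le_comp_first_order:
  assumes P: "\<And>X. X \<in> S \<Longrightarrow> P X \<in> S"
    and A: "\<And>f X. f \<in> C \<Longrightarrow> X \<in> S \<Longrightarrow> A f X \<in> S"
      "\<And>f g X. f \<in> C \<Longrightarrow> g \<in> C \<Longrightarrow> X \<in> S \<Longrightarrow> A f (g \<odot> X) = g \<odot> A f X"
      "\<And>f X. f \<in> C \<Longrightarrow> X \<in> S \<Longrightarrow> P (f \<odot> X) = f \<odot> P X + A f X"
  shows "(\<And>X Y. X \<in> S \<Longrightarrow> Y \<in> S \<Longrightarrow> D (X + Y) = D X + D Y) \<Longrightarrow> diffop_le M E k D \<Longrightarrow>
    diffop_le M E (Suc k) (\<lambda>X. D (P X))"
proof (induction k arbitrary: D)
  case 0
  have "diffop_le M E 0 (\<lambda>X. D (P (f \<odot> X)) - f \<odot> D (P X))" if f: "f \<in> C" for f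
  proof (rule diffop_le_cong)
    show "D (A f X) = D (P (f \<odot> X)) - f \<odot> D (P X)" if X: "X \<in> S" for X
      using 0(2) unfolding A(3)[OF f X] 0(1)[OF S_fscale[OF f P[OF X]] A(1)[OF f X]]
      by (simp add: f P[OF X])
    show "diffop_le M E 0 (\<lambda>X. D (A f X))"
      by (rule diffop_le_comp_linear[OF A(1)[OF f] A(2)[OF f] 0(2)])
  qed
  then show ?case by (rule diffop_le_SucI)
next
  case (Suc k)
  have "diffop_le M E (Suc k) (\<lambda>X. D (P (f \<odot> X)) - f \<odot> D (P X))" if f: "f \<in> C" for f
  proof (rule diffop_le_cong)
    let ?D = "\<lambda>X. D (f \<odot> X) - f \<odot> D X"
    show "?D (P X) + D (A f X) = D (P (f \<odot> X)) - f \<odot> D (P X)" if X: "X \<in> S" for X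
      unfolding A(3)[OF f X] Suc.prems(1)[OF S_fscale[OF f P[OF X]] A(1)[OF f X]] by simp
    have add: "?D (X + Y) = ?D X + ?D Y" if "X \<in> S" "Y \<in> S" for X Y
    proof -
      have eq: "f \<odot> (X + Y) = f \<odot> X + f \<odot> Y"
        by (simp add: fscale_def fun_eq_iff algebra_simps)
      show ?thesis
        unfolding eq Suc.prems(1)[OF that] Suc.prems(1)[OF S_fscale[OF f that(1)] S_fscale[OF f that(2)]]
        by (simp add: fscale_apply fun_eq_iff algebra_simps)
    qed
    have "diffop_le M E k ?D"
      by (rule diffop_le_SucD[OF Suc.prems(2) f])
    from Suc.IH[OF add this]
    show "diffop_le M E (Suc k) (\<lambda>X. ?D (P X) + D (A f X))"
      by (intro diffop_le_add diffop_le_comp_linear[of "A f", OF A(1)[OF f] A(2)[OF f] Suc.prems(2)])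
  qed
  then show ?case by (rule diffop_le_SucI)
qed

text \<open>The value of \<alpha> is a finite sum of elementary tensors whose endomorphism factors
  are linear on the fibre, so scaling can be pulled out pointwise.\<close>

lemma alpha_act_fscale:
  assumes X: "X \<in> S" and Y: "Y \<in> S"
  shows "alpha_act M \<alpha> Y f (g \<odot> X) = g \<odot> alpha_act M \<alpha> Y f X"
proof
  fix x
  show "alpha_act M \<alpha> Y f (g \<odot> X) x = (g \<odot> alpha_act M \<alpha> Y f X) x"
  proof (cases "x \<in> points M")
    case True
    have "linear_between (fibre E x) (fibre (tensor_bundle M E) x) (\<alpha> x)"
      using \<alpha> True unfolding vb_morphism_def by blast
    then have "\<alpha> x (Y x) \<in> fibre (tensor_bundle M E) x"
      using Sec_fibre[OF M E Y True] unfolding linear_between_def by blast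
    then have "\<alpha> x (Y x) \<in> tensor_space M E x"
      by (simp add: tensor_bundle_def)
    then obtain k :: nat and V \<Phi> where
      eq: "\<alpha> x (Y x) = (\<lambda>\<omega> X. if \<omega> \<in> cotangent_space M x \<and> X \<in> fibre E x
             then (\<Sum>i<k. \<omega> (V i) *\<^sub>R \<Phi> i X) else 0)"
      and lin: "\<And>i. i < k \<Longrightarrow> linear_between (fibre E x) (fibre E x) (\<Phi> i)"
      unfolding tensor_space_def by blast
    have Xx: "X x \<in> fibre E x" and gX: "g x *\<^sub>R X x \<in> fibre E x"
      using Sec_fibre[OF M E X True] subspace_scale[OF fibre_subspace[OF M E True]] by auto
    have "(\<Sum>i<k. \<omega> (V i) *\<^sub>R \<Phi> i (g x *\<^sub>R X x)) = g x *\<^sub>R (\<Sum>i<k. \<omega> (V i) *\<^sub>R \<Phi> i (X x))" for \<omega>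
      unfolding scaleR_sum_right
    proof (rule sum.cong)
      fix i assume "i \<in> {..<k}"
      then have "\<Phi> i (g x *\<^sub>R X x) = g x *\<^sub>R \<Phi> i (X x)"
        using lin Xx by (simp add: linear_between_def)
      then show "\<omega> (V i) *\<^sub>R \<Phi> i (g x *\<^sub>R X x) = g x *\<^sub>R \<omega> (V i) *\<^sub>R \<Phi> i (X x)"
        by simp
    qed simp
    then show ?thesis
      using True Xx gX by (simp add: alpha_act_def fscale_apply eq)
  qed (simp add: alpha_act_def fscale_apply)
qed

definition diffops :: "nat \<Rightarrow> (('m \<Rightarrow> 'e) \<Rightarrow> ('m \<Rightarrow> real)) set" where
  "diffops k = {D. linear_between S C D \<and> diffop_le M E k D}"

lemma diffopsI:
  assumes "\<And>X. X \<in> S \<Longrightarrow> D X \<in> C" "\<And>X Y. X \<in> S \<Longrightarrow> Y \<in> S \<Longrightarrow> D (X + Y) = D X + D Y"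
    "\<And>r X. X \<in> S \<Longrightarrow> D (r *\<^sub>R X) = r *\<^sub>R D X" "diffop_le M E k D"
  shows "D \<in> diffops k"
  using assms by (auto simp: diffops_def linear_between_def)

lemma diffopsD:
  assumes "D \<in> diffops k"
  shows diffops_C: "\<And>X. X \<in> S \<Longrightarrow> D X \<in> C"
    and diffops_additive: "\<And>X Y. X \<in> S \<Longrightarrow> Y \<in> S \<Longrightarrow> D (X + Y) = D X + D Y"
    and diffops_homogeneous: "\<And>r X. X \<in> S \<Longrightarrow> D (r *\<^sub>R X) = r *\<^sub>R D X"
    and diffops_le: "diffop_le M E k D"
  using assms by (auto simp: diffops_def linear_between_def)

lemma diffops_cong:
  assumes D: "D \<in> diffops k" and eq: "\<And>X. X \<in> S \<Longrightarrow> D X = D' X"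
  shows "D' \<in> diffops k"
  using diffopsD[OF D] diffop_le_cong[OF eq diffops_le[OF D]]
  by (intro diffopsI) (simp_all add: eq[symmetric] S_add S_scaleR del: diffop_le.simps)

lemma diffops_mono: "D \<in> diffops k \<Longrightarrow> k \<le> l \<Longrightarrow> D \<in> diffops l"
  by (auto simp: diffops_def intro: diffop_le_mono)

lemma diffops_zero: "(\<lambda>X. 0) \<in> diffops k"
  by (intro diffopsI diffop_le_zero) (simp_all add: C_zero)

lemma diffops_add:
  assumes D: "D \<in> diffops k" "D' \<in> diffops k"
  shows "(\<lambda>X. D X + D' X) \<in> diffops k"
  using D[THEN diffops_additive] D[THEN diffops_homogeneous]
  by (intro diffopsI diffop_le_add C_add D[THEN diffops_C] D[THEN diffops_le])
    (simp_all add: scaleR_add_right)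

lemma diffops_scaleR:
  assumes D: "D \<in> diffops k"
  shows "(\<lambda>X. r *\<^sub>R D X) \<in> diffops k"
  using diffops_additive[OF D] diffops_homogeneous[OF D]
  by (intro diffopsI diffop_le_scaleR C_scaleR diffops_C[OF D] diffops_le[OF D])
    (simp_all add: scaleR_add_right)

lemma diffops_diff: "D \<in> diffops k \<Longrightarrow> D' \<in> diffops k \<Longrightarrow> (\<lambda>X. D X - D' X) \<in> diffops k"
  using diffops_add[OF _ diffops_scaleR[of D' k "-1"], of D] by simp

lemma diffops_sum: "(\<And>i. i \<in> I \<Longrightarrow> D i \<in> diffops k) \<Longrightarrow> (\<lambda>X. \<Sum>i\<in>I. D i X) \<in> diffops k"
proof (induction I rule: infinite_finite_induct)
  case (insert i I)
  have "(\<lambda>X. D i X + (\<Sum>i\<in>I. D i X)) \<in> diffops k"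
    using insert by (intro diffops_add) auto
  then show ?case
    by (simp only: sum.insert[OF insert.hyps])
qed (simp_all add: diffops_zero)

lemma diffops_act:
  assumes Y: "Y \<in> S" and D: "D \<in> diffops k"
  shows "(\<lambda>X. act Y (D X)) \<in> diffops (Suc k)"
  by (intro diffopsI diffop_le_act[OF Y diffops_C[OF D] diffops_le[OF D]] act_C Y)
    (simp_all add: diffops_C[OF D] diffops_additive[OF D] diffops_homogeneous[OF D] act_add[OF Y] act_scaleR[OF Y])

lemma diffops_act_arg:
  assumes g: "g \<in> C"
  shows "(\<lambda>X. act X g) \<in> diffops k"
proof (rule diffops_mono)
  show "(\<lambda>X. act X g) \<in> diffops 0"
  proof (rule diffopsI)
    have "act (f \<odot> X) g = f \<odot> act X g" if "X \<in> S" for f X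
      unfolding act_fscale_sec[OF that] by (simp add: fscale_apply fun_eq_iff)
    then show "diffop_le M E 0 (\<lambda>X. act X g)"
      by simp
  qed (fact act_C[OF _ g] act_add_sec act_scaleR_sec)+
qed simp

lemma diffops_br_right:
  assumes Y: "Y \<in> S" and D: "D \<in> diffops k"
  shows "(\<lambda>X. D (br Y X)) \<in> diffops (Suc k)"
proof (rule diffopsI)
  show "diffop_le M E (Suc k) (\<lambda>X. D (br Y X))"
  proof (rule diffop_le_comp_first_order[where A = "\<lambda>f X. act Y f \<odot> X"])
    show "act Y f \<odot> g \<odot> X = g \<odot> act Y f \<odot> X" for f g :: "'m \<Rightarrow> real" and X :: "'m \<Rightarrow> 'e"
      by (simp add: fscale_def fun_eq_iff mult.commute)
    show "act Y f \<odot> X \<in> S" if "f \<in> C" "X \<in> S" for f X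
      by (intro S_fscale act_C Y that)
    show "br Y (f \<odot> X) = f \<odot> br Y X + act Y f \<odot> X" if "f \<in> C" "X \<in> S" for f X
      by (rule leibniz_right[OF Y that(2,1)])
  qed (fact br_S[OF Y] diffops_additive[OF D] diffops_le[OF D])+
  show "D (br Y (X + Z)) = D (br Y X) + D (br Y Z)" if "X \<in> S" "Z \<in> S" for X Z
    unfolding br_add_right[OF Y that] by (intro diffops_additive[OF D] br_S Y that)
  show "D (br Y (r *\<^sub>R X)) = r *\<^sub>R D (br Y X)" if "X \<in> S" for r X
    unfolding br_scaleR_right[OF Y that] by (intro diffops_homogeneous[OF D] br_S Y that)
  show "D (br Y X) \<in> C" if "X \<in> S" for X
    by (intro diffops_C[OF D] br_S Y that)
qed

lemma diffops_br_left:
  assumes Y: "Y \<in> S" and D: "D \<in> diffops k"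
  shows "(\<lambda>X. D (br X Y)) \<in> diffops (Suc k)"
proof (rule diffopsI)
  show "diffop_le M E (Suc k) (\<lambda>X. D (br X Y))"
  \<comment> \<open>The defect is written as a difference rather than through
    \<open>\<alpha>\<close>: it is then a section by closure of \<open>S\<close>, and the Leibniz
    rule is used only for its linearity over functions.\<close>
  proof (rule diffop_le_comp_first_order[where A = "\<lambda>f X. br (f \<odot> X) Y - f \<odot> br X Y"])
    show "br (f \<odot> g \<odot> X) Y - f \<odot> br (g \<odot> X) Y = g \<odot> (br (f \<odot> X) Y - f \<odot> br X Y)"
      if "f \<in> C" "g \<in> C" "X \<in> S" for f g X
    proof -
      have "br (f \<odot> Z) Y - f \<odot> br Z Y = alpha_act M \<alpha> Y f Z - act Y f \<odot> Z" if "Z \<in> S" for Z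
        by (simp add: leibniz_left[OF that Y \<open>f \<in> C\<close>])
      then show ?thesis
        using that alpha_act_fscale[OF that(3) Y, of f g]
        by (simp add: S_fscale) (simp add: fscale_def fun_eq_iff algebra_simps)
    qed
    show "br (f \<odot> X) Y - f \<odot> br X Y \<in> S" if "f \<in> C" "X \<in> S" for f X
      by (intro S_diff br_S S_fscale Y that)
    show "br (f \<odot> X) Y = f \<odot> br X Y + (br (f \<odot> X) Y - f \<odot> br X Y)" for f X
      by simp
  qed (fact br_S[OF _ Y] diffops_additive[OF D] diffops_le[OF D])+
  show "D (br (X + Z) Y) = D (br X Y) + D (br Z Y)" if "X \<in> S" "Z \<in> S" for X Z
    unfolding br_add_left[OF that Y] by (intro diffops_additive[OF D] br_S Y that)
  show "D (br (r *\<^sub>R X) Y) = r *\<^sub>R D (br X Y)" if "X \<in> S" for r X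
    unfolding br_scaleR_left[OF that Y] by (intro diffops_homogeneous[OF D] br_S Y that)
  show "D (br X Y) \<in> C" if "X \<in> S" for X
    by (intro diffops_C[OF D] br_S Y that)
qed


section \<open>Multidifferential operators\<close>

text \<open>One bound K for all slots, in contrast to the slotwise orders in
  \<open>multidiff\<close>; with it the estimate "the order grows by at most one" can be proved by
  induction on the number of arguments.\<close>

definition multidiff_le :: "nat \<Rightarrow> nat \<Rightarrow> ('m, 'e) cochain set" where
  "multidiff_le K p =
     {c. (\<forall>Xs. \<not> (length Xs = p \<and> set Xs \<subseteq> S) \<longrightarrow> c Xs = 0) \<and>
         (\<forall>Xs. length Xs = p \<and> set Xs \<subseteq> S \<longrightarrow> c Xs \<in> C) \<and>
         (\<forall>i<p. \<forall>Xs. length Xs = p \<and> set Xs \<subseteq> S \<longrightarrow> (\<lambda>X. c (Xs[i := X])) \<in> diffops K)}"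

lemma multidiff_leI:
  assumes "\<And>Xs. \<not> (length Xs = p \<and> set Xs \<subseteq> S) \<Longrightarrow> c Xs = 0"
    "\<And>Xs. length Xs = p \<Longrightarrow> set Xs \<subseteq> S \<Longrightarrow> c Xs \<in> C"
    "\<And>i Xs. i < p \<Longrightarrow> length Xs = p \<Longrightarrow> set Xs \<subseteq> S \<Longrightarrow> (\<lambda>X. c (Xs[i := X])) \<in> diffops K"
  shows "c \<in> multidiff_le K p"
  using assms unfolding multidiff_le_def by blast

lemma multidiff_le_0: "c \<in> multidiff_le K p \<Longrightarrow> \<not> (length Xs = p \<and> set Xs \<subseteq> S) \<Longrightarrow> c Xs = 0"
  unfolding multidiff_le_def by blast

lemma multidiff_le_cochains: "c \<in> multidiff_le K p \<Longrightarrow> c \<in> cochains"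
  unfolding multidiff_le_def using C_zero by (intro cochainsI) (metis (mono_tags, lifting) mem_Collect_eq)+

lemma multidiff_le_slot:
  assumes c: "c \<in> multidiff_le K p" and Xs: "set Xs \<subseteq> S" and i: "i < length Xs"
  shows "(\<lambda>X. c (Xs[i := X])) \<in> diffops K"
proof (cases "length Xs = p")
  case True
  then show ?thesis
    using c Xs i unfolding multidiff_le_def by blast
next
  case False
  then have "c (Xs[i := X]) = 0" for X
    by (intro multidiff_le_0[OF c]) simp
  then show ?thesis
    by (simp only: diffops_zero)
qed

lemma multidiff_le_head:
  assumes c: "c \<in> multidiff_le K p" and Xs: "set Xs \<subseteq> S"
  shows "(\<lambda>X. c (X # Xs)) \<in> diffops K"
  using multidiff_le_slot[OF c, of "0 # Xs" 0] S_zero Xs by simp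

lemma multidiff_le_mono: "c \<in> multidiff_le K p \<Longrightarrow> K \<le> K' \<Longrightarrow> c \<in> multidiff_le K' p"
  unfolding multidiff_le_def using diffops_mono by blast

lemma multidiff_iff: "c \<in> multidiff M E p \<longleftrightarrow> (\<exists>K. c \<in> multidiff_le K p)"
proof
  assume c: "c \<in> multidiff M E p"
  then have "\<forall>i<p. \<exists>k. \<forall>Xs. length Xs = p \<and> set Xs \<subseteq> S \<longrightarrow> diffop_le M E k (\<lambda>X. c (Xs[i := X]))"
    unfolding multidiff_def by blast
  then obtain k where k: "\<And>i Xs. i < p \<Longrightarrow> length Xs = p \<Longrightarrow> set Xs \<subseteq> S \<Longrightarrow>
      diffop_le M E (k i) (\<lambda>X. c (Xs[i := X]))"
    by metis
  \<comment> \<open>The sum of the slotwise orders merely serves as a common upper bound.\<close>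
  have "diffop_le M E (\<Sum>i<p. k i) (\<lambda>X. c (Xs[i := X]))"
    if "i < p" "length Xs = p" "set Xs \<subseteq> S" for i Xs
    by (rule diffop_le_mono[OF k[OF that]]) (use that in \<open>auto intro: member_le_sum\<close>)
  then have "c \<in> multidiff_le (\<Sum>i<p. k i) p"
    using c unfolding multidiff_le_def multidiff_def diffops_def by blast
  then show "\<exists>K. c \<in> multidiff_le K p" ..
next
  assume "\<exists>K. c \<in> multidiff_le K p"
  then obtain K where "c \<in> multidiff_le K p" ..
  then show "c \<in> multidiff M E p"
    unfolding multidiff_le_def multidiff_def diffops_def by blast
qed

lemma multidiff_le_add:
  assumes a: "a \<in> multidiff_le K p" and b: "b \<in> multidiff_le K p"
  shows "a + b \<in> multidiff_le K p"
proof (rule multidiff_leI)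
  fix Xs assume "\<not> (length Xs = p \<and> set Xs \<subseteq> S)"
  then show "(a + b) Xs = 0"
    using multidiff_le_0[OF a, of Xs] multidiff_le_0[OF b, of Xs] by (simp add: fun_eq_iff)
next
  fix Xs assume "length Xs = p" "set Xs \<subseteq> S"
  show "(a + b) Xs \<in> C"
    by (intro cochains_C' cochains_add multidiff_le_cochains[OF a] multidiff_le_cochains[OF b])
next
  fix i Xs assume "i < p" "length Xs = p" "set Xs \<subseteq> S"
  then have "(\<lambda>X. a (Xs[i := X]) + b (Xs[i := X])) \<in> diffops K"
    by (intro diffops_add multidiff_le_slot[OF a] multidiff_le_slot[OF b]) simp_all
  then show "(\<lambda>X. (a + b) (Xs[i := X])) \<in> diffops K"
    by (rule diffops_cong) (simp add: fun_eq_iff)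
qed

lemma multidiff_le_scaleR:
  assumes a: "a \<in> multidiff_le K p"
  shows "r *\<^sub>R a \<in> multidiff_le K p"
proof (rule multidiff_leI)
  fix Xs assume "\<not> (length Xs = p \<and> set Xs \<subseteq> S)"
  then show "(r *\<^sub>R a) Xs = 0"
    using multidiff_le_0[OF a, of Xs] by (simp add: fun_eq_iff)
next
  fix Xs assume "length Xs = p" "set Xs \<subseteq> S"
  show "(r *\<^sub>R a) Xs \<in> C"
    by (intro cochains_C' cochains_scaleR multidiff_le_cochains[OF a])
next
  fix i Xs assume "i < p" "length Xs = p" "set Xs \<subseteq> S"
  then have "(\<lambda>X. r *\<^sub>R a (Xs[i := X])) \<in> diffops K"
    by (intro diffops_scaleR multidiff_le_slot[OF a]) simp_all
  then show "(\<lambda>X. (r *\<^sub>R a) (Xs[i := X])) \<in> diffops K"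
    by (rule diffops_cong) (simp add: fun_eq_iff)
qed

lemma multidiff_le_diff:
  "a \<in> multidiff_le K p \<Longrightarrow> b \<in> multidiff_le K p \<Longrightarrow> a - b \<in> multidiff_le K p"
  using multidiff_le_add[OF _ multidiff_le_scaleR[of b K p "-1"], of a] by simp

lemma multidiff_le_zero: "0 \<in> multidiff_le K p"
  by (rule multidiff_leI) (simp_all only: zero_fun_apply diffops_zero C_zero)

lemma multidiff_le_contraction:
  assumes X: "X \<in> S" and c: "c \<in> multidiff_le K (Suc p)"
  shows "contraction X c \<in> multidiff_le K p"
proof (rule multidiff_leI)
  fix Xs assume "\<not> (length Xs = p \<and> set Xs \<subseteq> S)"
  then show "contraction X c Xs = 0"
    unfolding contraction_apply by (intro multidiff_le_0[OF c]) simp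
next
  fix Xs assume "length Xs = p" "set Xs \<subseteq> S"
  show "contraction X c Xs \<in> C"
    by (intro cochains_C' cochains_contraction X multidiff_le_cochains[OF c])
next
  fix i Xs assume "i < p" "length Xs = p" "set Xs \<subseteq> S"
  then show "(\<lambda>Z. contraction X c (Xs[i := Z])) \<in> diffops K"
    using multidiff_le_slot[OF c, of "X # Xs" "Suc i"] X unfolding contraction_apply by simp
qed

lemma contraction_multidiff_le_zero:
  assumes "c \<in> multidiff_le K 0"
  shows "contraction X c = 0"
proof
  fix Xs show "contraction X c Xs = 0 Xs"
    using multidiff_le_0[OF assms, of "X # Xs"] by (simp add: contraction_def)
qed

lemma multidiff_le_lie:
  assumes X: "X \<in> S" and c: "c \<in> multidiff_le K p"
  shows "lie X c \<in> multidiff_le (Suc K) p"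
proof (rule multidiff_leI)
  fix Xs assume Xs: "\<not> (length Xs = p \<and> set Xs \<subseteq> S)"
  show "lie X c Xs = 0"
  proof (cases "set Xs \<subseteq> S")
    case True
    with Xs have "length Xs \<noteq> p"
      by simp
    then have "c (Xs[j := Z]) = 0" "c Xs = 0" for j Z
      using multidiff_le_0[OF c] by simp_all
    then show ?thesis
      unfolding lie_def if_P[OF True] by (simp only: act_zero[OF X] sum.neutral_const diff_self)
  qed (rule lie_outside)
next
  fix Xs assume "length Xs = p" "set Xs \<subseteq> S"
  show "lie X c Xs \<in> C"
    by (intro cochains_C' cochains_lie X multidiff_le_cochains[OF c])
next
  fix i Xs assume i: "i < p" and len: "length Xs = p" and Xs: "set Xs \<subseteq> S"
  \<comment> \<open>The variable Z sits in slot i. For j = i the bracket hits Z and costs one order;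
    for j different from i it only alters a fixed argument.\<close>
  let ?D = "\<lambda>j Z. if j = i then c (Xs[i := br X Z]) else c (Xs[j := br X (Xs ! j), i := Z])"
  have "(\<lambda>Z. act X (c (Xs[i := Z])) - (\<Sum>j<p. ?D j Z)) \<in> diffops (Suc K)"
  proof (intro diffops_diff diffops_sum diffops_act X multidiff_le_slot[OF c Xs])
    fix j assume j: "j \<in> {..<p}"
    show "?D j \<in> diffops (Suc K)"
    proof (cases "j = i")
      case True
      then show ?thesis
        using diffops_br_right[OF X multidiff_le_slot[OF c Xs, of i]] i len by simp
    next
      case False
      have "(\<lambda>Z. c (Xs[j := br X (Xs ! j), i := Z])) \<in> diffops K"
        using i j len by (intro multidiff_le_slot[OF c] set_br_update_subset X Xs) simp_all
      then show ?thesis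
        using False diffops_mono[of _ K "Suc K"] by simp
    qed
  qed (use i len in simp)
  then show "(\<lambda>Z. lie X c (Xs[i := Z])) \<in> diffops (Suc K)"
  proof (rule diffops_cong)
    fix Z assume "Z \<in> S"
    then have "set (Xs[i := Z]) \<subseteq> S"
      by (rule set_update_subset[OF Xs])
    then have "lie X c (Xs[i := Z]) =
        act X (c (Xs[i := Z])) - (\<Sum>j<p. c (Xs[i := Z, j := br X (Xs[i := Z] ! j)]))"
      using len by (simp add: lie_def)
    also have "(\<Sum>j<p. c (Xs[i := Z, j := br X (Xs[i := Z] ! j)])) = (\<Sum>j<p. ?D j Z)"
    proof (rule sum.cong)
      fix j assume "j \<in> {..<p}"
      then show "c (Xs[i := Z, j := br X (Xs[i := Z] ! j)]) = ?D j Z"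
        using i len list_update_swap[of i j Xs Z] by auto
    qed simp
    finally show "act X (c (Xs[i := Z])) - (\<Sum>j<p. ?D j Z) = lie X c (Xs[i := Z])"
      by (rule sym)
  qed
qed

lemma length_omit: "i < length Xs \<Longrightarrow> length (omit i Xs) = length Xs - 1"
  by (simp add: omit_def)

lemma coboundary_cong_length:
  assumes "\<And>Ys. Suc (length Ys) = length Xs \<Longrightarrow> c Ys = c' Ys"
  shows "d c Xs = d c' Xs"
proof -
  have eq: "c (omit i Ys) = c' (omit i Ys)" if "i < length Xs" "length Ys = length Xs" for i Ys
    using that length_omit[of i Ys] by (intro assms) simp
  have "(\<Sum>i<length Xs. ((-1) ^ i :: real) *\<^sub>R act (Xs ! i) (c (omit i Xs))) =
      (\<Sum>i<length Xs. ((-1) ^ i :: real) *\<^sub>R act (Xs ! i) (c' (omit i Xs)))"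
    by (rule sum.cong) (simp_all add: eq)
  moreover have "(\<Sum>j<length Xs. \<Sum>i<j. ((-1) ^ Suc i :: real) *\<^sub>R c (omit i (Xs[j := br (Xs ! i) (Xs ! j)]))) =
      (\<Sum>j<length Xs. \<Sum>i<j. ((-1) ^ Suc i :: real) *\<^sub>R c' (omit i (Xs[j := br (Xs ! i) (Xs ! j)])))"
    by (intro sum.cong) (simp_all add: eq)
  ultimately show ?thesis
    by (simp only: coboundary_def)
qed

lemma coboundary_length_zero:
  assumes "\<And>Ys. Suc (length Ys) = length Xs \<Longrightarrow> c Ys = 0"
  shows "d c Xs = 0"
proof -
  have "d c Xs = d 0 Xs"
    by (rule coboundary_cong_length) (simp only: assms zero_fun_apply)
  then show ?thesis
    by (simp only: coboundary_zero zero_fun_apply)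
qed

text \<open>Treats the first slot by itself and all later slots through contraction, which is the
  shape in which the recursion for d delivers its information.\<close>

lemma multidiff_le_SucI:
  assumes "\<And>Xs. \<not> (length Xs = Suc p \<and> set Xs \<subseteq> S) \<Longrightarrow> c Xs = 0"
    and head: "\<And>Xs. length Xs = p \<Longrightarrow> set Xs \<subseteq> S \<Longrightarrow> (\<lambda>X. c (X # Xs)) \<in> diffops K"
    and tail: "\<And>X. X \<in> S \<Longrightarrow> contraction X c \<in> multidiff_le K p"
  shows "c \<in> multidiff_le K (Suc p)"
proof (rule multidiff_leI)
  show "\<And>Xs. \<not> (length Xs = Suc p \<and> set Xs \<subseteq> S) \<Longrightarrow> c Xs = 0"
    by fact
next
  fix Xs assume "length Xs = Suc p" "set Xs \<subseteq> S"
  then show "c Xs \<in> C"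
    using head diffops_C by (cases Xs) auto
next
  fix i Xs assume i: "i < Suc p" and "length Xs = Suc p" "set Xs \<subseteq> S"
  then obtain Y Ys where Xs: "Xs = Y # Ys" "length Ys = p" "set Ys \<subseteq> S" "Y \<in> S"
    by (cases Xs) auto
  show "(\<lambda>X. c (Xs[i := X])) \<in> diffops K"
  proof (cases i)
    case 0
    then show ?thesis
      using head Xs by simp
  next
    case (Suc j)
    then show ?thesis
      using multidiff_le_slot[OF tail[OF Xs(4)] Xs(3), of j] i Xs by (simp add: contraction_def)
  qed
qed

lemma diffops_coboundary_contraction:
  assumes c: "c \<in> multidiff_le K p" and Xs: "set Xs \<subseteq> S"
  shows "(\<lambda>X. d (contraction X c) Xs) \<in> diffops (Suc K)"
proof -
  have "(\<lambda>X. c (X # omit i (Xs[j := br (Xs ! i) (Xs ! j)]))) \<in> diffops (Suc K)"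
    if "j < length Xs" "i < j" for i j
    using that by (intro diffops_mono[OF multidiff_le_head[OF c]] set_omit_subset set_update_subset br_S nth_S Xs) auto
  moreover have "(\<lambda>X. act (Xs ! i) (c (X # omit i Xs))) \<in> diffops (Suc K)" if "i < length Xs" for i
    using that by (intro diffops_act multidiff_le_head[OF c] set_omit_subset nth_S Xs)
  ultimately show ?thesis
    unfolding coboundary_def if_P[OF Xs] contraction_apply
    by (intro diffops_add diffops_sum diffops_scaleR) auto
qed

text \<open>Here X is the left argument of every bracket, so this estimate depends on
  \<open>\<alpha>\<close>, through \<open>diffops_br_left\<close>.\<close>

lemma diffops_lie_arg:
  assumes c: "c \<in> multidiff_le K p" and Xs: "set Xs \<subseteq> S"
  shows "(\<lambda>X. lie X c Xs) \<in> diffops (Suc K)"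
proof -
  have "(\<lambda>X. c (Xs[j := br X (Xs ! j)])) \<in> diffops (Suc K)" if "j < length Xs" for j
    using diffops_br_left[OF nth_S[OF Xs that] multidiff_le_slot[OF c Xs that]] .
  then show ?thesis
    unfolding lie_def if_P[OF Xs]
    by (intro diffops_diff diffops_sum diffops_act_arg cochains_C' multidiff_le_cochains[OF c]) auto
qed

text \<open>As a function of the first slot, d c is
  \<open>lie X c Xs - d (contraction X c) Xs\<close> with X varying. For the later slots X is fixed,
  and the same difference is estimated by \<open>multidiff_le_lie\<close> and by the assumption on
  contractions.\<close>

lemma multidiff_le_coboundary_step:
  assumes c: "c \<in> multidiff_le K p"
    and tail: "\<And>X. X \<in> S \<Longrightarrow> d (contraction X c) \<in> multidiff_le (Suc K) p"
  shows "d c \<in> multidiff_le (Suc K) (Suc p)"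
proof (rule multidiff_le_SucI)
  fix Xs assume Xs: "\<not> (length Xs = Suc p \<and> set Xs \<subseteq> S)"
  show "d c Xs = 0"
  proof (cases "set Xs \<subseteq> S")
    case True
    then show ?thesis
      using Xs by (intro coboundary_length_zero multidiff_le_0[OF c]) auto
  qed (rule coboundary_outside)
next
  fix Xs assume Xs: "length Xs = p" "set Xs \<subseteq> S"
  have "(\<lambda>X. lie X c Xs - d (contraction X c) Xs) \<in> diffops (Suc K)"
    by (intro diffops_diff diffops_lie_arg[OF c] diffops_coboundary_contraction[OF c] Xs)
  then show "(\<lambda>X. d c (X # Xs)) \<in> diffops (Suc K)"
    by (rule diffops_cong) (rule coboundary_Cons[OF _ Xs(2), symmetric])
next
  fix X assume X: "X \<in> S"
  show "contraction X (d c) \<in> multidiff_le (Suc K) p"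
    unfolding contraction_coboundary[OF X] by (intro multidiff_le_diff multidiff_le_lie X c tail)
qed

lemma multidiff_le_coboundary:
  "c \<in> multidiff_le K p \<Longrightarrow> d c \<in> multidiff_le (Suc K) (Suc p)"
proof (induction p arbitrary: c)
  case 0
  show ?case
  proof (rule multidiff_le_coboundary_step[OF 0])
    show "d (contraction X c) \<in> multidiff_le (Suc K) 0" for X
      unfolding contraction_multidiff_le_zero[OF 0] coboundary_zero by (rule multidiff_le_zero)
  qed
next
  case (Suc p)
  show ?case
    by (intro multidiff_le_coboundary_step Suc multidiff_le_contraction)
qed

lemma multidiff_coboundary: "c \<in> multidiff M E p \<Longrightarrow> d c \<in> multidiff M E (Suc p)"
  unfolding multidiff_iff using multidiff_le_coboundary by blast

lemma multidiff_contraction: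
  "X \<in> S \<Longrightarrow> c \<in> multidiff M E (Suc p) \<Longrightarrow> contraction X c \<in> multidiff M E p"
  unfolding multidiff_iff using multidiff_le_contraction by blast

lemma contraction_multidiff_zero: "c \<in> multidiff M E 0 \<Longrightarrow> contraction X c = 0"
  unfolding multidiff_iff using contraction_multidiff_le_zero by blast

lemma multidiff_lie: "X \<in> S \<Longrightarrow> c \<in> multidiff M E p \<Longrightarrow> lie X c \<in> multidiff M E p"
  unfolding multidiff_iff using multidiff_le_lie by blast

lemma multidiff_add: "a \<in> multidiff M E p \<Longrightarrow> b \<in> multidiff M E p \<Longrightarrow> a + b \<in> multidiff M E p"
  unfolding multidiff_iff using multidiff_le_add multidiff_le_mono
  by (meson max.cobounded1 max.cobounded2)

lemma multidiff_zero: "0 \<in> multidiff M E p"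
  unfolding multidiff_iff using multidiff_le_zero by blast

section \<open>Passage to the direct sum over all degrees\<close>

lemma component_coboundary: "component (Suc p) (d c) = d (component p c)"
proof
  fix Xs
  show "component (Suc p) (d c) Xs = d (component p c) Xs"
  proof (cases "length Xs = Suc p")
    case True
    have "d c Xs = d (component p c) Xs"
      by (rule coboundary_cong_length) (simp add: component_def True)
    then show ?thesis
      by (simp add: component_def True)
  next
    case False
    have "d (component p c) Xs = 0"
      using False by (intro coboundary_length_zero) (auto simp: component_def)
    then show ?thesis
      using False by (simp add: component_def)
  qed
qed

lemma component_coboundary_0: "component 0 (d c) = 0"
proof
  fix Xs show "component 0 (d c) Xs = 0 Xs"
    using coboundary_Nil[of c] by (simp add: component_def)
qed

lemma component_contraction: "component p (contraction X c) = contraction X (component (Suc p) c)"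
proof
  fix Xs show "component p (contraction X c) Xs = contraction X (component (Suc p) c) Xs"
    by (simp add: component_def contraction_def)
qed

lemma component_add: "component p (a + b) = component p a + component p b"
  by (rule ext, rule ext) (simp add: component_def)

lemma multidiffsI:
  assumes "\<And>p. component p c \<in> multidiff M E p" "finite A" "\<And>p. p \<notin> A \<Longrightarrow> component p c = 0"
  shows "c \<in> multidiffs M E"
proof -
  have "{p. component p c \<noteq> 0} \<subseteq> A"
    using assms(3) by blast
  then show ?thesis
    using assms(1,2) finite_subset unfolding multidiffs_def by blast
qed

lemma multidiffs_add:
  assumes "a \<in> multidiffs M E" "b \<in> multidiffs M E"
  shows "a + b \<in> multidiffs M E"
proof (rule multidiffsI)
  show "component p (a + b) \<in> multidiff M E p" for p
    unfolding component_add using assms by (intro multidiff_add) (auto simp: multidiffs_def)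
  show "finite ({p. component p a \<noteq> 0} \<union> {p. component p b \<noteq> 0})"
    using assms by (simp add: multidiffs_def)
  show "component p (a + b) = 0" if "p \<notin> {p. component p a \<noteq> 0} \<union> {p. component p b \<noteq> 0}" for p
    using that by (simp add: component_add)
qed

lemma multidiffs_coboundary:
  assumes "c \<in> multidiffs M E"
  shows "d c \<in> multidiffs M E"
proof (rule multidiffsI)
  show "component p (d c) \<in> multidiff M E p" for p
    using assms by (cases p)
      (auto simp: component_coboundary component_coboundary_0 multidiffs_def
        intro: multidiff_zero multidiff_coboundary)
  show "finite (Suc ` {p. component p c \<noteq> 0})"
    using assms by (simp add: multidiffs_def)
  show "component p (d c) = 0" if "p \<notin> Suc ` {p. component p c \<noteq> 0}" for p
    using that by (cases p) (auto simp: component_coboundary component_coboundary_0 coboundary_zero)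
qed

lemma multidiffs_contraction:
  assumes "X \<in> S" "c \<in> multidiffs M E"
  shows "contraction X c \<in> multidiffs M E"
proof (rule multidiffsI)
  show "component p (contraction X c) \<in> multidiff M E p" for p
    unfolding component_contraction using assms by (auto simp: multidiffs_def intro: multidiff_contraction)
  show "finite (Suc -` {p. component p c \<noteq> 0})"
    by (rule finite_vimageI[OF _ inj_Suc]) (use assms in \<open>simp add: multidiffs_def\<close>)
  show "component p (contraction X c) = 0" if "p \<notin> Suc -` {p. component p c \<noteq> 0}" for p
    using that by (simp add: component_contraction contraction_zero)
qed

lemma multidiffs_additive_cochains:
  assumes "c \<in> multidiffs M E"
  shows "c \<in> additive_cochains"
proof -
  have comp: "component p c Xs = c Xs" if "length Xs = p" for p Xs
    using that by (simp add: component_def)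
  have md: "\<exists>K. component p c \<in> multidiff_le K p" for p
    using assms by (simp add: multidiffs_def multidiff_iff)
  have "c \<in> cochains"
  proof (rule cochainsI)
    fix Xs assume "set Xs \<subseteq> S"
    then show "c Xs \<in> C"
      using md[of "length Xs"] comp[OF refl, of Xs] multidiff_le_cochains cochains_C' by metis
  next
    fix Xs assume "\<not> set Xs \<subseteq> S"
    then show "c Xs = 0"
      using md[of "length Xs"] comp[OF refl, of Xs] multidiff_le_0 by metis
  qed
  moreover have "c (Xs[i := U + V]) = c (Xs[i := U]) + c (Xs[i := V])"
    if Xs: "set Xs \<subseteq> S" and i: "i < length Xs" and UV: "U \<in> S" "V \<in> S" for Xs i U V
  proof -
    obtain K where "component (length Xs) c \<in> multidiff_le K (length Xs)"
      using md by blast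
    from diffops_additive[OF multidiff_le_slot[OF this Xs i] UV] show ?thesis
      by (simp only: comp length_list_update)
  qed
  ultimately show ?thesis
    unfolding additive_cochains_def by blast
qed

lemma multidiff_multidiffs:
  assumes c: "c \<in> multidiff M E p"
  shows "c \<in> multidiffs M E"
proof (rule multidiffsI)
  have zero: "c Xs = 0" if "length Xs \<noteq> p" for Xs
    using c that by (auto simp: multidiff_def)
  then have "component p c = c"
    by (auto simp: component_def)
  moreover have "component q c = 0" if "q \<noteq> p" for q
    using zero that by (auto simp: component_def)
  ultimately show "component q c \<in> multidiff M E q" for q
    using c multidiff_zero by (cases "q = p") auto
  show "component q c = 0" if "q \<notin> {p}" for q
    using zero that by (auto simp: component_def)
qed simp

lemma multidiffs_cochains: "c \<in> multidiffs M E \<Longrightarrow> c \<in> cochains"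
  by (intro additive_cochains_cochains multidiffs_additive_cochains)

section \<open>Graded derivations and the Cartan identities\<close>

lemma grade_involution_multidiff:
  assumes "a \<in> multidiff M E p"
  shows "grade_involution a = koszul_sign (int p) *\<^sub>R a"
proof
  fix Xs
  have "a Xs = 0" if "length Xs \<noteq> p"
    using assms that by (auto simp: multidiff_def)
  then show "grade_involution a Xs = (koszul_sign (int p) *\<^sub>R a) Xs"
    by (cases "length Xs = p") (auto simp: grade_involution_def koszul_sign_def fun_eq_iff)
qed

lemma lie_scaleR:
  assumes "X \<in> S" "a \<in> cochains"
  shows "lie X (r *\<^sub>R a) = r *\<^sub>R lie X a"
proof
  fix Xs show "lie X (r *\<^sub>R a) Xs = (r *\<^sub>R lie X a) Xs"
    using act_scaleR[OF assms(1) cochains_C'[OF assms(2), of Xs]]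
    by (simp add: lie_def scaleR_diff_right scaleR_sum_right)
qed

lemma graded_derivation_coboundary: "graded_derivation M E 1 d"
  unfolding graded_derivation_def linear_between_def
proof (intro conjI allI ballI)
  show "d ` multidiffs M E \<subseteq> multidiffs M E"
    using multidiffs_coboundary by blast
  fix a b assume "a \<in> multidiffs M E" "b \<in> multidiffs M E"
  then show "d (a + b) = d a + d b"
    by (intro coboundary_add multidiffs_cochains)
next
  fix r a assume "a \<in> multidiffs M E"
  then show "d (r *\<^sub>R a) = r *\<^sub>R d a"
    by (intro coboundary_scaleR multidiffs_cochains)
next
  fix p c assume "c \<in> multidiff M E p"
  moreover have "nat (int p + 1) = Suc p"
    by simp
  ultimately show "if 0 \<le> int p + 1 then d c \<in> multidiff M E (nat (int p + 1)) else d c = 0"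
    using multidiff_coboundary by simp
next
  fix p a b assume a: "a \<in> multidiff M E p" and b: "b \<in> multidiffs M E"
  show "d (a \<pitchfork> b) = d a \<pitchfork> b + koszul_sign (1 * int p) *\<^sub>R (a \<pitchfork> d b)"
    using coboundary_shuffle_prod[OF multidiffs_cochains[OF multidiff_multidiffs[OF a]] multidiffs_cochains[OF b]]
    by (simp only: grade_involution_multidiff[OF a] shuffle_prod_scaleR_left mult_1)
qed

lemma graded_derivation_contraction:
  assumes X: "X \<in> S"
  shows "graded_derivation M E (-1) (contraction X)"
  unfolding graded_derivation_def linear_between_def
proof (intro conjI allI ballI)
  show "contraction X ` multidiffs M E \<subseteq> multidiffs M E"
    using multidiffs_contraction[OF X] by blast
next
  fix p c assume c: "c \<in> multidiff M E p"
  show "if 0 \<le> int p + - 1 then contraction X c \<in> multidiff M E (nat (int p + - 1))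
      else contraction X c = 0"
    using c contraction_multidiff_zero multidiff_contraction[OF X] by (cases p) auto
next
  fix p a b assume a: "a \<in> multidiff M E p" and b: "b \<in> multidiffs M E"
  have "koszul_sign (- 1 * int p) = koszul_sign (int p)"
    by (simp add: koszul_sign_def)
  then show "contraction X (a \<pitchfork> b) =
      contraction X a \<pitchfork> b + koszul_sign (- 1 * int p) *\<^sub>R (a \<pitchfork> contraction X b)"
    by (simp only: contraction_shuffle_prod grade_involution_multidiff[OF a] shuffle_prod_scaleR_left)
qed (simp_all only: contraction_add contraction_scaleR)

lemma graded_derivation_lie_derivative:
  assumes X: "X \<in> S"
  shows "graded_derivation M E 0 (L X)"
  unfolding graded_derivation_def linear_between_def
proof (intro conjI allI ballI)
  show "L X ` multidiffs M E \<subseteq> multidiffs M E"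
    unfolding lie_derivative_def
    using multidiffs_add multidiffs_coboundary multidiffs_contraction[OF X] by blast
  fix a b assume "a \<in> multidiffs M E" "b \<in> multidiffs M E"
  then show "L X (a + b) = L X a + L X b"
    unfolding lie_derivative_eq[OF X] by (intro lie_add multidiffs_cochains X)
next
  fix r a assume "a \<in> multidiffs M E"
  then show "L X (r *\<^sub>R a) = r *\<^sub>R L X a"
    unfolding lie_derivative_eq[OF X] by (intro lie_scaleR multidiffs_cochains X)
next
  fix p c assume "c \<in> multidiff M E p"
  then show "if 0 \<le> int p + 0 then L X c \<in> multidiff M E (nat (int p + 0)) else L X c = 0"
    unfolding lie_derivative_eq[OF X] using multidiff_lie[OF X] by simp
next
  fix p a b assume a: "a \<in> multidiff M E p" and b: "b \<in> multidiffs M E"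
  have "koszul_sign (0 * int p) *\<^sub>R (a \<pitchfork> lie X b) = a \<pitchfork> lie X b"
    by (simp add: koszul_sign_def)
  then show "L X (a \<pitchfork> b) = L X a \<pitchfork> b + koszul_sign (0 * int p) *\<^sub>R (a \<pitchfork> L X b)"
    unfolding lie_derivative_eq[OF X]
    using lie_shuffle_prod[OF X multidiffs_cochains[OF multidiff_multidiffs[OF a]] multidiffs_cochains[OF b]]
    by (simp only:)
qed

end

theorem theorem8p10:
  fixes M :: "('m, 'b::real_inner) mfd"
    and E :: "('m, 'e::real_vector, 'v::real_inner) vbundle"
    and br :: "('m \<Rightarrow> 'e) \<Rightarrow> ('m \<Rightarrow> 'e) \<Rightarrow> ('m \<Rightarrow> 'e)"
    and \<rho> :: "'m \<Rightarrow> 'e \<Rightarrow> 'm tvec"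
    and \<alpha> :: "'m \<Rightarrow> 'e \<Rightarrow> ('m tvec \<Rightarrow> real) \<Rightarrow> 'e \<Rightarrow> 'e"
    and d :: "('m, 'e) cochain \<Rightarrow> ('m, 'e) cochain"
    and \<iota> L :: "('m \<Rightarrow> 'e) \<Rightarrow> ('m, 'e) cochain \<Rightarrow> ('m, 'e) cochain"
    and X Y :: "'m \<Rightarrow> 'e"
  defines "d \<equiv> coboundary M E br \<rho>"
    and "\<iota> \<equiv> contraction"
    and "L \<equiv> lie_derivative M E br \<rho>"
  assumes "loday_algebroid M E br \<rho> \<alpha>"
    and "X \<in> Sec M E" and "Y \<in> Sec M E"
  shows "graded_derivation M E 1 d \<and>
         graded_derivation M E (-1) (\<iota> X) \<and>
         graded_derivation M E 0 (L X) \<and>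
         (\<forall>c\<in>multidiffs M E.
           \<comment> \<open>(a)\<close>
           (2 *\<^sub>R d (d c) = supercomm 1 d 1 d c \<and> supercomm 1 d 1 d c = 0) \<and>
           \<comment> \<open>(b)\<close>
           (L X c = supercomm 1 d (-1) (\<iota> X) c \<and>
            supercomm 1 d (-1) (\<iota> X) c = d (\<iota> X c) + \<iota> X (d c)) \<and>
           \<comment> \<open>(c)\<close>
           (d (L X c) - L X (d c) = supercomm 1 d 0 (L X) c \<and>
            supercomm 1 d 0 (L X) c = 0) \<and>
           \<comment> \<open>(d)\<close>
           (L X (\<iota> Y c) - \<iota> Y (L X c) = supercomm 0 (L X) (-1) (\<iota> Y) c \<and>
            supercomm 0 (L X) (-1) (\<iota> Y) c = \<iota> (br X Y) c) \<and>
           \<comment> \<open>(e)\<close>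
           (L X (L Y c) - L Y (L X c) = supercomm 0 (L X) 0 (L Y) c \<and>
            supercomm 0 (L X) 0 (L Y) c = L (br X Y) c))"
proof -
  interpret loday M E br \<rho> \<alpha>
    by standard fact
  note X = \<open>X \<in> Sec M E\<close> and Y = \<open>Y \<in> Sec M E\<close>
  have even: "supercomm d P e Q c = P (Q c) - Q (P c)" if "even (d * e)"
    for d e and P Q :: "('m, 'e) cochain \<Rightarrow> ('m, 'e) cochain" and c
    using that by (simp only: supercomm_def koszul_sign_def if_True scaleR_one)
  have odd: "supercomm d P e Q c = P (Q c) + Q (P c)" if "odd (d * e)"
    for d e and P Q :: "('m, 'e) cochain \<Rightarrow> ('m, 'e) cochain" and c
    using that by (simp only: supercomm_def koszul_sign_def if_False scaleR_minus1_left diff_minus_eq_add)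
  show ?thesis
    unfolding d_def \<iota>_def L_def
  proof (intro conjI ballI graded_derivation_coboundary graded_derivation_contraction
      graded_derivation_lie_derivative X)
    fix c assume "c \<in> multidiffs M E"
    \<comment> \<open>Identities (a), (c) and (e) rest on the Jacobi identity and hence on
      additivity; (d) is the recursion \<open>contraction_lie\<close> on \<open>cochains\<close>,
      and (b) unfolds the definition of the Lie derivative.\<close>
    then have c: "c \<in> additive_cochains" and c': "c \<in> cochains"
      using multidiffs_additive_cochains multidiffs_cochains by blast+
    let ?d = "coboundary M E br \<rho>" and ?L = "lie_derivative M E br \<rho>"
    have dd: "?d (?d c) = 0"
      by (rule coboundary_coboundary[OF c])
    have Ld: "?d (?L X c) = ?L X (?d c)"
      unfolding lie_derivative_eq[OF X] by (rule coboundary_lie[OF X c])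
    show "2 *\<^sub>R ?d (?d c) = supercomm 1 ?d 1 ?d c" "supercomm 1 ?d 1 ?d c = 0"
      by (simp_all add: odd dd)
    show "?L X c = supercomm 1 ?d (-1) (contraction X) c"
      "supercomm 1 ?d (-1) (contraction X) c = ?d (contraction X c) + contraction X (?d c)"
      by (simp_all add: odd lie_derivative_def)
    show "?d (?L X c) - ?L X (?d c) = supercomm 1 ?d 0 (?L X) c" "supercomm 1 ?d 0 (?L X) c = 0"
      by (simp_all add: even Ld)
    show "?L X (contraction Y c) - contraction Y (?L X c) = supercomm 0 (?L X) (-1) (contraction Y) c"
      by (simp add: even)
    show "supercomm 0 (?L X) (-1) (contraction Y) c = contraction (br X Y) c"
      by (simp add: even lie_derivative_eq[OF X] contraction_lie[OF X Y c'])
    show "?L X (?L Y c) - ?L Y (?L X c) = supercomm 0 (?L X) 0 (?L Y) c"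
      by (simp add: even)
    show "supercomm 0 (?L X) 0 (?L Y) c = ?L (br X Y) c"
      using lie_commutator[OF X Y c]
      by (simp add: even lie_derivative_eq[OF X] lie_derivative_eq[OF Y] lie_derivative_eq[OF br_S[OF X Y]])
  qed
qed

end
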